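(* Let $X$ ($m\times p$) and $S$ ($p\times p$) be independent with $X\sim \mathcal N_{m\times p}(\Theta, I_m\otimes\Sigma)$ and $S\sim\mathcal W_p(n,\Sigma)$. Assume $p>m+1$ and $n\ge p$. For positive constants $\alpha,\beta$ let $\widehat\Sigma_0=n^{-1}S$ and $$\widehat\Theta^{G}=X-\alpha X\{I_p+\beta S^{-1}X^\top X\}^{-1},\qquad \widehat\Sigma^{G1}=\widehat\Sigma_0+n^{-1}\alpha X^\top\{I_m+\beta XS^{-1}X^\top\}^{-1}X.$$ If $$\frac{\alpha}{\beta}\le\frac{2(p-m-1)}{n-p+2m+1},$$ then the estimator $(\widehat\Theta^G,\widehat\Sigma^{G1})$ of $(\Theta,\Sigma)$ dominates $(X,\widehat\Sigma_0)$ relative to the Kullback-Leibler divergence.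
   Context: $\mathcal N_{m\times p}(\Theta,I_m\otimes\Sigma)$ is the distribution of an $m\times p$ matrix with mean $\Theta$ and independent normal rows with covariance $\Sigma$ ($p\times p$ positive definite), with density $\phi(\cdot\mid\Theta,\Sigma)$; $\mathcal W_p(n,\Sigma)$ is the Wishart distribution with $n$ degrees of freedom and scale $\Sigma$. Both $\Theta$ and $\Sigma$ are unknown. The Kullback-Leibler loss of $(\widehat\Theta,\widehat\Sigma)$ is $$D_{KL}=\int\log\frac{\phi(Y\mid\widehat\Theta,\widehat\Sigma)}{\phi(Y\mid\Theta,\Sigma)}\,\phi(Y\mid\widehat\Theta,\widehat\Sigma)\,dY=\frac m2\{\mathrm{tr}(\widehat\Sigma\Sigma^{-1})-\log|\widehat\Sigma\Sigma^{-1}|-p\}+\frac12\mathrm{tr}\{(\widehat\Theta-\Theta)\Sigma^{-1}(\widehat\Theta-\Theta)^\top\},$$ and the risk is its expectation over $(X,S)$. One estimator dominates another if its risk is at most that of the other for all $(\Theta,\Sigma)$ with strict inequality for some $(\Theta,\Sigma)$. *)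

theory Defs
  imports "HOL-Probability.Probability"
begin

definition pos_def :: "real^'p^'p \<Rightarrow> bool" where
  "pos_def A \<longleftrightarrow> transpose A = A \<and> (\<forall>x. x \<noteq> 0 \<longrightarrow> x \<bullet> (A *v x) > 0)"

text \<open>
  An \<open>m \<times> p\<close> matrix has type \<open>real^'p^'m\<close>, with \<open>m = CARD('m)\<close> and \<open>p = CARD('p)\<close>.
  The density of \<open>N(\<Theta>, I \<otimes> \<Sigma>)\<close> is the product of the densities of the \<open>m\<close> independent rows;
  it is meant for positive definite \<open>\<Sigma>\<close>.
\<close>

definition matrix_normal_density ::
    "real^'p^'m \<Rightarrow> real^'p^'p \<Rightarrow> real^'p^'m \<Rightarrow> real" where
  "matrix_normal_density \<Theta> \<Sigma> Y =
     (2 * pi) powr (- (real CARD('m) * real CARD('p)) / 2) * det \<Sigma> powr (- real CARD('m) / 2) *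
     exp (- trace ((Y - \<Theta>) ** matrix_inv \<Sigma> ** transpose (Y - \<Theta>)) / 2)"

definition matrix_normal :: "real^'p^'m \<Rightarrow> real^'p^'p \<Rightarrow> (real^'p^'m) measure" where
  "matrix_normal \<Theta> \<Sigma> = density lborel (\<lambda>Y. ennreal (matrix_normal_density \<Theta> \<Sigma> Y))"

text \<open>
  The Wishart distribution with integer degrees of freedom: the law of the sum of
  \<open>z\<^sub>i\<^sup>T z\<^sub>i\<close> over \<open>n\<close> independent centred normal row vectors (\<open>1 \<times> p\<close> matrices)
  \<open>z\<^sub>i\<close> with covariance \<open>\<Sigma>\<close>.
\<close>

definition wishart :: "nat \<Rightarrow> real^'p^'p \<Rightarrow> (real^'p^'p) measure" where
  "wishart n \<Sigma> =
     distr (Pi\<^sub>M {..<n} (\<lambda>_. matrix_normal (0 :: real^'p^1) \<Sigma>)) borel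
       (\<lambda>z. \<Sum>i<n. transpose (z i) ** z i)"

definition kl_loss ::
    "(real^'p^'m) \<times> (real^'p^'p) \<Rightarrow> real^'p^'m \<Rightarrow> real^'p^'p \<Rightarrow> real" where
  "kl_loss est \<Theta> \<Sigma> = (case est of (\<Theta>', \<Sigma>') \<Rightarrow>
     LINT Y|lborel. ln (matrix_normal_density \<Theta>' \<Sigma>' Y / matrix_normal_density \<Theta> \<Sigma> Y) *
       matrix_normal_density \<Theta>' \<Sigma>' Y)"

text \<open>
  An estimator maps the observation \<open>(X, S)\<close> to a pair \<open>(\<Theta>', \<Sigma>')\<close>. Independence of \<open>X\<close> and
  \<open>S\<close> is expressed by the product measure. The loss is nonnegative when \<open>\<Sigma>'\<close> is positive
  definite, so the risk is taken as a \<open>[0,\<infinity>]\<close>-valued expectation; an infinite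
  risk is thus not confused with the default value \<open>0\<close> of the Bochner integral.
\<close>

type_synonym ('m, 'p) estimator =
  "real^'p^'m \<Rightarrow> real^'p^'p \<Rightarrow> (real^'p^'m) \<times> (real^'p^'p)"

definition risk ::
    "nat \<Rightarrow> ('m::finite, 'p::finite) estimator \<Rightarrow> real^'p^'m \<Rightarrow> real^'p^'p \<Rightarrow> ennreal" where
  "risk n \<delta> \<Theta> \<Sigma> =
     (\<integral>\<^sup>+ (X, S). ennreal (kl_loss (\<delta> X S) \<Theta> \<Sigma>) \<partial>(matrix_normal \<Theta> \<Sigma> \<Otimes>\<^sub>M wishart n \<Sigma>))"

definition dominates ::
    "nat \<Rightarrow> ('m::finite, 'p::finite) estimator \<Rightarrow> ('m, 'p) estimator \<Rightarrow> bool" where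
  "dominates n \<delta> \<delta>' \<longleftrightarrow>
     (\<forall>\<Theta> \<Sigma>. pos_def \<Sigma> \<longrightarrow> risk n \<delta> \<Theta> \<Sigma> \<le> risk n \<delta>' \<Theta> \<Sigma>) \<and>
     (\<exists>\<Theta> \<Sigma>. pos_def \<Sigma> \<and> risk n \<delta> \<Theta> \<Sigma> < risk n \<delta>' \<Theta> \<Sigma>)"

definition Sigma_hat0 :: "nat \<Rightarrow> real^'p^'p \<Rightarrow> real^'p^'p" where
  "Sigma_hat0 n S = (1 / real n) *\<^sub>R S"

definition Theta_G ::
    "real \<Rightarrow> real \<Rightarrow> real^'p^'m \<Rightarrow> real^'p^'p \<Rightarrow> real^'p^'m" where
  "Theta_G \<alpha> \<beta> X S =
     X - \<alpha> *\<^sub>R (X ** matrix_inv (mat 1 + \<beta> *\<^sub>R (matrix_inv S ** transpose X ** X)))"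

definition Sigma_G1 ::
    "nat \<Rightarrow> real \<Rightarrow> real \<Rightarrow> real^'p^'m \<Rightarrow> real^'p^'p \<Rightarrow> real^'p^'p" where
  "Sigma_G1 n \<alpha> \<beta> X S =
     Sigma_hat0 n S + (\<alpha> / real n) *\<^sub>R
       (transpose X ** matrix_inv (mat 1 + \<beta> *\<^sub>R (X ** matrix_inv S ** transpose X)) ** X)"

end

theory Submission imports Defs begin

text \<open>
  Write \<open>M = X\<^sup>T X\<close>, \<open>P = (S + \<beta> M)\<^sup>-\<^sup>1\<close>, \<open>Q = \<Sigma>\<^sup>-\<^sup>1\<close>, \<open>K = \<beta> X P X\<^sup>T\<close> and \<open>G = I - K\<close>.
  Pushing \<open>X\<close> through the inverses (\<open>G_inverse\<close>, \<open>Theta_G_eq\<close>, \<open>Sigma_G1_eq\<close>) gives the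
  estimators the form \<open>X - \<alpha> Z\<close> and \<open>(S + \<alpha> H)/n\<close>, where \<open>Z = X P S = G X\<close> and
  \<open>H = M P S = X\<^sup>T G X\<close>. By the closed form of the loss (\<open>kl_loss_eq\<close>), twice the loss
  difference is
  \<open>m {(\<alpha>/n) tr(Q H) - log(det(S + \<alpha> H)/det S)} - 2\<alpha> tr((X - \<Theta>) Q Z\<^sup>T) + \<alpha>\<^sup>2 tr(Z Q Z\<^sup>T)\<close>.

  The unknown \<open>\<Theta>\<close> and \<open>Q\<close> can be removed under the expectation. For fixed \<open>S\<close>, Stein's identity
  for the normal matrix \<open>X\<close> (\<open>field1_stein\<close>) replaces the cross term by the divergence of
  \<open>X \<mapsto> Z\<close>; for fixed \<open>X\<close>, two Stein-Haff identities for the Wishart matrix \<open>S\<close> (\<open>stein_haff\<close>)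
  replace \<open>tr(Q M P S)\<close> and \<open>tr(Q M P M P S)\<close>. What remains is a function of
  \<open>k\<^sub>j = tr K\<^sup>j\<close> for \<open>j \<le> 3\<close> and of the log-determinant, and it is negative at every sample point
  (\<open>risk_difference_negative\<close>). Three facts enter. The eigenvalues of \<open>K\<close> lie in \<open>[0,1)\<close>.
  With \<open>c = \<alpha>/\<beta>\<close>, the eigenvalues of \<open>\<alpha> S\<^sup>-\<^sup>1 H\<close> lie in \<open>[0,c]\<close> and have sum \<open>c k\<^sub>1\<close>, so that
  \<open>log(1+x) \<ge> 2x/(2+x)\<close> bounds the log-determinant below by \<open>2c k\<^sub>1/(2+c)\<close>. The bound on \<open>c\<close>
  then makes the covariance part nonpositive and the mean part negative, separately.

  Hence the risk is strictly smaller at every \<open>(\<Theta>,\<Sigma>)\<close>, provided that the risks are finite and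
  all integrals above exist. This needs \<open>S\<close> to be almost surely nonsingular with integrable
  \<open>log det S\<close>, which holds because \<open>n \<ge> p\<close>
  (\<open>gram_pos_def_and_ln_det_integrable\<close>). Integration by parts comes from translation invariance of Lebesgue measure
  (\<open>integral_directional_derivative_0\<close>), and the Stein-Haff identities come from Stein's
  identity in one row at a time of the Gaussian sample whose Gram matrix is \<open>S\<close>. Such a row sees
  the possibly singular Gram matrix of the other rows, so \<open>\<beta> M\<close> is first replaced by the
  positive definite \<open>\<epsilon> I + \<beta> M\<close>, and \<open>\<epsilon>\<close> tends to \<open>0\<close> at the end.
\<close>

section \<open>Matrix algebra\<close>

lemma bounded_bilinear_matrix_mult:
  "bounded_bilinear ((**) :: real^'n^'m \<Rightarrow> real^'p^'n \<Rightarrow> real^'p^'m)"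
  unfolding bilinear_conv_bounded_bilinear[symmetric] bilinear_def
  by (auto intro!: linearI simp: matrix_matrix_mult_def vec_eq_iff sum.distrib algebra_simps
      sum_distrib_left)

interpretation mm: bounded_bilinear "(**) :: real^'n^'m \<Rightarrow> real^'p^'n \<Rightarrow> real^'p^'m"
  by (rule bounded_bilinear_matrix_mult)

lemma bounded_linear_transpose: "bounded_linear (transpose :: real^'n^'m \<Rightarrow> real^'m^'n)"
  unfolding linear_conv_bounded_linear[symmetric]
  by (auto intro!: linearI simp: transpose_def vec_eq_iff)

lemmas transpose_add = linear_add[OF bounded_linear.linear[OF bounded_linear_transpose]]
lemmas transpose_diff = linear_diff[OF bounded_linear.linear[OF bounded_linear_transpose]]
lemmas transpose_minus = linear_neg[OF bounded_linear.linear[OF bounded_linear_transpose]]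

lemma bounded_linear_trace: "bounded_linear (trace :: real^'n^'n \<Rightarrow> real)"
  unfolding linear_conv_bounded_linear[symmetric]
  by (auto intro!: linearI simp: trace_def sum.distrib sum_distrib_left)

lemmas trace_scaleR = linear_scale[OF bounded_linear.linear[OF bounded_linear_trace]]
lemmas trace_sum = linear_sum[OF bounded_linear.linear[OF bounded_linear_trace]]

lemmas mat_distrib = mm.add_left mm.add_right mm.diff_left mm.diff_right mm.scaleR_left
  mm.scaleR_right mm.minus_left mm.minus_right transpose_add transpose_diff transpose_scalar transpose_minus
  matrix_transpose_mul

lemma inner_matrix_trace: "(Y :: real^'p^'m) \<bullet> Z = trace (Y ** transpose Z)"
  by (simp add: inner_vec_def trace_def matrix_matrix_mult_def transpose_def)

lemma inner_transpose: "transpose (Y :: real^'p^'m) \<bullet> transpose Z = Y \<bullet> Z"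
proof -
  have "transpose Y \<bullet> transpose Z = trace (transpose Y ** Z)"
    unfolding inner_matrix_trace transpose_transpose ..
  also have "\<dots> = trace (Z ** transpose Y)" by (rule trace_mul_sym)
  also have "\<dots> = Z \<bullet> Y" by (rule inner_matrix_trace[symmetric])
  also have "\<dots> = Y \<bullet> Z" by (rule inner_commute)
  finally show ?thesis .
qed

lemma inner_matrix_mult_right: "(Y ** A) \<bullet> (Z :: real^'p^'m) = Y \<bullet> (Z ** transpose A)"
  by (simp add: inner_matrix_trace matrix_transpose_mul matrix_mul_assoc)

text \<open>
  The Frobenius norm is submultiplicative: Cauchy-Schwarz for each entry of the product.
\<close>
lemma norm_matrix_mult_le: "norm ((A :: real^'n^'m) ** (B :: real^'p^'n)) \<le> norm A * norm B"
proof -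
  have 1: "(norm C)\<^sup>2 = (\<Sum>i\<in>UNIV. (norm (C $ i))\<^sup>2)" for C :: "real^'a^'b"
    by (simp add: power2_norm_eq_inner inner_vec_def)
  have 2: "(norm C)\<^sup>2 = (\<Sum>j\<in>UNIV. (norm (transpose C $ j))\<^sup>2)" for C :: "real^'a^'b"
    by (simp only: 1[symmetric]) (simp add: power2_norm_eq_inner inner_transpose)
  have "(norm (A ** B))\<^sup>2 = (\<Sum>i\<in>UNIV. \<Sum>j\<in>UNIV. (A $ i \<bullet> transpose B $ j)\<^sup>2)"
    by (simp only: power2_norm_eq_inner)
      (simp add: inner_vec_def matrix_matrix_mult_def transpose_def power2_eq_square)
  also have "\<dots> \<le> (\<Sum>i\<in>UNIV. \<Sum>j\<in>UNIV. (norm (A $ i))\<^sup>2 * (norm (transpose B $ j))\<^sup>2)"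
    by (intro sum_mono) (metis Cauchy_Schwarz_ineq power2_norm_eq_inner)
  also have "\<dots> = (norm A)\<^sup>2 * (norm B)\<^sup>2"
    by (simp add: 1[of A] 2[of B] sum_product)
  finally show ?thesis
    using power2_le_imp_le[of "norm (A ** B)" "norm A * norm B"] by (simp add: power_mult_distrib)
qed

lemma norm_transpose [simp]: "norm (transpose (A :: real^'n^'m)) = norm A"
  by (simp only: norm_eq_sqrt_inner inner_transpose)

lemma inner_matrix_vector: "x \<bullet> ((A :: real^'n^'m) *v y) = (transpose A *v x) \<bullet> y"
  by (simp only: transpose_matrix_vector dot_lmul_matrix)

lemma matrix_inv_both:
  assumes "invertible (A :: real^'n^'n)"
  shows "A ** matrix_inv A = mat 1 \<and> matrix_inv A ** A = mat 1"
  unfolding matrix_inv_def by (rule someI_ex) (use assms in \<open>simp only: invertible_def\<close>)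

lemma matrix_inv_left: "invertible (A :: real^'n^'n) \<Longrightarrow> matrix_inv A ** A = mat 1"
  and matrix_inv_right: "invertible (A :: real^'n^'n) \<Longrightarrow> A ** matrix_inv A = mat 1"
  using matrix_inv_both by blast+

lemma matrix_inv_unique:
  assumes "(A :: real^'n^'n) ** B = mat 1" shows "matrix_inv A = B"
proof -
  have "B ** A = mat 1" using assms by (simp add: matrix_left_right_inverse)
  then have "invertible A" using assms unfolding invertible_def by blast
  then have "B = (matrix_inv A ** A) ** B" by (simp add: matrix_inv_left)
  also have "\<dots> = matrix_inv A ** (A ** B)" by (simp only: matrix_mul_assoc)
  finally show ?thesis by (simp add: assms)
qed

lemma matrix_inv_mult:
  assumes "invertible (A :: real^'n^'n)" "invertible (B :: real^'n^'n)"
  shows "matrix_inv (A ** B) = matrix_inv B ** matrix_inv A"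
proof (rule matrix_inv_unique)
  have "A ** B ** (matrix_inv B ** matrix_inv A) = A ** (B ** matrix_inv B) ** matrix_inv A"
    by (simp only: matrix_mul_assoc)
  then show "A ** B ** (matrix_inv B ** matrix_inv A) = mat 1"
    by (simp add: matrix_inv_right assms)
qed

lemma invertible_matrix_inv: "invertible (A :: real^'n^'n) \<Longrightarrow> invertible (matrix_inv A)"
  using matrix_inv_left matrix_inv_right unfolding invertible_def by blast

lemma transpose_matrix_inv:
  assumes "invertible (A :: real^'n^'n)"
  shows "transpose (matrix_inv A) = matrix_inv (transpose A)"
  by (rule matrix_inv_unique[symmetric])
     (simp only: matrix_transpose_mul[symmetric] matrix_inv_left[OF assms] transpose_mat)

lemma inv_cancel:
  assumes "invertible (A :: real^'n^'n)"
  shows "X ** A ** matrix_inv A = X" "X ** matrix_inv A ** A = X"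
    "A ** (matrix_inv A ** Y) = Y" "matrix_inv A ** (A ** Y) = Y"
proof -
  show "X ** A ** matrix_inv A = X" "X ** matrix_inv A ** A = X"
    by (simp_all only: matrix_mul_assoc[symmetric] matrix_inv_right[OF assms] matrix_inv_left[OF assms]
      matrix_mul_rid)
  show "A ** (matrix_inv A ** Y) = Y" "matrix_inv A ** (A ** Y) = Y"
    by (simp_all only: matrix_mul_assoc matrix_inv_right[OF assms] matrix_inv_left[OF assms]
      matrix_mul_lid)
qed

section \<open>The spectral theorem for real symmetric matrices\<close>

text \<open>
  The maximiser of the Rayleigh quotient on the unit sphere of \<open>V\<close> is an eigenvector: its residual
  \<open>r = A x - c x\<close> lies in \<open>V\<close>, and moving from \<open>x\<close> in the direction \<open>r\<close> would increase the quotient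
  to first order unless \<open>r = 0\<close>.
\<close>
lemma symmetric_eigenvector_in_subspace:
  fixes A :: "real^'n^'n"
  assumes A: "transpose A = A" and V: "subspace V" and inv: "\<And>x. x \<in> V \<Longrightarrow> A *v x \<in> V"
    and z: "z \<in> V" "z \<noteq> 0"
  shows "\<exists>x\<in>V. \<exists>c. norm x = 1 \<and> A *v x = c *\<^sub>R x"
proof -
  define K where "K = V \<inter> sphere 0 1"
  have "compact K" unfolding K_def
    by (intro closed_Int_compact closed_subspace V compact_sphere)
  moreover have "(1 / norm z) *\<^sub>R z \<in> K"
    using z V by (auto simp: K_def subspace_scale)
  moreover have "continuous_on K (\<lambda>x. x \<bullet> (A *v x))"
    by (intro continuous_intros)
  ultimately obtain x where x: "x \<in> K" "\<And>y. y \<in> K \<Longrightarrow> y \<bullet> (A *v y) \<le> x \<bullet> (A *v x)"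
    using continuous_attains_sup[of K "\<lambda>x. x \<bullet> (A *v x)"] by blast
  define c where "c = x \<bullet> (A *v x)"
  have xV: "x \<in> V" "norm x = 1" using x by (auto simp: K_def)
  have q: "y \<bullet> (A *v y) \<le> c * (y \<bullet> y)" if "y \<in> V" for y
  proof (cases "y = 0")
    case False
    have "(1 / norm y) *\<^sub>R y \<in> K" using that False V by (auto simp: K_def subspace_scale)
    from x(2)[OF this] show ?thesis using False
      by (simp add: c_def matrix_vector_mult_scaleR field_simps power2_norm_eq_inner[symmetric]
          power2_eq_square)
  qed simp
  define r where "r = A *v x - c *\<^sub>R x"
  have rV: "r \<in> V" unfolding r_def by (intro subspace_diff subspace_scale V inv xV)
  have xx: "x \<bullet> x = 1" using xV by (simp add: norm_eq_1)
  have sym: "x \<bullet> (A *v r) = r \<bullet> (A *v x)"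
    by (metis A inner_commute inner_matrix_vector)
  have rx: "r \<bullet> (A *v x) - c * (r \<bullet> x) = r \<bullet> r"
    by (simp add: r_def inner_simps)
  have key: "2 * t * (r \<bullet> r) + t\<^sup>2 * (r \<bullet> (A *v r) - c * (r \<bullet> r)) \<le> 0" for t
  proof -
    have "x + t *\<^sub>R r \<in> V" by (intro subspace_add subspace_scale V xV rV)
    from q[OF this]
    have "c + t * (x \<bullet> (A *v r)) + t * (r \<bullet> (A *v x)) + t * (t * (r \<bullet> (A *v r)))
        \<le> c * (x \<bullet> x) + c * (2 * t * (r \<bullet> x)) + c * (t * (t * (r \<bullet> r)))"
      by (simp add: matrix_vector_right_distrib matrix_vector_mult_scaleR inner_simps c_def
          algebra_simps inner_commute)
    then have "2 * t * (r \<bullet> (A *v x) - c * (r \<bullet> x)) + t * t * (r \<bullet> (A *v r) - c * (r \<bullet> r)) \<le> 0"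
      by (simp add: sym xx algebra_simps)
    then show ?thesis by (simp add: rx power2_eq_square)
  qed
  have "r = 0"
  proof (rule ccontr)
    assume "r \<noteq> 0"
    then have R: "r \<bullet> r > 0" by simp
    define w where "w = r \<bullet> (A *v r) - c * (r \<bullet> r)"
    \<comment> \<open>This step length makes the second-order term at most half of the first-order term.\<close>
    define t where "t = (r \<bullet> r) / (\<bar>w\<bar> + 1)"
    have t: "t > 0" using R by (simp add: t_def)
    have "t * (2 * (r \<bullet> r) + t * w) \<le> 0"
      using key[of t] by (simp add: w_def power2_eq_square algebra_simps)
    with t have "2 * (r \<bullet> r) + t * w \<le> 0" by (simp add: mult_le_0_iff)
    moreover have "t * \<bar>w\<bar> \<le> r \<bullet> r" using R by (simp add: t_def field_simps)
    moreover have "t * w \<ge> - (t * \<bar>w\<bar>)" using t by (simp add: abs_if)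
    ultimately show False using R by linarith
  qed
  then show ?thesis using xV by (auto simp: r_def)
qed

definition diag :: "('n \<Rightarrow> real) \<Rightarrow> real^'n^'n" where
  "diag d = (\<chi> i j. if i = j then d i else 0)"

lemma diag_mult: "diag d ** diag e = diag (\<lambda>i. d i * e i)"
proof -
  have "(\<Sum>k\<in>UNIV. (if i = k then d i else 0) * (if k = j then e k else 0))
      = (\<Sum>k\<in>UNIV. if i = k then d i * (if i = j then e i else 0) else 0)" for i j
    by (intro sum.cong) auto
  then show ?thesis by (simp add: diag_def matrix_matrix_mult_def vec_eq_iff)
qed

lemma transpose_diag [simp]: "transpose (diag d) = diag d"
  by (simp add: diag_def transpose_def vec_eq_iff)

lemma trace_diag: "trace (diag d) = (\<Sum>i\<in>UNIV. d i)"
  by (simp add: diag_def trace_def)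

lemma det_diag: "det (diag d) = (\<Prod>i\<in>UNIV. d i)"
  by (subst det_diagonal) (auto simp: diag_def)

text \<open>
  The orthogonal complement of a family of eigenvectors is invariant, so an orthonormal family of
  eigenvectors can be extended until it is indexed by the whole index type; its members are the rows
  of the orthogonal matrix.
\<close>
theorem symmetric_spectral:
  fixes A :: "real^'n^'n"
  assumes A: "transpose A = A"
  obtains Q :: "real^'n^'n" and d where "Q ** transpose Q = mat 1" "transpose Q ** Q = mat 1"
    "A = transpose Q ** diag d ** Q"
proof -
  define ON :: "'n set \<Rightarrow> ('n \<Rightarrow> real^'n) \<Rightarrow> ('n \<Rightarrow> real) \<Rightarrow> bool"
    where "ON I v d \<longleftrightarrow> (\<forall>i\<in>I. \<forall>j\<in>I. v i \<bullet> v j = (if i = j then 1 else 0)) \<and>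
      (\<forall>i\<in>I. A *v v i = d i *\<^sub>R v i)" for I v d
  have "\<exists>v d. ON I v d" for I :: "'n set"
    using finite[of I]
  proof (induction I rule: finite_induct)
    case (insert k I)
    then obtain v d where "ON I v d" by blast
    then have v: "\<And>i j. i \<in> I \<Longrightarrow> j \<in> I \<Longrightarrow> v i \<bullet> v j = (if i = j then 1 else 0)"
      and d: "\<And>i. i \<in> I \<Longrightarrow> A *v v i = d i *\<^sub>R v i" by (simp_all add: ON_def)
    define V where "V = {y. \<forall>j\<in>I. v j \<bullet> y = 0}"
    have sub: "subspace V" by (auto simp: V_def subspace_def inner_simps)
    have "card (v ` I) \<le> card I" by (simp add: card_image_le)
    also have "\<dots> < card (insert k I)" using insert by simp
    also have "\<dots> \<le> CARD('n)" by (intro card_mono) auto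
    finally have "dim (v ` I) < DIM(real^'n)"
      using dim_le_card'[of "v ` I"] by simp
    then obtain z where z: "z \<noteq> 0" "\<And>y. y \<in> span (v ` I) \<Longrightarrow> orthogonal z y"
      using orthogonal_to_subspace_exists by blast
    have zV: "z \<in> V"
      using z(2)[OF span_base] by (auto simp: V_def orthogonal_def inner_commute[of z])
    have inv: "A *v y \<in> V" if "y \<in> V" for y
    proof -
      have "v j \<bullet> (A *v y) = (A *v v j) \<bullet> y" for j by (metis A inner_matrix_vector)
      then show ?thesis using that d by (auto simp: V_def)
    qed
    obtain x c where x: "x \<in> V" "norm x = 1" "A *v x = c *\<^sub>R x"
      using symmetric_eigenvector_in_subspace[OF A sub inv zV z(1)] by blast
    have "ON (insert k I) (v(k:=x)) (d(k:=c))"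
      unfolding ON_def using v d x insert.hyps by (auto simp: V_def inner_commute norm_eq_1)
    then show ?case by blast
  qed (simp add: ON_def)
  from this[of UNIV] obtain v d where "ON UNIV v d" by blast
  then have vd: "(\<forall>i\<in>UNIV. \<forall>j\<in>UNIV. v i \<bullet> v j = (if i = j then 1 else 0)) \<and>
      (\<forall>i\<in>UNIV. A *v v i = d i *\<^sub>R v i)"
    by (simp only: ON_def)
  have v: "v i \<bullet> v j = (if i = j then 1 else 0)" for i j using vd by simp
  have d: "A *v v i = d i *\<^sub>R v i" for i using vd by simp
  define Q :: "real^'n^'n" where "Q = (\<chi> i. v i)"
  have 1: "Q ** transpose Q = mat 1"
    by (simp add: matrix_mult_transpose_dot_row row_def Q_def v mat_def vec_eq_iff)
  then have 2: "transpose Q ** Q = mat 1"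
    by (simp add: matrix_left_right_inverse)
  have "A $ i \<bullet> v j = v j $ i * d j" for i j
  proof -
    have "(A *v v j) $ i = d j * v j $ i" by (simp add: d)
    then show ?thesis by (simp add: matrix_vector_mul_component mult.commute)
  qed
  moreover have "(transpose Q ** diag d) $ i $ j = v j $ i * d j" for i j
  proof -
    have "(transpose Q ** diag d) $ i $ j = (\<Sum>k\<in>UNIV. if k = j then v j $ i * d j else 0)"
      unfolding matrix_matrix_mult_def transpose_def Q_def diag_def
      by (simp only: vec_lambda_beta, intro sum.cong) auto
    then show ?thesis by simp
  qed
  moreover have "(A ** transpose Q) $ i $ j = A $ i \<bullet> v j" for i j
    by (simp add: matrix_matrix_mult_def transpose_def Q_def inner_vec_def)
  ultimately have "A ** transpose Q = transpose Q ** diag d" by (simp add: vec_eq_iff)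
  then have "A ** transpose Q ** Q = transpose Q ** diag d ** Q" by simp
  then have "A = transpose Q ** diag d ** Q"
    by (simp only: matrix_mul_assoc[symmetric] 2 matrix_mul_rid)
  with 1 2 show ?thesis using that by blast
qed

section \<open>Positive semidefinite matrices\<close>

definition psd :: "real^'p^'p \<Rightarrow> bool" where
  "psd A \<longleftrightarrow> transpose A = A \<and> (\<forall>x. 0 \<le> x \<bullet> (A *v x))"

lemma pos_def_imp_psd: "pos_def A \<Longrightarrow> psd A"
  unfolding pos_def_def psd_def by (metis inner_zero_left less_eq_real_def)

lemma psd_add: "psd A \<Longrightarrow> psd B \<Longrightarrow> psd (A + B)"
  by (simp add: psd_def transpose_add matrix_vector_mult_add_rdistrib inner_add_right)

lemma psd_scaleR: "psd A \<Longrightarrow> 0 \<le> c \<Longrightarrow> psd (c *\<^sub>R A)"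
  by (simp add: psd_def transpose_scalar scaleR_matrix_vector_assoc[symmetric])

lemma pos_def_add: "pos_def A \<Longrightarrow> psd B \<Longrightarrow> pos_def (A + B)"
  by (auto simp: psd_def pos_def_def transpose_add matrix_vector_mult_add_rdistrib inner_add_right
      intro: add_pos_nonneg)

lemma pos_def_scaleR: "pos_def A \<Longrightarrow> 0 < c \<Longrightarrow> pos_def (c *\<^sub>R A)"
  by (simp add: pos_def_def transpose_scalar scaleR_matrix_vector_assoc[symmetric])

lemma mat_eq_scaleR: "(mat c :: real^'n^'n) = c *\<^sub>R mat 1"
  by (simp add: mat_def vec_eq_iff)

lemma pos_def_mat: "0 < c \<Longrightarrow> pos_def (mat c)"
  by (simp add: pos_def_def mat_eq_scaleR[of c] scaleR_matrix_vector_assoc[symmetric] transpose_scalar)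

lemma psd_0: "psd 0" by (simp add: psd_def transpose_def vec_eq_iff)

lemma quadratic_form_congruence:
  "x \<bullet> ((transpose C ** A ** C) *v x) = (C *v x) \<bullet> ((A :: real^'n^'n) *v (C *v x))"
  by (simp only: inner_matrix_vector[of "C *v x"] matrix_vector_mul_assoc[symmetric])
    (simp only: inner_matrix_vector transpose_transpose)

lemma psd_congruence: "psd A \<Longrightarrow> psd (transpose C ** A ** C)"
  unfolding psd_def quadratic_form_congruence
  by (auto simp: matrix_transpose_mul matrix_mul_assoc)

lemma psd_gram: "psd (transpose C ** C)"
  using psd_congruence[of "mat 1" C] pos_def_imp_psd[OF pos_def_mat[of 1]] by simp

lemma pos_def_congruence:
  fixes A C :: "real^'n^'n"
  assumes "pos_def A" "invertible C" shows "pos_def (transpose C ** A ** C)"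
proof -
  have "C *v x \<noteq> 0" if "x \<noteq> 0" for x
  proof
    assume "C *v x = 0"
    then have "matrix_inv C *v (C *v x) = 0" by simp
    then show False
      using that by (simp add: matrix_vector_mul_assoc matrix_inv_left[OF assms(2)])
  qed
  then show ?thesis using assms(1)
    unfolding pos_def_def quadratic_form_congruence
    by (auto simp: matrix_transpose_mul matrix_mul_assoc)
qed

lemma psd_sum: "finite I \<Longrightarrow> (\<And>i. i \<in> I \<Longrightarrow> psd (f i)) \<Longrightarrow> psd (sum f I)"
  by (induction I rule: finite_induct) (auto simp: psd_0 psd_add)

lemma trace_psd_nonneg: assumes "psd A" shows "0 \<le> trace A"
proof -
  have "A $ i $ i = axis i 1 \<bullet> (A *v axis i 1)" for i
    by (simp add: inner_axis' matrix_vector_mult_basis column_def)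
  then show ?thesis using assms by (simp add: trace_def psd_def sum_nonneg)
qed

lemma invertible_pos_def:
  fixes A :: "real^'n^'n"
  assumes "pos_def A" shows "invertible A"
proof -
  have "x = 0" if "A *v x = 0" for x
    using assms that unfolding pos_def_def by force
  then show ?thesis by (simp add: invertible_left_inverse matrix_left_invertible_ker)
qed

lemma psd_spectral:
  fixes A :: "real^'n^'n"
  assumes "psd A"
  obtains Q :: "real^'n^'n" and d where "Q ** transpose Q = mat 1" "transpose Q ** Q = mat 1"
    "A = transpose Q ** diag d ** Q" "\<forall>i. 0 \<le> d i"
    "\<forall>i c. psd (mat c - A) \<longrightarrow> d i \<le> c" "pos_def A \<longrightarrow> (\<forall>i. 0 < d i)"
proof -
  obtain Q :: "real^'n^'n" and d where Q: "Q ** transpose Q = mat 1" "transpose Q ** Q = mat 1"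
    and A: "A = transpose Q ** diag d ** Q"
  proof (rule symmetric_spectral[of A])
    show "transpose A = A" using assms by (simp add: psd_def)
  qed
  define u where "u i = transpose Q *v axis i 1" for i
  have "A ** transpose Q = transpose Q ** diag d ** (Q ** transpose Q)"
    by (simp only: A matrix_mul_assoc)
  then have AQ: "A ** transpose Q = transpose Q ** diag d" by (simp add: Q)
  have dg: "diag d *v axis i 1 = d i *\<^sub>R axis i 1" for i
    unfolding matrix_vector_mult_basis by (simp add: column_def diag_def vec_eq_iff axis_def)
  have Au: "A *v u i = d i *\<^sub>R u i" for i
    by (simp only: u_def matrix_vector_mul_assoc AQ)
       (simp only: matrix_vector_mul_assoc[symmetric] dg matrix_vector_mult_scaleR)
  have uu: "u i \<bullet> u i = 1" for i
    unfolding u_def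
    by (subst inner_matrix_vector)
      (simp only: transpose_transpose matrix_vector_mul_assoc Q matrix_vector_mul_lid inner_axis_axis,
        simp)
  have u0: "u i \<noteq> 0" for i using uu[of i] by auto
  have dA: "d i = u i \<bullet> (A *v u i)" for i by (simp add: Au uu)
  then have "0 \<le> d i" for i using assms by (simp add: psd_def)
  moreover have "d i \<le> c" if "psd (mat c - A)" for i c
  proof -
    have "0 \<le> u i \<bullet> (c *\<^sub>R u i - A *v u i)"
      using that unfolding psd_def mat_eq_scaleR[of c]
      by (simp add: matrix_vector_mult_diff_rdistrib scaleR_matrix_vector_assoc[symmetric])
    then show ?thesis by (simp add: Au inner_simps uu)
  qed
  moreover have "0 < d i" if "pos_def A" for i
    using that u0 dA[of i] by (simp add: pos_def_def)
  ultimately show ?thesis using Q A by (intro that[of Q d]) auto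
qed

lemma psd_root:
  fixes A :: "real^'n^'n"
  assumes "psd A" obtains C :: "real^'n^'n" where "A = transpose C ** C"
proof -
  obtain Q :: "real^'n^'n" and d where Q: "Q ** transpose Q = mat 1" "transpose Q ** Q = mat 1"
    and A: "A = transpose Q ** diag d ** Q" and d: "\<forall>i. 0 \<le> d i"
      "\<forall>i c. psd (mat c - A) \<longrightarrow> d i \<le> c" "pos_def A \<longrightarrow> (\<forall>i. 0 < d i)"
    by (rule psd_spectral[OF assms]) (rule that)
  have d: "0 \<le> d i" for i using d(1) by simp
  have "A = transpose (diag (\<lambda>i. sqrt (d i)) ** Q) ** (diag (\<lambda>i. sqrt (d i)) ** Q)"
    using d by (simp add: A mat_distrib matrix_mul_assoc)
       (simp add: matrix_mul_assoc[symmetric, of "transpose Q"] diag_mult)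
  then show ?thesis using that by blast
qed

text \<open>
  With a Gram factor \<open>A = C\<^sup>T C\<close>, the trace of \<open>A B\<close> is that of the congruent matrix \<open>C B C\<^sup>T\<close>.
\<close>
lemma trace_psd_mult_nonneg:
  fixes A :: "real^'n^'n"
  assumes "psd A" "psd B" shows "0 \<le> trace (A ** B)"
proof -
  obtain C :: "real^'n^'n" where A: "A = transpose C ** C" using psd_root assms by blast
  have "trace (A ** B) = trace (transpose C ** (C ** B))" by (simp only: A matrix_mul_assoc)
  also have "\<dots> = trace ((C ** B) ** transpose C)" by (rule trace_mul_sym)
  also have "\<dots> \<ge> 0"
    using trace_psd_nonneg[OF psd_congruence[OF assms(2), of "transpose C"]] by simp
  finally show ?thesis .
qed

lemma pos_def_root:
  fixes A :: "real^'n^'n"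
  assumes "pos_def A" obtains C :: "real^'n^'n" where "A = transpose C ** C" "invertible C"
proof -
  obtain C :: "real^'n^'n" where "A = transpose C ** C" using psd_root[OF pos_def_imp_psd[OF assms]] by blast
  moreover from this have "invertible C" using invertible_pos_def[OF assms]
    by (auto simp: invertible_det_nz det_mul)
  ultimately show ?thesis using that by blast
qed

lemma pos_def_gram: "invertible (C :: real^'n^'n) \<Longrightarrow> pos_def (transpose C ** C)"
  using pos_def_congruence[OF pos_def_mat[of 1], of C] by simp

lemma pos_def_matrix_inv:
  fixes A :: "real^'n^'n"
  assumes "pos_def A" shows "pos_def (matrix_inv A)"
proof -
  obtain C :: "real^'n^'n" where C: "A = transpose C ** C" "invertible C" using pos_def_root assms by blast
  have "matrix_inv A = transpose (transpose (matrix_inv C)) ** transpose (matrix_inv C)"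
    by (simp add: C matrix_inv_mult transpose_invertible transpose_matrix_inv)
  then show ?thesis
    using pos_def_gram[OF transpose_invertible[OF invertible_matrix_inv[OF C(2)]]] by simp
qed

lemma det_pos_def:
  fixes A :: "real^'n^'n"
  assumes "pos_def A" shows "0 < det A"
proof -
  obtain C :: "real^'n^'n" where "A = transpose C ** C" "invertible C"
    using pos_def_root assms by blast
  then show ?thesis by (auto simp: det_mul invertible_det_nz zero_less_mult_iff)
qed

text \<open>
  A Gram factor \<open>C\<close> of \<open>A\<close> has \<open>|C|\<^sup>2 = tr A\<close>. This turns trace
  bounds into norm bounds.
\<close>
lemma norm_psd_le_trace:
  fixes A :: "real^'n^'n"
  assumes "psd A" shows "norm A \<le> trace A"
proof -
  obtain C :: "real^'n^'n" where A: "A = transpose C ** C" using psd_root assms by blast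
  have "norm A \<le> norm (transpose C) * norm C" unfolding A by (rule norm_matrix_mult_le)
  also have "\<dots> = C \<bullet> C" by (simp add: dot_square_norm power2_eq_square)
  also have "\<dots> = trace A" unfolding inner_matrix_trace A by (rule trace_mul_sym)
  finally show ?thesis .
qed

section \<open>Determinant and trace inequalities\<close>

lemma orthogonal_conjugate:
  fixes Q D :: "real^'n^'n"
  assumes "Q ** transpose Q = mat 1" "transpose Q ** Q = mat 1"
  shows "det (transpose Q ** D ** Q) = det D" "trace (transpose Q ** D ** Q) = trace D"
    "mat 1 + transpose Q ** D ** Q = transpose Q ** (mat 1 + D) ** Q"
proof -
  have "det (Q ** transpose Q) = 1" by (simp add: assms)
  then show "det (transpose Q ** D ** Q) = det D" by (simp add: det_mul)
  show "trace (transpose Q ** D ** Q) = trace D"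
  proof -
    have "trace (transpose Q ** D ** Q) = trace (Q ** (transpose Q ** D))" by (rule trace_mul_sym)
    then show ?thesis by (simp add: matrix_mul_assoc assms)
  qed
  show "mat 1 + transpose Q ** D ** Q = transpose Q ** (mat 1 + D) ** Q"
    by (simp add: mat_distrib assms)
qed

text \<open>
  Summing \<open>log x \<le> x - 1\<close> over the eigenvalues.
\<close>
lemma ln_det_le_trace:
  assumes "pos_def (A :: real^'n^'n)" shows "ln (det A) \<le> trace A - CARD('n)"
proof -
  obtain Q :: "real^'n^'n" and d where Q: "Q ** transpose Q = mat 1" "transpose Q ** Q = mat 1"
    and A: "A = transpose Q ** diag d ** Q" and d: "\<forall>i. 0 \<le> d i"
      "\<forall>i c. psd (mat c - A) \<longrightarrow> d i \<le> c" "pos_def A \<longrightarrow> (\<forall>i. 0 < d i)"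
    by (rule psd_spectral[OF pos_def_imp_psd[OF assms]]) (rule that)
  have d: "0 < d i" for i using d(3) assms by simp
  have d0: "d i \<noteq> 0" for i using d[of i] by simp
  have "ln (det A) = (\<Sum>i\<in>UNIV. ln (d i))"
    unfolding A orthogonal_conjugate[OF Q] det_diag by (rule ln_prod) (use d0 in auto)
  also have "\<dots> \<le> (\<Sum>i\<in>UNIV. d i - 1)" by (intro sum_mono ln_le_minus_one d)
  also have "\<dots> = trace A - CARD('n)"
    unfolding A orthogonal_conjugate[OF Q] trace_diag by (simp add: sum_subtractf)
  finally show ?thesis .
qed

lemma det_1_plus_diag: "det (mat 1 + diag d) = (\<Prod>i\<in>UNIV. 1 + d i)"
proof -
  have "mat 1 + diag d = diag (\<lambda>i. 1 + d i)" by (simp add: mat_def diag_def vec_eq_iff)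
  then show ?thesis by (simp add: det_diag)
qed

text \<open>
  The \<open>[1/1]\<close> Pade approximant of the logarithm; the difference of the two sides vanishes at \<open>0\<close> and
  has derivative \<open>x\<^sup>2 / ((1+x)(2+x)\<^sup>2)\<close>.
\<close>
lemma ln_add_one_ge_pade:
  fixes x :: real
  assumes "0 \<le> x" shows "2 * x / (2 + x) \<le> ln (1 + x)"
proof -
  define f where "f x = ln (1 + x) - 2 * x / (2 + x)" for x :: real
  have "f 0 \<le> f x"
  proof (rule DERIV_nonneg_imp_nondecreasing[OF assms])
    fix y :: real assume y: "0 \<le> y" "y \<le> x"
    have "(f has_real_derivative 1 / (1 + y) - 4 / ((2 + y) * (2 + y))) (at y)"
      unfolding f_def using y by (auto intro!: derivative_eq_intros)
    moreover have "1 / (1 + y) - 4 / ((2 + y) * (2 + y)) = y * y / ((1 + y) * ((2 + y) * (2 + y)))"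
    proof -
      have "1 / a - 4 / (b * b) = (b * b - 4 * a) / (a * (b * b))" if "a \<noteq> 0" "b \<noteq> 0" for a b :: real
        using that by (simp add: field_simps)
      moreover have "(2 + y) * (2 + y) - 4 * (1 + y) = y * y" by (simp add: algebra_simps)
      ultimately show ?thesis using y by (metis add_nonneg_eq_0_iff zero_neq_one zero_neq_numeral
          zero_le_one zero_le_numeral)
    qed
    ultimately have "(f has_real_derivative y * y / ((1 + y) * ((2 + y) * (2 + y)))) (at y)"
      by simp
    then show "\<exists>d. (f has_real_derivative d) (at y) \<and> 0 \<le> d"
      using y by (intro exI[of _ "y * y / ((1 + y) * ((2 + y) * (2 + y)))"] conjI) auto
  qed
  then show ?thesis by (simp add: f_def)
qed

text \<open>
  Eigenvalue by eigenvalue: on \<open>[0,c]\<close> the logarithm satisfies \<open>2x/(2+c) \<le> 2x/(2+x) \<le> log(1+x) \<le> x\<close>.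
\<close>
lemma ln_det_1_plus_ge:
  fixes N :: "real^'n^'n"
  assumes N: "psd N" "psd (mat c - N)"
  shows "2 / (2 + c) * trace N \<le> ln (det (mat 1 + N))" "1 \<le> det (mat 1 + N)"
    "ln (det (mat 1 + N)) \<le> trace N"
proof -
  obtain Q :: "real^'n^'n" and d where Q: "Q ** transpose Q = mat 1" "transpose Q ** Q = mat 1"
    and A: "N = transpose Q ** diag d ** Q" and d: "\<forall>i. 0 \<le> d i"
      "\<forall>i c. psd (mat c - N) \<longrightarrow> d i \<le> c" "pos_def N \<longrightarrow> (\<forall>i. 0 < d i)"
    by (rule psd_spectral[OF N(1)]) (rule that)
  have d: "0 \<le> d i" "d i \<le> c" for i using d(1,2) N(2) by auto
  have d0: "1 + d i \<noteq> 0" for i using d(1)[of i] by simp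
  have ln: "ln (det (mat 1 + N)) = (\<Sum>i\<in>UNIV. ln (1 + d i))"
    unfolding A orthogonal_conjugate[OF Q] det_1_plus_diag
    by (rule ln_prod) (use d0 in auto)
  have "2 / (2 + c) * d i \<le> ln (1 + d i)" for i
  proof -
    have "2 / (2 + c) * d i \<le> 2 / (2 + d i) * d i"
      using d[of i] by (intro mult_right_mono divide_left_mono) auto
    also have "\<dots> = 2 * d i / (2 + d i)" by simp
    also have "\<dots> \<le> ln (1 + d i)" by (rule ln_add_one_ge_pade) (rule d)
    finally show ?thesis .
  qed
  then show "2 / (2 + c) * trace N \<le> ln (det (mat 1 + N))"
    unfolding ln unfolding A orthogonal_conjugate[OF Q] trace_diag sum_distrib_left
    by (intro sum_mono)
  show "1 \<le> det (mat 1 + N)"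
    unfolding A orthogonal_conjugate[OF Q] det_1_plus_diag by (intro prod_ge_1) (use d in auto)
  show "ln (det (mat 1 + N)) \<le> trace N"
    unfolding ln unfolding A orthogonal_conjugate[OF Q] trace_diag
    by (intro sum_mono ln_add_one_self_le_self d)
qed

text \<open>
  The product of the factors \<open>1 + d\<^sub>i\<close> dominates its expansion up to first order.
\<close>
lemma det_1_plus_ge_trace:
  fixes N :: "real^'n^'n"
  assumes N: "psd N" shows "1 + trace N \<le> det (mat 1 + N)"
proof -
  obtain Q :: "real^'n^'n" and d where Q: "Q ** transpose Q = mat 1" "transpose Q ** Q = mat 1"
    and A: "N = transpose Q ** diag d ** Q" and d: "\<forall>i. 0 \<le> d i"
      "\<forall>i c. psd (mat c - N) \<longrightarrow> d i \<le> c" "pos_def N \<longrightarrow> (\<forall>i. 0 < d i)"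
    by (rule psd_spectral[OF N]) (rule that)
  have d: "0 \<le> d i" for i using d(1) by simp
  have "1 + sum d I \<le> (\<Prod>i\<in>I. 1 + d i)" if "finite I" for I
    using that
  proof (induction I rule: finite_induct)
    case (insert i I)
    have "1 + sum d (insert i I) \<le> (1 + d i) * (1 + sum d I)"
      using insert.hyps d[of i] sum_nonneg[of I d] d by (simp add: algebra_simps)
    also have "\<dots> \<le> (1 + d i) * (\<Prod>i\<in>I. 1 + d i)"
      using insert d[of i] by (intro mult_left_mono) auto
    finally show ?case using insert.hyps by simp
  qed simp
  then show ?thesis unfolding A orthogonal_conjugate[OF Q] trace_diag det_1_plus_diag by simp
qed

text \<open>
  With \<open>S = C\<^sup>T C\<close> take \<open>N = C\<^sup>-\<^sup>T W C\<^sup>-\<^sup>1\<close>. Since \<open>S\<^sup>-\<^sup>1 W\<close> is not symmetric, statements about the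
  pair \<open>(S, W)\<close> are read off from the symmetric matrix \<open>N\<close>, which is similar to it.
\<close>
lemma whitening:
  fixes S W :: "real^'n^'n"
  assumes S: "pos_def S" and W: "psd W"
  obtains N :: "real^'n^'n" where "psd N" "det (S + W) = det S * det (mat 1 + N)"
    "trace N = trace (matrix_inv S ** W)" "\<forall>c. psd (c *\<^sub>R S - W) \<longrightarrow> psd (mat c - N)"
    "pos_def W \<longrightarrow> pos_def N \<and> det W = det S * det N"
proof -
  obtain C :: "real^'n^'n" where C: "S = transpose C ** C" "invertible C" using pos_def_root S by blast
  define J where "J = matrix_inv C"
  have CJ: "C ** J = mat 1" "J ** C = mat 1"
    by (simp_all add: J_def C matrix_inv_left matrix_inv_right)
  then have JC: "transpose J ** transpose C = mat 1" "transpose C ** transpose J = mat 1"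
    by (simp_all only: matrix_transpose_mul[symmetric] CJ transpose_mat)
  define N where "N = transpose J ** W ** J"
  have W': "W = transpose C ** N ** C"
    by (simp add: N_def matrix_mul_assoc JC)
       (simp add: matrix_mul_assoc[symmetric] CJ)
  have SW: "S + W = transpose C ** (mat 1 + N) ** C"
    by (simp add: W' C mat_distrib)
  have inv: "matrix_inv S = J ** transpose J"
    by (simp add: C matrix_inv_mult transpose_invertible J_def transpose_matrix_inv)
  have Sc: "mat c - N = transpose J ** (c *\<^sub>R S - W) ** J" for c
  proof -
    have "transpose J ** S ** J = mat 1"
      by (simp add: C matrix_mul_assoc JC) (simp add: CJ)
    then show ?thesis by (simp add: mat_distrib N_def mat_eq_scaleR[of c])
  qed
  show ?thesis
  proof (rule that[of N])
    show "psd N" unfolding N_def by (rule psd_congruence[OF W])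
    show "det (S + W) = det S * det (mat 1 + N)" by (simp add: SW) (simp add: C det_mul)
    show "trace N = trace (matrix_inv S ** W)"
    proof -
      have "trace N = trace (transpose J ** (W ** J))" by (simp only: N_def matrix_mul_assoc)
      also have "\<dots> = trace ((W ** J) ** transpose J)" by (rule trace_mul_sym)
      also have "\<dots> = trace (W ** (J ** transpose J))" by (simp only: matrix_mul_assoc)
      also have "\<dots> = trace ((J ** transpose J) ** W)" by (rule trace_mul_sym)
      finally show ?thesis by (simp only: inv)
    qed
    show "\<forall>c. psd (c *\<^sub>R S - W) \<longrightarrow> psd (mat c - N)"
      unfolding Sc by (intro allI impI psd_congruence)
    show "pos_def W \<longrightarrow> pos_def N \<and> det W = det S * det N"
    proof (intro impI conjI)
      assume pd: "pos_def W"
      show "pos_def N" unfolding N_def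
        by (rule pos_def_congruence[OF pd]) (simp add: J_def C invertible_matrix_inv)
      show "det W = det S * det N" by (simp add: W') (simp add: C det_mul)
    qed
  qed
qed

section \<open>Integration by parts without coordinates\<close>

text \<open>
  Fundamental theorem of calculus in \<open>s\<close>, followed by an exchange of the two integrals.
\<close>
lemma integral_path_derivative:
  fixes h h' :: "real \<Rightarrow> 'a::euclidean_space \<Rightarrow> real"
  assumes deriv: "\<And>s x. 0 \<le> s \<Longrightarrow> s \<le> 1 \<Longrightarrow> ((\<lambda>s. h s x) has_real_derivative h' s x) (at s)"
    and cont: "\<And>s x. 0 \<le> s \<Longrightarrow> s \<le> 1 \<Longrightarrow> isCont (\<lambda>s. h' s x) s"
    and int: "integrable lborel (h 0)" "integrable lborel (h 1)"
    and joint: "integrable (lborel \<Otimes>\<^sub>M lborel) (\<lambda>(s, x). indicator {0..1} s * h' s x)"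
  shows "(\<integral>x. h 1 x \<partial>lborel) - (\<integral>x. h 0 x \<partial>lborel)
       = (\<integral>s. indicator {0..1} s * (\<integral>x. h' s x \<partial>lborel) \<partial>lborel)"
proof -
  have "(\<integral>x. h 1 x \<partial>lborel) - (\<integral>x. h 0 x \<partial>lborel) = (\<integral>x. h 1 x - h 0 x \<partial>lborel)"
    using int by simp
  also have "\<dots> = (\<integral>x. (\<integral>s. indicator {0..1} s * h' s x \<partial>lborel) \<partial>lborel)"
    by (intro Bochner_Integration.integral_cong refl)
       (use integral_FTC_Icc_real[of 0 1 "\<lambda>s. h s x" "\<lambda>s. h' s x" for x, OF _ deriv cont]
        in \<open>simp add: mult.commute\<close>)
  also have "\<dots> = (\<integral>s. (\<integral>x. indicator {0..1} s * h' s x \<partial>lborel) \<partial>lborel)"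
    using lborel_pair.Fubini_integral[OF joint] by simp
  finally show ?thesis by simp
qed

lemma lborel_integrable_shift:
  fixes f :: "'a::euclidean_space \<Rightarrow> real"
  assumes "integrable lborel f" shows "integrable lborel (\<lambda>x. f (x + c))"
    "(\<integral>x. f (x + c) \<partial>lborel) = (\<integral>x. f x \<partial>lborel)"
proof -
  have [measurable]: "f \<in> borel_measurable borel" using assms by simp
  have *: "distr lborel borel (\<lambda>x. x + c) = lborel"
    using lborel_distr_plus[of c] by (simp add: add.commute[of _ c] cong: distr_cong)
  show "integrable lborel (\<lambda>x. f (x + c))"
    using assms by (subst (asm) *[symmetric], subst (asm) integrable_distr_eq) auto
  show "(\<integral>x. f (x + c) \<partial>lborel) = (\<integral>x. f x \<partial>lborel)"
    by (subst (2) *[symmetric], subst integral_distr) auto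
qed

text \<open>
  The function \<open>h\<close> and its translate by \<open>b\<close> have the same integral. Their difference is the integral
  over \<open>s \<in> [0,1]\<close> of the directional derivative translated by \<open>s b\<close>, and each of these translates has
  the integral of \<open>h'\<close>. Integration by parts thus needs neither coordinates nor boundary terms.
\<close>
lemma integral_directional_derivative_0:
  fixes h h' :: "'a::euclidean_space \<Rightarrow> real"
  assumes deriv: "\<And>x. ((\<lambda>t. h (x + t *\<^sub>R b)) has_real_derivative h' x) (at 0)"
    and cont: "continuous_on UNIV h'"
    and int: "integrable lborel h" "integrable lborel h'"
  shows "(\<integral>x. h' x \<partial>lborel) = 0"
proof -
  have [measurable]: "h' \<in> borel_measurable borel" using int(2) by simp
  have d: "((\<lambda>t. h (x + t *\<^sub>R b)) has_real_derivative h' (x + s *\<^sub>R b)) (at s)" for x s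
  proof -
    have "((\<lambda>t. h (x + s *\<^sub>R b + t *\<^sub>R b)) has_real_derivative h' (x + s *\<^sub>R b)) (at 0)"
      by (rule deriv)
    moreover have "(\<lambda>t. h (x + s *\<^sub>R b + t *\<^sub>R b)) = (\<lambda>t. h (x + (t + s) *\<^sub>R b))"
      by (simp add: algebra_simps)
    ultimately have "((\<lambda>t. h (x + (t + s) *\<^sub>R b)) has_real_derivative h' (x + s *\<^sub>R b)) (at 0)"
      by simp
    then show ?thesis
      using DERIV_shift[of "\<lambda>t. h (x + t *\<^sub>R b)" "h' (x + s *\<^sub>R b)" 0 s] by simp
  qed
  have "(\<integral>x. h (x + 1 *\<^sub>R b) \<partial>lborel) - (\<integral>x. h (x + 0 *\<^sub>R b) \<partial>lborel)
       = (\<integral>s. indicator {0..1} s * (\<integral>x. h' (x + s *\<^sub>R b) \<partial>lborel) \<partial>lborel)"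
  proof (rule integral_path_derivative)
    show "((\<lambda>s. h (x + s *\<^sub>R b)) has_real_derivative h' (x + s *\<^sub>R b)) (at s)" for s x by (rule d)
    show "isCont (\<lambda>s. h' (x + s *\<^sub>R b)) s" for s x
    proof -
      have "isCont h' (x + s *\<^sub>R b)" using cont by (simp add: continuous_on_eq_continuous_at)
      moreover have "isCont (\<lambda>s. x + s *\<^sub>R b) s" by (intro continuous_intros)
      ultimately show ?thesis by (rule isCont_o2[rotated])
    qed
    show "integrable lborel (\<lambda>x. h (x + 0 *\<^sub>R b))" "integrable lborel (\<lambda>x. h (x + 1 *\<^sub>R b))"
      using int(1) lborel_integrable_shift by auto
    show "integrable (lborel \<Otimes>\<^sub>M lborel) (\<lambda>(s, x). indicator {0..1} s * h' (x + s *\<^sub>R b))"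
    proof (rule lborel_pair.Fubini_integrable)
      show "(\<lambda>(s, x). indicator {0..1} s * h' (x + s *\<^sub>R b)) \<in> borel_measurable (lborel \<Otimes>\<^sub>M lborel)"
        by measurable
      have n: "(\<integral>x. norm (h' (x + s *\<^sub>R b)) \<partial>lborel) = (\<integral>x. norm (h' x) \<partial>lborel)" for s
        using lborel_integrable_shift(2)[OF integrable_norm[OF int(2)]] .
      have "integrable lborel (\<lambda>s. indicator {0..1::real} s * (\<integral>x. norm (h' x) \<partial>lborel))"
        by (intro integrable_mult_left integrable_real_indicator) auto
      then show "integrable lborel (\<lambda>s. \<integral>x. norm (case (s, x) of
          (s, x) \<Rightarrow> indicator {0..1} s * h' (x + s *\<^sub>R b)) \<partial>lborel)"
        using n by (simp add: abs_mult)
      show "AE s in lborel. integrable lborel (\<lambda>x. case (s, x) of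
          (s, x) \<Rightarrow> indicator {0..1} s * h' (x + s *\<^sub>R b))"
        using lborel_integrable_shift(1)[OF int(2)] by simp
    qed
  qed
  moreover have "(\<integral>x. h' (x + s *\<^sub>R b) \<partial>lborel) = (\<integral>x. h' x \<partial>lborel)" for s
    by (rule lborel_integrable_shift(2)[OF int(2)])
  ultimately show ?thesis
    using lborel_integrable_shift(2)[OF int(1), of b] by simp
qed

section \<open>Gaussian weights\<close>

lemma nn_integral_exp_norm:
  fixes a :: real assumes "0 < a"
  shows "(\<integral>\<^sup>+x. ennreal (exp (- a * (norm (x::'a::euclidean_space))\<^sup>2)) \<partial>lborel)
       = ennreal (sqrt (pi / a) ^ DIM('a))"
proof -
  have one: "(\<integral>\<^sup>+t. ennreal (exp (- a * (t::real)\<^sup>2)) \<partial>lborel) = ennreal (sqrt (pi / a))"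
  proof -
    have eq: "exp (- a * t\<^sup>2) = sqrt (pi / a) * normal_density 0 (sqrt (1 / (2 * a))) t" for t
      using assms by (simp add: normal_density_def real_sqrt_divide real_sqrt_mult field_simps)
    have "(\<integral>\<^sup>+t. ennreal (exp (- a * (t::real)\<^sup>2)) \<partial>lborel)
        = (\<integral>\<^sup>+t. ennreal (sqrt (pi / a)) * ennreal (normal_density 0 (sqrt (1 / (2 * a))) t) \<partial>lborel)"
      unfolding eq by (intro nn_integral_cong ennreal_mult) (use assms in auto)
    also have "\<dots> = ennreal (sqrt (pi / a))
        * (\<integral>\<^sup>+t. ennreal (normal_density 0 (sqrt (1 / (2 * a))) t) \<partial>lborel)"
      by (rule nn_integral_cmult) auto
    also have "(\<integral>\<^sup>+t. ennreal (normal_density 0 (sqrt (1 / (2 * a))) t) \<partial>lborel) = 1"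
      using assms by (subst nn_integral_eq_integral) (auto intro: integrable_normal_density)
    finally show ?thesis by simp
  qed
  have "ennreal (exp (- a * (norm x)\<^sup>2)) = (\<Prod>b\<in>Basis. ennreal (exp (- a * (x \<bullet> b)\<^sup>2)))"
    for x :: 'a
  proof -
    have "(norm x)\<^sup>2 = (\<Sum>b\<in>Basis. (x \<bullet> b)\<^sup>2)"
      by (simp only: power2_norm_eq_inner) (simp add: euclidean_inner[of x x] power2_eq_square)
    then have "exp (- a * (norm x)\<^sup>2) = (\<Prod>b\<in>Basis. exp (- a * (x \<bullet> b)\<^sup>2))"
      by (simp only: exp_sum[OF finite_Basis, symmetric] sum_distrib_left)
    then show ?thesis by (simp add: prod_ennreal)
  qed
  then have "(\<integral>\<^sup>+x. ennreal (exp (- a * (norm (x::'a))\<^sup>2)) \<partial>lborel)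
      = (\<Prod>b\<in>(Basis :: 'a set). (\<integral>\<^sup>+t. ennreal (exp (- a * t\<^sup>2)) \<partial>lborel))"
    by (simp only:) (rule nn_integral_lborel_prod, auto)
  also have "\<dots> = ennreal (sqrt (pi / a) ^ DIM('a))"
    unfolding one using assms by (simp add: ennreal_power)
  finally show ?thesis .
qed

lemma integrable_exp_norm:
  assumes "0 < (a::real)"
  shows "integrable lborel (\<lambda>x::'a::euclidean_space. exp (- a * (norm (x - \<mu>))\<^sup>2))"
proof -
  have "integrable lborel (\<lambda>x::'a. exp (- a * (norm x)\<^sup>2))"
  proof (rule integrableI_nonneg)
    show "(\<integral>\<^sup>+x. ennreal (exp (- a * (norm (x::'a))\<^sup>2)) \<partial>lborel) < \<infinity>"
      unfolding nn_integral_exp_norm[OF assms] by simp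
  qed auto
  from lborel_integrable_shift(1)[OF this, of "- \<mu>"] show ?thesis by simp
qed

lemma integrable_poly_exp_norm:
  fixes \<mu> :: "'a::euclidean_space"
  assumes "0 < (a::real)"
  shows "integrable lborel (\<lambda>x. (1 + (norm (x - \<mu>))\<^sup>2) * exp (- a * (norm (x - \<mu>))\<^sup>2))"
proof (rule Bochner_Integration.integrable_bound)
  show "integrable lborel (\<lambda>x. (1 + 2 / a) * exp (- (a / 2) * (norm (x - \<mu>))\<^sup>2))"
    using assms by (intro integrable_mult_right integrable_exp_norm) auto
  show "AE x in lborel. norm ((1 + (norm (x - \<mu>))\<^sup>2) * exp (- a * (norm (x - \<mu>))\<^sup>2))
      \<le> norm ((1 + 2 / a) * exp (- (a / 2) * (norm (x - \<mu>))\<^sup>2))"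
  proof (intro always_eventually allI)
    fix x
    define u where "u = (norm (x - \<mu>))\<^sup>2"
    have u: "0 \<le> u" by (simp add: u_def)
    have "1 + a / 2 * u \<le> exp (a / 2 * u)" by (rule exp_ge_add_one_self)
    moreover have "1 + u \<le> (1 + 2 / a) * (1 + a / 2 * u)" using assms u by (simp add: field_simps)
    ultimately have "1 + u \<le> (1 + 2 / a) * exp (a / 2 * u)"
      using mult_left_mono[of "1 + a / 2 * u" "exp (a / 2 * u)" "1 + 2 / a"] assms by simp
    then have "(1 + u) * exp (- a * u) \<le> (1 + 2 / a) * exp (a / 2 * u) * exp (- a * u)"
      by (intro mult_right_mono) auto
    also have "\<dots> = (1 + 2 / a) * exp (- (a / 2) * u)"
      by (simp add: mult.assoc exp_add[symmetric])
    finally show "norm ((1 + (norm (x - \<mu>))\<^sup>2) * exp (- a * (norm (x - \<mu>))\<^sup>2))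
      \<le> norm ((1 + 2 / a) * exp (- (a / 2) * (norm (x - \<mu>))\<^sup>2))"
      using assms u by (simp add: u_def)
  qed
qed simp

text \<open>
  The Gram factor \<open>C\<close> of \<open>Q\<close> is invertible, and the quadratic form is the squared norm of \<open>D C\<^sup>T\<close>.
\<close>
lemma pos_def_coercive:
  fixes Q :: "real^'p^'p"
  assumes "pos_def Q"
  obtains l where "0 < l" "\<forall>D :: real^'p^'m. l * (norm D)\<^sup>2 \<le> (D ** Q) \<bullet> D"
proof -
  obtain C :: "real^'p^'p" where C: "Q = transpose C ** C" "invertible C"
    using pos_def_root assms by blast
  define J where "J = transpose (matrix_inv C)"
  have CJ: "transpose C ** J = mat 1"
    unfolding J_def by (simp only: matrix_transpose_mul[symmetric] matrix_inv_left[OF C(2)] transpose_mat)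
  have J0: "0 < norm J"
  proof (rule ccontr)
    assume "\<not> 0 < norm J" then have "J = 0" by simp
    then have "trace (mat 1 :: real^'p^'p) = 0" using CJ by (simp add: trace_def flip: CJ)
    then show False by (simp add: trace_I)
  qed
  have "(1 / (norm J)\<^sup>2) * (norm D)\<^sup>2 \<le> (D ** Q) \<bullet> D" for D :: "real^'p^'m"
  proof -
    have "norm D = norm ((D ** transpose C) ** J)"
      by (simp only: matrix_mul_assoc[symmetric] CJ matrix_mul_rid)
    also have "\<dots> \<le> norm (D ** transpose C) * norm J" by (rule norm_matrix_mult_le)
    finally have "(norm D)\<^sup>2 \<le> (norm (D ** transpose C) * norm J)\<^sup>2" by (intro power_mono) auto
    then have "(norm D)\<^sup>2 / (norm J)\<^sup>2 \<le> (norm (D ** transpose C))\<^sup>2"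
      using J0 by (simp add: power_mult_distrib divide_le_eq)
    also have "\<dots> = (D ** transpose C) \<bullet> (D ** transpose C)" by (simp add: dot_square_norm)
    also have "\<dots> = (D ** Q) \<bullet> D"
    proof -
      have "(D ** transpose C) \<bullet> (D ** transpose C) = D \<bullet> ((D ** transpose C) ** C)"
        by (subst inner_matrix_mult_right) (simp only: transpose_transpose)
      also have "\<dots> = (D ** Q) \<bullet> D" by (simp only: C(1) matrix_mul_assoc inner_commute)
      finally show ?thesis .
    qed
    finally show ?thesis by simp
  qed
  then show ?thesis using J0 that[of "1 / (norm J)\<^sup>2"] by simp
qed

text \<open>
  The unnormalised density is parametrised by the precision matrix \<open>Q\<close>: Stein's identity holds for it
  before the normalising constant is known, and is then used to compute that constant.
\<close>
definition gauss_weight :: "real^'p^'m \<Rightarrow> real^'p^'p \<Rightarrow> real^'p^'m \<Rightarrow> real" where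
  "gauss_weight \<Theta> Q Y = exp (- (((Y - \<Theta>) ** Q) \<bullet> (Y - \<Theta>)) / 2)"

lemma gauss_weight_pos [simp]: "0 < gauss_weight \<Theta> Q Y"
  by (simp add: gauss_weight_def)

lemma continuous_gauss_weight: "continuous_on UNIV (gauss_weight \<Theta> Q)"
  unfolding gauss_weight_def by (intro continuous_intros mm.continuous_on) auto

lemma measurable_gauss_weight [measurable]: "gauss_weight \<Theta> Q \<in> borel_measurable borel"
  by (rule borel_measurable_continuous_onI[OF continuous_gauss_weight])

lemma integrable_gauss_weight:
  fixes Q :: "real^'p^'p" and f :: "real^'p^'m \<Rightarrow> real"
  assumes Q: "pos_def Q" and f [measurable]: "f \<in> borel_measurable borel"
    and bound: "\<And>Y. \<bar>f Y\<bar> \<le> B * (1 + (norm Y)\<^sup>2)"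
  shows "integrable lborel (\<lambda>Y. f Y * gauss_weight \<Theta> Q Y)"
proof -
  obtain l where l: "0 < l" "\<And>D :: real^'p^'m. l * (norm D)\<^sup>2 \<le> (D ** Q) \<bullet> D"
    using pos_def_coercive[OF Q] by metis
  define c where "c = 2 * (1 + (norm \<Theta>)\<^sup>2)"
  have B: "0 \<le> B" using bound[of 0] by (simp add: order_trans[OF abs_ge_zero])
  have c: "1 + (norm Y)\<^sup>2 \<le> c * (1 + (norm (Y - \<Theta>))\<^sup>2)" for Y
  proof -
    have "norm Y \<le> norm (Y - \<Theta>) + norm \<Theta>" by (metis diff_add_cancel norm_triangle_ineq)
    then have "(norm Y)\<^sup>2 \<le> (norm (Y - \<Theta>) + norm \<Theta>)\<^sup>2" by (intro power_mono) auto
    also have "\<dots> \<le> 2 * (norm (Y - \<Theta>))\<^sup>2 + 2 * (norm \<Theta>)\<^sup>2"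
      using sum_squares_bound[of "norm (Y - \<Theta>)" "norm \<Theta>"] by (simp add: power2_sum)
    finally have "(norm Y)\<^sup>2 \<le> 2 * (norm (Y - \<Theta>))\<^sup>2 + 2 * (norm \<Theta>)\<^sup>2" .
    moreover have "0 \<le> (norm \<Theta>)\<^sup>2 * (norm (Y - \<Theta>))\<^sup>2" by simp
    moreover have "c * (1 + (norm (Y - \<Theta>))\<^sup>2) = 2 + 2 * (norm \<Theta>)\<^sup>2
        + 2 * (norm (Y - \<Theta>))\<^sup>2 + 2 * ((norm \<Theta>)\<^sup>2 * (norm (Y - \<Theta>))\<^sup>2)"
      by (simp add: c_def algebra_simps)
    ultimately show ?thesis by linarith
  qed
  show ?thesis
  proof (rule Bochner_Integration.integrable_bound)
    show "integrable lborel (\<lambda>Y. (B * c) * ((1 + (norm (Y - \<Theta>))\<^sup>2) *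
        exp (- (l / 2) * (norm (Y - \<Theta>))\<^sup>2)))"
      by (intro integrable_mult_right integrable_poly_exp_norm) (use l in auto)
    show "AE Y in lborel. norm (f Y * gauss_weight \<Theta> Q Y) \<le> norm ((B * c) *
        ((1 + (norm (Y - \<Theta>))\<^sup>2) * exp (- (l / 2) * (norm (Y - \<Theta>))\<^sup>2)))"
    proof (intro always_eventually allI)
      fix Y
      have "\<bar>f Y\<bar> \<le> B * (c * (1 + (norm (Y - \<Theta>))\<^sup>2))"
        using bound[of Y] mult_left_mono[OF c[of Y] B] by linarith
      moreover have "gauss_weight \<Theta> Q Y \<le> exp (- (l / 2) * (norm (Y - \<Theta>))\<^sup>2)"
        unfolding gauss_weight_def using l(2)[of "Y - \<Theta>"] by simp
      ultimately have "\<bar>f Y\<bar> * gauss_weight \<Theta> Q Y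
          \<le> (B * (c * (1 + (norm (Y - \<Theta>))\<^sup>2))) * exp (- (l / 2) * (norm (Y - \<Theta>))\<^sup>2)"
        by (intro mult_mono) (auto simp: less_imp_le intro: order_trans[OF abs_ge_zero])
      also have "\<dots> = (B * c) * ((1 + (norm (Y - \<Theta>))\<^sup>2) * exp (- (l / 2) * (norm (Y - \<Theta>))\<^sup>2))"
        by (simp add: mult_ac)
      also have "\<dots> \<le> norm \<dots>" by simp
      finally show "norm (f Y * gauss_weight \<Theta> Q Y) \<le> norm ((B * c) *
        ((1 + (norm (Y - \<Theta>))\<^sup>2) * exp (- (l / 2) * (norm (Y - \<Theta>))\<^sup>2)))"
        by (simp add: abs_mult abs_of_pos[OF gauss_weight_pos])
    qed
  qed measurable
qed

lemma gauss_weight_has_derivative: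
  fixes Q :: "real^'p^'p" and E :: "real^'p^'m"
  assumes Q: "transpose Q = Q"
  shows "((\<lambda>t. gauss_weight \<Theta> Q (Y + t *\<^sub>R E)) has_real_derivative
    - (((Y - \<Theta>) ** Q) \<bullet> E) * gauss_weight \<Theta> Q Y) (at 0)"
proof -
  define D where "D = Y - \<Theta>"
  have *: "gauss_weight \<Theta> Q (Y + t *\<^sub>R E) =
      exp (- ((D ** Q) \<bullet> D + t * (2 * ((D ** Q) \<bullet> E)) + t * t * ((E ** Q) \<bullet> E)) / 2)" for t
  proof -
    have "(E ** Q) \<bullet> D = (D ** Q) \<bullet> E"
      by (subst inner_matrix_mult_right) (simp only: Q inner_commute)
    moreover have "Y + t *\<^sub>R E - \<Theta> = D + t *\<^sub>R E" by (simp add: D_def)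
    ultimately show ?thesis
      by (simp add: gauss_weight_def mm.add_left mm.scaleR_left inner_simps algebra_simps)
  qed
  have "((\<lambda>t. exp (- (a + t * (2 * b) + t * t * c) / 2)) has_real_derivative - b * exp (- a / 2)) (at 0)"
    for a b c :: real
    by (auto intro!: derivative_eq_intros)
  from this[of "(D ** Q) \<bullet> D" "(D ** Q) \<bullet> E" "(E ** Q) \<bullet> E"]
  have **: "((\<lambda>t. gauss_weight \<Theta> Q (Y + t *\<^sub>R E)) has_real_derivative
      - ((D ** Q) \<bullet> E) * exp (- ((D ** Q) \<bullet> D) / 2)) (at 0)"
    unfolding * .
  have "gauss_weight \<Theta> Q Y = exp (- ((D ** Q) \<bullet> D) / 2)"
    unfolding gauss_weight_def D_def ..
  then show ?thesis using ** unfolding D_def by (rule ssubst)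
qed

text \<open>
  For each matrix unit \<open>E\<close>, the directional derivative along \<open>E\<close> of \<open>(f \<bullet> E)\<close> times the weight integrates
  to zero; the identity is the sum over \<open>E\<close>.
\<close>
theorem gauss_weight_stein:
  fixes Q :: "real^'p^'p" and f :: "real^'p^'m \<Rightarrow> real^'p^'m"
  assumes Q: "pos_def Q"
    and deriv: "\<And>Y. (f has_derivative f' Y) (at Y)"
    and cont: "\<And>E. E \<in> Basis \<Longrightarrow> continuous_on UNIV (\<lambda>Y. f' Y E \<bullet> E)"
    and bound: "\<And>Y. norm (f Y) \<le> B * (1 + norm Y)"
      "\<And>Y E. E \<in> Basis \<Longrightarrow> \<bar>f' Y E \<bullet> E\<bar> \<le> B * (1 + (norm Y)\<^sup>2)"
  shows "(\<integral>Y. (((Y - \<Theta>) ** Q) \<bullet> f Y) * gauss_weight \<Theta> Q Y \<partial>lborel)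
      = (\<integral>Y. (\<Sum>E\<in>Basis. f' Y E \<bullet> E) * gauss_weight \<Theta> Q Y \<partial>lborel)" (is ?eq)
    and "integrable lborel (\<lambda>Y. (((Y - \<Theta>) ** Q) \<bullet> f Y) * gauss_weight \<Theta> Q Y)" (is ?int1)
    and "integrable lborel (\<lambda>Y. (\<Sum>E\<in>Basis. f' Y E \<bullet> E) * gauss_weight \<Theta> Q Y)" (is ?int2)
proof -
  have cf: "continuous_on UNIV f"
    by (intro continuous_at_imp_continuous_on ballI has_derivative_continuous[OF deriv])
  have B: "0 \<le> B" using order_trans[OF norm_ge_zero bound(1)[of 0]] by simp
  have sq: "1 + norm Y \<le> 2 * (1 + (norm Y)\<^sup>2)" for Y :: "real^'p^'m"
  proof -
    have "0 \<le> (norm Y - 1 / 4) * (norm Y - 1 / 4)" by simp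
    then show ?thesis by (simp add: power2_eq_square algebra_simps)
  qed
  define K where "K = (1 + norm \<Theta>) * norm Q"
  have K: "0 \<le> K" by (simp add: K_def)
  have nQ: "norm ((Y - \<Theta>) ** Q) \<le> K * (1 + norm Y)" for Y :: "real^'p^'m"
  proof -
    have "norm ((Y - \<Theta>) ** Q) \<le> norm (Y - \<Theta>) * norm Q" by (rule norm_matrix_mult_le)
    also have "norm (Y - \<Theta>) \<le> norm Y + norm \<Theta>" by (rule norm_triangle_ineq4)
    also have "norm Y + norm \<Theta> \<le> (1 + norm \<Theta>) * (1 + norm Y)" by (simp add: algebra_simps)
    finally have "norm ((Y - \<Theta>) ** Q) \<le> ((1 + norm \<Theta>) * (1 + norm Y)) * norm Q"
      by (simp add: mult_right_mono)
    then show ?thesis by (simp only: K_def mult_ac)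
  qed
  have fb: "\<bar>f Y \<bullet> E\<bar> \<le> B * (1 + norm Y)" if "E \<in> Basis" for Y E
    using Basis_le_norm[OF that, of "f Y"] bound(1)[of Y] by linarith
  have sq2: "(1 + norm Y) * (1 + norm Y) \<le> 2 * (1 + (norm Y)\<^sup>2)" for Y :: "real^'p^'m"
    using sum_squares_bound[of 1 "norm Y"] by (simp add: power2_eq_square algebra_simps)
  have i0: "integrable lborel (\<lambda>Y. (f Y \<bullet> E) * gauss_weight \<Theta> Q Y)" if E: "E \<in> Basis" for E
  proof (rule integrable_gauss_weight[OF Q, where B = "B * 2"])
    show "(\<lambda>Y. f Y \<bullet> E) \<in> borel_measurable borel"
      by (intro borel_measurable_continuous_onI continuous_intros cf)
    show "\<bar>f Y \<bullet> E\<bar> \<le> B * 2 * (1 + (norm Y)\<^sup>2)" for Y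
      using order_trans[OF fb[OF E, of Y] mult_left_mono[OF sq[of Y] B]] by (simp only: mult.assoc)
  qed
  have i1: "integrable lborel (\<lambda>Y. (f' Y E \<bullet> E) * gauss_weight \<Theta> Q Y)" if E: "E \<in> Basis" for E
    by (rule integrable_gauss_weight[OF Q _ bound(2)[OF E]])
       (intro borel_measurable_continuous_onI cont[OF E])
  have i2: "integrable lborel (\<lambda>Y. ((f Y \<bullet> E) * (((Y - \<Theta>) ** Q) \<bullet> E)) * gauss_weight \<Theta> Q Y)"
    if E: "E \<in> Basis" for E
  proof (rule integrable_gauss_weight[OF Q, where B = "B * K * 2"])
    show "(\<lambda>Y. (f Y \<bullet> E) * (((Y - \<Theta>) ** Q) \<bullet> E)) \<in> borel_measurable borel"
      by (intro borel_measurable_continuous_onI continuous_intros cf mm.continuous_on)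
    show "\<bar>(f Y \<bullet> E) * (((Y - \<Theta>) ** Q) \<bullet> E)\<bar> \<le> B * K * 2 * (1 + (norm Y)\<^sup>2)" for Y
    proof -
      have "\<bar>((Y - \<Theta>) ** Q) \<bullet> E\<bar> \<le> K * (1 + norm Y)"
        using Basis_le_norm[OF E, of "(Y - \<Theta>) ** Q"] nQ[of Y] by linarith
      then have "\<bar>f Y \<bullet> E\<bar> * \<bar>((Y - \<Theta>) ** Q) \<bullet> E\<bar> \<le> (B * (1 + norm Y)) * (K * (1 + norm Y))"
        by (intro mult_mono fb E) (use B in auto)
      also have "\<dots> = (B * K) * ((1 + norm Y) * (1 + norm Y))" by (simp add: mult_ac)
      also have "\<dots> \<le> (B * K) * (2 * (1 + (norm Y)\<^sup>2))"
        by (intro mult_left_mono sq2) (use B K in auto)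
      finally show ?thesis by (simp add: abs_mult mult_ac)
    qed
  qed
  have z: "(\<integral>Y. (f' Y E \<bullet> E) * gauss_weight \<Theta> Q Y
      - ((f Y \<bullet> E) * (((Y - \<Theta>) ** Q) \<bullet> E)) * gauss_weight \<Theta> Q Y \<partial>lborel) = 0"
    if E: "E \<in> Basis" for E
  proof (rule integral_directional_derivative_0[where h = "\<lambda>Y. (f Y \<bullet> E) * gauss_weight \<Theta> Q Y" and b = E])
    show "((\<lambda>t. (f (Y + t *\<^sub>R E) \<bullet> E) * gauss_weight \<Theta> Q (Y + t *\<^sub>R E)) has_real_derivative
        (f' Y E \<bullet> E) * gauss_weight \<Theta> Q Y
      - ((f Y \<bullet> E) * (((Y - \<Theta>) ** Q) \<bullet> E)) * gauss_weight \<Theta> Q Y) (at 0)" for Y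
    proof -
      have l: "((\<lambda>t. Y + t *\<^sub>R E) has_derivative (\<lambda>t. t *\<^sub>R E)) (at 0)"
        by (auto intro!: derivative_eq_intros)
      have "(f has_derivative f' Y) (at (Y + 0 *\<^sub>R E))" using deriv by simp
      then have "((\<lambda>t. f (Y + t *\<^sub>R E)) has_derivative (\<lambda>t. f' Y (t *\<^sub>R E))) (at 0)"
        by (rule has_derivative_compose[OF l])
      moreover have "f' Y (t *\<^sub>R E) = t *\<^sub>R f' Y E" for t
        using has_derivative_linear[OF deriv[of Y]] by (rule linear_scale)
      ultimately have "((\<lambda>t. f (Y + t *\<^sub>R E)) has_derivative (\<lambda>t. t *\<^sub>R f' Y E)) (at 0)" by simp
      from bounded_linear.has_derivative[OF bounded_linear_inner_left[of E] this]
      have "((\<lambda>t. f (Y + t *\<^sub>R E) \<bullet> E) has_real_derivative f' Y E \<bullet> E) (at 0)"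
        unfolding has_field_derivative_def
        by (rule has_derivative_eq_rhs) (auto simp: fun_eq_iff)
      from DERIV_mult[OF this gauss_weight_has_derivative[of Q \<Theta> Y E]] Q
      show ?thesis by (simp add: pos_def_def algebra_simps)
    qed
    show "continuous_on UNIV (\<lambda>Y. (f' Y E \<bullet> E) * gauss_weight \<Theta> Q Y
        - ((f Y \<bullet> E) * (((Y - \<Theta>) ** Q) \<bullet> E)) * gauss_weight \<Theta> Q Y)"
      by (intro continuous_intros cont E continuous_gauss_weight cf mm.continuous_on)
    show "integrable lborel (\<lambda>Y. (f' Y E \<bullet> E) * gauss_weight \<Theta> Q Y
        - ((f Y \<bullet> E) * (((Y - \<Theta>) ** Q) \<bullet> E)) * gauss_weight \<Theta> Q Y)"
      by (intro Bochner_Integration.integrable_diff i1 i2 E)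
  qed (rule i0[OF E])
  have s2: "(((Y - \<Theta>) ** Q) \<bullet> f Y) * gauss_weight \<Theta> Q Y =
      (\<Sum>E\<in>Basis. ((f Y \<bullet> E) * (((Y - \<Theta>) ** Q) \<bullet> E)) * gauss_weight \<Theta> Q Y)" for Y
    by (subst euclidean_inner[of _ "f Y"], simp only: sum_distrib_right, intro sum.cong refl)
      (simp only: mult.commute[of "f Y \<bullet> E" for E])
  have s1: "(\<Sum>E\<in>Basis. f' Y E \<bullet> E) * gauss_weight \<Theta> Q Y =
      (\<Sum>E\<in>Basis. (f' Y E \<bullet> E) * gauss_weight \<Theta> Q Y)" for Y
    by (simp add: sum_distrib_right)
  show ?int1 unfolding s2 by (intro Bochner_Integration.integrable_sum i2)
  show ?int2 unfolding s1 by (intro Bochner_Integration.integrable_sum i1)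
  have "(\<integral>Y. (f' Y E \<bullet> E) * gauss_weight \<Theta> Q Y \<partial>lborel)
      = (\<integral>Y. ((f Y \<bullet> E) * (((Y - \<Theta>) ** Q) \<bullet> E)) * gauss_weight \<Theta> Q Y \<partial>lborel)"
    if E: "E \<in> Basis" for E
    using z[OF E] i1[OF E] i2[OF E] by simp
  then show ?eq unfolding s1 s2
    by (simp add: Bochner_Integration.integral_sum i1 i2)
qed

section \<open>Matrix units\<close>

lemma Basis_matrix: "(Basis :: (real^'p^'m) set) = (\<lambda>(i, j). axis i (axis j 1)) ` UNIV"
  by (force simp: Basis_vec_def)

lemma sum_Basis_matrix:
  "(\<Sum>E\<in>(Basis :: (real^'p^'m) set). g E) = (\<Sum>i\<in>UNIV. \<Sum>j\<in>UNIV. g (axis i (axis j 1)))"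
proof -
  have "inj (\<lambda>(i::'m, j::'p). axis i (axis j (1::real)))"
    by (auto simp: inj_def axis_eq_axis)
  then have "(\<Sum>E\<in>(Basis :: (real^'p^'m) set). g E) = (\<Sum>(i, j)\<in>UNIV. g (axis i (axis j 1)))"
    unfolding Basis_matrix by (subst sum.reindex) (auto simp: case_prod_unfold)
  then show ?thesis by (simp add: sum.cartesian_product)
qed

lemma matrix_unit_mult:
  "((A :: real^'m^'k) ** axis i (axis j 1) ** (B :: real^'l^'p)) $ a $ b = A $ a $ i * B $ j $ b"
proof -
  have "(A ** axis i (axis j 1)) $ a $ c = (if c = j then A $ a $ i else 0)" for c :: 'p
  proof -
    have "(A ** axis i (axis j 1)) $ a $ c = (\<Sum>k\<in>UNIV. if k = i then (if c = j then A $ a $ i else 0) else 0)"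
      unfolding matrix_matrix_mult_def vec_lambda_beta
      by (intro sum.cong) (auto simp: axis_def)
    then show ?thesis by simp
  qed
  then have "(A ** axis i (axis j 1) ** B) $ a $ b
      = (\<Sum>c\<in>UNIV. if c = j then A $ a $ i * B $ j $ b else 0)"
    unfolding matrix_matrix_mult_def[of "A ** axis i (axis j 1)"] vec_lambda_beta
    by (intro sum.cong) auto
  then show ?thesis by simp
qed

lemma transpose_matrix_unit: "transpose (axis i (axis j 1) :: real^'p^'m) = axis j (axis i 1)"
  by (auto simp: transpose_def axis_def vec_eq_iff)

lemma inner_matrix_unit: "axis i (axis j 1) \<bullet> (W :: real^'p^'m) = W $ i $ j"
  by (simp add: inner_axis' )

lemma sum_Basis_mult_right:
  "(\<Sum>E\<in>(Basis :: (real^'p^'m) set). (E ** A) \<bullet> E) = real CARD('m) * trace A"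
proof -
  have "(axis i (axis j 1) ** A) \<bullet> (axis i (axis j 1) :: real^'p^'m) = A $ j $ j" for i j
  proof -
    have "(mat 1 :: real^'m^'m) $ i $ i = 1" by (simp add: mat_def)
    then have "(axis i (axis j 1) ** A) $ i $ j = A $ j $ j"
      using matrix_unit_mult[of "mat 1 :: real^'m^'m" i j A i j] by (simp only: matrix_mul_lid mult_1_left)
    then show ?thesis
      by (subst inner_commute) (simp only: inner_matrix_unit)
  qed
  then show ?thesis unfolding sum_Basis_matrix by (simp add: trace_def)
qed

lemma norm_Basis_mult_le:
  assumes "E \<in> (Basis :: (real^'p^'m) set)" shows "\<bar>(E ** A) \<bullet> E\<bar> \<le> norm A"
proof -
  have "\<bar>(E ** A) \<bullet> E\<bar> \<le> norm (E ** A) * norm E" by (rule Cauchy_Schwarz_ineq2)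
  also have "\<dots> \<le> norm E * norm A * norm E" by (intro mult_right_mono norm_matrix_mult_le) auto
  finally show ?thesis using assms by simp
qed

section \<open>Normalisation of the matrix normal density\<close>

text \<open>
  The field \<open>Y \<mapsto> Y A + C\<close> has constant divergence \<open>m tr A\<close>.
\<close>
lemma gauss_weight_stein_linear:
  fixes Q A :: "real^'p^'p" and C \<Theta> :: "real^'p^'m"
  assumes Q: "pos_def Q"
  shows "(\<integral>Y. (((Y - \<Theta>) ** Q) \<bullet> (Y ** A + C)) * gauss_weight \<Theta> Q Y \<partial>lborel)
      = (\<integral>Y. (real CARD('m) * trace A) * gauss_weight \<Theta> Q Y \<partial>lborel)"
    and "integrable lborel (\<lambda>Y. (((Y - \<Theta>) ** Q) \<bullet> (Y ** A + C)) * gauss_weight \<Theta> Q Y)"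
proof -
  have d: "((\<lambda>Y. Y ** A + C) has_derivative (\<lambda>E. E ** A)) (at Y)" for Y
    using bounded_linear_imp_has_derivative[OF mm.bounded_linear_left[of A]]
    by (auto intro!: derivative_eq_intros)
  have c: "continuous_on UNIV (\<lambda>Y. (E ** A) \<bullet> E)" for E :: "real^'p^'m" by simp
  have b1: "norm (Y ** A + C) \<le> (norm A + norm C) * (1 + norm Y)" for Y
  proof -
    have "norm (Y ** A + C) \<le> norm Y * norm A + norm C"
      using norm_triangle_ineq[of "Y ** A" C] norm_matrix_mult_le[of Y A] by linarith
    moreover have "(norm A + norm C) * (1 + norm Y) = norm A + norm C + norm Y * norm A + norm C * norm Y"
      by (simp add: algebra_simps)
    moreover have "0 \<le> norm C * norm Y" by simp
    ultimately show ?thesis using norm_ge_zero[of A] by linarith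
  qed
  have b2: "\<bar>(E ** A) \<bullet> E\<bar> \<le> (norm A + norm C) * (1 + (norm Y)\<^sup>2)"
    if "E \<in> Basis" for E Y :: "real^'p^'m"
  proof -
    have "\<bar>(E ** A) \<bullet> E\<bar> \<le> norm A + norm C" using norm_Basis_mult_le[OF that, of A] norm_ge_zero[of C] by linarith
    also have "\<dots> \<le> (norm A + norm C) * (1 + (norm Y)\<^sup>2)" by (simp add: algebra_simps)
    finally show ?thesis .
  qed
  note st = gauss_weight_stein[OF Q, of "\<lambda>Y. Y ** A + C" "\<lambda>Y E. E ** A", OF d c b1 b2]
  show "(\<integral>Y. (((Y - \<Theta>) ** Q) \<bullet> (Y ** A + C)) * gauss_weight \<Theta> Q Y \<partial>lborel)
      = (\<integral>Y. (real CARD('m) * trace A) * gauss_weight \<Theta> Q Y \<partial>lborel)"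
    using st(1) unfolding sum_Basis_mult_right .
  show "integrable lborel (\<lambda>Y. (((Y - \<Theta>) ** Q) \<bullet> (Y ** A + C)) * gauss_weight \<Theta> Q Y)"
    by (rule st(2))
qed

lemma integrable_gauss_weight_1:
  fixes \<Theta> :: "real^'p^'m"
  assumes "pos_def Q" shows "integrable lborel (gauss_weight \<Theta> Q)"
proof -
  have "integrable lborel (\<lambda>Y :: real^'p^'m. 1 * gauss_weight \<Theta> Q Y)"
    by (rule integrable_gauss_weight[OF assms, where B = 1]) auto
  then show ?thesis by simp
qed

lemma gauss_weight_identity:
  "gauss_weight 0 (mat 1 :: real^'p^'p) (Y :: real^'p^'m) = exp (- (1/2) * (norm Y)\<^sup>2)"
  by (simp add: gauss_weight_def dot_square_norm)

lemma integral_gauss_weight_identity: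
  "(\<integral>Y. gauss_weight 0 (mat 1 :: real^'p^'p) (Y :: real^'p^'m) \<partial>lborel)
    = sqrt (2 * pi) ^ (CARD('m) * CARD('p))"
proof -
  have "(\<integral>Y. gauss_weight 0 (mat 1 :: real^'p^'p) (Y :: real^'p^'m) \<partial>lborel)
      = enn2real (\<integral>\<^sup>+Y. ennreal (gauss_weight 0 (mat 1 :: real^'p^'p) (Y :: real^'p^'m)) \<partial>lborel)"
    by (rule integral_eq_nn_integral) (auto simp: less_imp_le)
  also have "\<dots> = sqrt (2 * pi) ^ (CARD('m) * CARD('p))"
    unfolding gauss_weight_identity
    using nn_integral_exp_norm[of "1/2", where 'a = "real^'p^'m"] by (simp add: mult.commute)
  finally show ?thesis .
qed

text \<open>
  Along the segment \<open>Q\<^sub>s = (1-s) I + s Q\<close> the product of \<open>(det Q\<^sub>s)\<^bsup>m/2\<^esup>\<close> with the integral of the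
  weight is constant. Its derivative in \<open>s\<close> is the difference of the two sides of Stein's identity
  for the linear field \<open>Y A\<^sub>s\<close> with \<open>A\<^sub>s Q\<^sub>s = Q - I\<close>. At \<open>s = 0\<close> the integral is a product of
  one-dimensional Gaussian integrals.
\<close>
theorem integral_gauss_weight_0:
  fixes Q :: "real^'p^'p"
  assumes Q: "pos_def Q"
  shows "(\<integral>Y. gauss_weight 0 Q (Y :: real^'p^'m) \<partial>lborel)
    = sqrt (2 * pi) ^ (CARD('m) * CARD('p)) * det Q powr (- real CARD('m) / 2)"
proof -
  obtain V :: "real^'p^'p" and d
    where V: "V ** transpose V = mat 1" "transpose V ** V = mat 1"
    and QV: "Q = transpose V ** diag d ** V" and d0: "\<forall>i. 0 \<le> d i"
      "\<forall>i c. psd (mat c - Q) \<longrightarrow> d i \<le> c" "pos_def Q \<longrightarrow> (\<forall>i. 0 < d i)"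
    by (rule psd_spectral[OF pos_def_imp_psd[OF Q]]) (rule that)
  have d: "0 < d i" for i using d0(3) Q by simp
  define k where "k i s = 1 + s * (d i - 1)" for i and s :: real
  have k: "0 < k i s" if "0 \<le> s" "s \<le> 1" for i s
  proof -
    have "0 \<le> (1 - s) + s * d i" using that d[of i] by simp
    moreover have "(1 - s) + s * d i \<noteq> 0"
      using that d[of i] by (cases "s = 0") (auto simp: add_nonneg_eq_0_iff)
    moreover have "(1 - s) + s * d i = k i s" by (simp add: k_def algebra_simps)
    ultimately show ?thesis by simp
  qed
  define Qs where "Qs s = (1 - s) *\<^sub>R mat 1 + s *\<^sub>R Q" for s
  have Qs: "pos_def (Qs s)" if "0 \<le> s" "s \<le> 1" for s
  proof (cases "s = 1")
    case True then show ?thesis using Q by (simp add: Qs_def)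
  next
    case False then show ?thesis unfolding Qs_def
      using that by (intro pos_def_add pos_def_scaleR pos_def_mat psd_scaleR pos_def_imp_psd[OF Q]) auto
  qed
  have diag1: "mat 1 = diag (\<lambda>i. 1)" by (simp add: mat_def diag_def)
  have diag_add: "r *\<^sub>R diag a + t *\<^sub>R diag b = diag (\<lambda>i. r * a i + t * b i)" for r t a b
    by (simp add: diag_def vec_eq_iff)
  have conj: "transpose V ** diag a ** V ** (transpose V ** diag b ** V)
      = transpose V ** diag (\<lambda>i. a i * b i) ** V" for a b
  proof -
    have "transpose V ** diag a ** V ** (transpose V ** diag b ** V)
      = transpose V ** (diag a ** (V ** transpose V) ** diag b) ** V"
      by (simp only: matrix_mul_assoc)
    then show ?thesis by (simp add: V diag_mult)
  qed
  have lin: "r *\<^sub>R mat 1 + t *\<^sub>R Q = transpose V ** diag (\<lambda>i. r + t * d i) ** V" for r t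
  proof -
    have "r *\<^sub>R mat 1 + t *\<^sub>R Q = r *\<^sub>R (transpose V ** V) + t *\<^sub>R Q" by (simp only: V)
    also have "\<dots> = transpose V ** (r *\<^sub>R mat 1 + t *\<^sub>R diag d) ** V"
      by (simp add: QV mat_distrib)
    also have "r *\<^sub>R mat 1 + t *\<^sub>R diag d = diag (\<lambda>i. r + t * d i)"
      unfolding diag1 diag_add by simp
    finally show ?thesis .
  qed
  define A where "A s = transpose V ** diag (\<lambda>i. (d i - 1) / k i s) ** V" for s
  have AQ: "A s ** Qs s = Q - mat 1" if "0 \<le> s" "s \<le> 1" for s
  proof -
    have "A s ** Qs s = transpose V ** diag (\<lambda>i. (d i - 1) / k i s * (1 - s + s * d i)) ** V"
      unfolding A_def Qs_def lin conj ..
    also have "(\<lambda>i. (d i - 1) / k i s * (1 - s + s * d i)) = (\<lambda>i. (-1) + 1 * d i)"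
    proof
      fix i
      have "1 - s + s * d i = k i s" by (simp add: k_def algebra_simps)
      then show "(d i - 1) / k i s * (1 - s + s * d i) = (-1) + 1 * d i" using k[OF that, of i] by simp
    qed
    also have "transpose V ** diag (\<lambda>i. (-1) + 1 * d i) ** V = Q - mat 1"
      unfolding lin[symmetric] by simp
    finally show ?thesis .
  qed
  have trA: "trace (A s) = (\<Sum>i\<in>UNIV. (d i - 1) / k i s)" for s
    unfolding A_def orthogonal_conjugate(2)[OF V] trace_diag ..
  define m where "m = real CARD('m)"
  \<comment> \<open>In the eigenbasis of \<open>Q\<close> the numbers \<open>k i s\<close> are the eigenvalues of \<open>Q\<^sub>s\<close>, so \<open>L s\<close> is \<open>m/2\<close> times \<open>log det Q\<^sub>s\<close>.\<close>
  define L where "L s = m / 2 * (\<Sum>i\<in>UNIV. ln (k i s))" for s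
  define q where "q Y = (Y ** Q) \<bullet> Y" for Y :: "real^'p^'m"
  define h where "h s Y = exp (L s - ((1 - s) * (Y \<bullet> Y) + s * q Y) / 2)" for s and Y :: "real^'p^'m"
  define h' where "h' s Y = (m / 2 * trace (A s) - (q Y - Y \<bullet> Y) / 2) * h s Y" for s and Y :: "real^'p^'m"
  have hg: "h s Y = exp (L s) * gauss_weight 0 (Qs s) Y" for s Y
  proof -
    have e: "exp (l - x / 2) = exp l * exp (- x / 2)" for l x :: real by (simp add: mult_exp_exp)
    have eq: "((Y - 0) ** Qs s) \<bullet> (Y - 0) = (1 - s) * (Y \<bullet> Y) + s * q Y"
      by (simp add: Qs_def q_def mm.add_right mm.scaleR_right inner_add_left)
    show ?thesis unfolding h_def gauss_weight_def eq by (rule e)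
  qed
  have dL: "(L has_real_derivative (m / 2 * trace (A s))) (at s)" if "0 \<le> s" "s \<le> 1" for s
    unfolding L_def trA k_def using k[OF that]
    by (auto intro!: derivative_eq_intros sum.cong simp: k_def field_simps)
  have dh: "((\<lambda>s. h s Y) has_real_derivative h' s Y) (at s)" if "0 \<le> s" "s \<le> 1" for s Y
    unfolding h_def h'_def
    by (auto intro!: derivative_eq_intros dL[OF that] simp: field_simps)
  have cA: "isCont (\<lambda>s. trace (A s)) s" if "0 \<le> s" "s \<le> 1" for s
  proof -
    have "k i s \<noteq> 0" for i using k[OF that, of i] by simp
    then show ?thesis unfolding trA k_def by (intro continuous_intros) (auto simp: k_def)
  qed
  have ch: "isCont (\<lambda>s. h s Y) s" if "0 \<le> s" "s \<le> 1" for s Y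
    using dh[OF that] by (rule DERIV_isCont)
  have cL: "isCont L s" if "0 \<le> s" "s \<le> 1" for s using dL[OF that] by (rule DERIV_isCont)
  have "bounded (L ` {0..1})" "bounded ((\<lambda>s. trace (A s)) ` {0..1})"
    by (auto intro!: compact_imp_bounded compact_continuous_image continuous_at_imp_continuous_on cL cA)
  then obtain c1 c2 where c1: "\<And>s. s \<in> {0..1} \<Longrightarrow> \<bar>L s\<bar> \<le> c1"
    and c2: "\<And>s. s \<in> {0..1} \<Longrightarrow> \<bar>trace (A s)\<bar> \<le> c2"
    unfolding bounded_iff by (metis image_eqI real_norm_def)
  obtain l where l: "0 < l" "\<forall>D :: real^'p^'m. l * (norm D)\<^sup>2 \<le> (D ** Q) \<bullet> D"
    by (rule pos_def_coercive[OF Q]) (rule that)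
  define l1 where "l1 = min l 1"
  have l1: "0 < l1" "l1 \<le> l" "l1 \<le> 1" using l by (auto simp: l1_def)
  define c3 where "c3 = m / 2 * c2 + norm Q + 1"
  have m: "0 \<le> m" by (simp add: m_def)
  have c2': "0 \<le> c2" using c2[of 0] by auto
  have c3: "0 \<le> c3" using m c2' by (simp add: c3_def)
  have hb: "h s Y \<le> exp c1 * exp (- (l1 / 2) * (norm Y)\<^sup>2)" if "s \<in> {0..1}" for s Y
  proof -
    have s: "0 \<le> s" "s \<le> 1" using that by auto
    have "l1 * (norm Y)\<^sup>2 \<le> l * (norm Y)\<^sup>2" using l1 by (intro mult_right_mono) auto
    then have q: "l1 * (norm Y)\<^sup>2 \<le> q Y" using l(2) unfolding q_def by (meson order_trans)
    have "l1 * (norm Y)\<^sup>2 \<le> 1 * (norm Y)\<^sup>2" using l1 by (intro mult_right_mono) auto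
    then have "l1 * (norm Y)\<^sup>2 \<le> Y \<bullet> Y" by (simp add: dot_square_norm)
    then have "(1 - s) * (l1 * (norm Y)\<^sup>2) + s * (l1 * (norm Y)\<^sup>2) \<le> (1 - s) * (Y \<bullet> Y) + s * q Y"
      using s q by (intro add_mono mult_left_mono) auto
    then have "l1 * (norm Y)\<^sup>2 \<le> (1 - s) * (Y \<bullet> Y) + s * q Y" by (simp add: algebra_simps)
    moreover have "l - r / 2 \<le> c1 - u / 2" if "u \<le> r" "\<bar>l\<bar> \<le> c1" for l r u using that by linarith
    ultimately have "h s Y \<le> exp (c1 - l1 * (norm Y)\<^sup>2 / 2)"
      using c1[OF that] unfolding h_def exp_le_cancel_iff by blast
    then show ?thesis by (simp add: exp_add[symmetric])
  qed
  have hb': "\<bar>h' s Y\<bar> \<le> c3 * exp c1 * ((1 + (norm Y)\<^sup>2) * exp (- (l1 / 2) * (norm Y)\<^sup>2))"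
    if "s \<in> {0..1}" for s Y
  proof -
    have "\<bar>q Y\<bar> \<le> norm (Y ** Q) * norm Y" unfolding q_def by (rule Cauchy_Schwarz_ineq2)
    also have "\<dots> \<le> (norm Y * norm Q) * norm Y" by (intro mult_right_mono norm_matrix_mult_le) auto
    finally have "\<bar>q Y\<bar> \<le> norm Q * (norm Y)\<^sup>2" by (simp add: power2_eq_square mult_ac)
    moreover have "\<bar>m / 2 * trace (A s)\<bar> \<le> m / 2 * c2"
      using mult_left_mono[OF c2[OF that], of "m / 2"] m by (simp add: abs_mult)
    moreover have "\<bar>a - (b - N) / 2\<bar> \<le> x + y + N" if "\<bar>b\<bar> \<le> y" "\<bar>a\<bar> \<le> x" "0 \<le> N" for a b x y N :: real
      using that by argo
    ultimately have "\<bar>m / 2 * trace (A s) - (q Y - (norm Y)\<^sup>2) / 2\<bar>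
        \<le> m / 2 * c2 + norm Q * (norm Y)\<^sup>2 + (norm Y)\<^sup>2"
      using zero_le_power2 by blast
    also have "\<dots> \<le> c3 * (1 + (norm Y)\<^sup>2)"
    proof -
      have "0 \<le> m / 2 * c2 * (norm Y)\<^sup>2" using m c2' by simp
      moreover have "c3 * (1 + (norm Y)\<^sup>2) = m / 2 * c2 + norm Q + 1 + m / 2 * c2 * (norm Y)\<^sup>2
          + norm Q * (norm Y)\<^sup>2 + (norm Y)\<^sup>2"
        by (simp add: c3_def algebra_simps)
      ultimately show ?thesis using norm_ge_zero[of Q] by linarith
    qed
    finally have "\<bar>m / 2 * trace (A s) - (q Y - Y \<bullet> Y) / 2\<bar> \<le> c3 * (1 + (norm Y)\<^sup>2)"
      by (simp only: dot_square_norm)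
    then have "\<bar>h' s Y\<bar> \<le> (c3 * (1 + (norm Y)\<^sup>2)) * (exp c1 * exp (- (l1 / 2) * (norm Y)\<^sup>2))"
      unfolding h'_def abs_mult using hb[OF that, of Y] c3
      by (intro mult_mono) (auto simp: h_def)
    then show ?thesis by (simp only: mult_ac)
  qed
  have int_h: "integrable lborel (h s)" if "0 \<le> s" "s \<le> 1" for s
    unfolding hg[abs_def] by (intro integrable_mult_right integrable_gauss_weight_1 Qs that)
  have zero: "(\<integral>Y. h' s Y \<partial>lborel) = 0" if "0 \<le> s" "s \<le> 1" for s
  proof -
    have eq: "((Y - 0) ** Qs s) \<bullet> (Y ** A s + 0) = q Y - Y \<bullet> Y" for Y :: "real^'p^'m"
    proof -
      have "transpose (Qs s) = Qs s" using Qs[OF that] by (simp add: pos_def_def)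
      then have "(Y ** Qs s) \<bullet> (Y ** A s) = Y \<bullet> (Y ** A s ** Qs s)"
        by (subst inner_matrix_mult_right) simp
      also have "Y ** A s ** Qs s = Y ** (A s ** Qs s)" by (simp only: matrix_mul_assoc)
      also have "\<dots> = Y ** Q - Y" by (simp add: AQ[OF that] mm.diff_right)
      finally show ?thesis by (simp add: q_def inner_simps inner_commute)
    qed
    note st = gauss_weight_stein_linear[OF Qs[OF that], where \<Theta> = "0 :: real^'p^'m" and C = 0 and A = "A s",
        unfolded eq]
    have g: "integrable lborel (gauss_weight (0 :: real^'p^'m) (Qs s))"
      by (intro integrable_gauss_weight_1 Qs that)
    have "(\<integral>Y. h' s Y \<partial>lborel) = (\<integral>Y. exp (L s) / 2 * ((m * trace (A s)) * gauss_weight 0 (Qs s) Y)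
        - exp (L s) / 2 * ((q Y - Y \<bullet> Y) * gauss_weight 0 (Qs s) Y) \<partial>lborel)"
      by (intro Bochner_Integration.integral_cong refl) (simp add: h'_def hg field_simps)
    also have "\<dots> = exp (L s) / 2 * (\<integral>Y. (m * trace (A s)) * gauss_weight (0 :: real^'p^'m) (Qs s) Y \<partial>lborel)
        - exp (L s) / 2 * (\<integral>Y. (q Y - Y \<bullet> Y) * gauss_weight 0 (Qs s) Y \<partial>lborel)"
      using st(2) g by (subst Bochner_Integration.integral_diff) auto
    also have "\<dots> = 0" using st(1) by (simp add: m_def)
    finally show ?thesis .
  qed
  have "(\<integral>Y. h 1 Y \<partial>lborel) - (\<integral>Y. h 0 Y \<partial>lborel)
       = (\<integral>s. indicator {0..1} s * (\<integral>Y. h' s Y \<partial>lborel) \<partial>lborel)"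
  proof (rule integral_path_derivative)
    show "((\<lambda>s. h s Y) has_real_derivative h' s Y) (at s)" if "0 \<le> s" "s \<le> 1" for s Y
      by (rule dh[OF that])
    show "isCont (\<lambda>s. h' s Y) s" if "0 \<le> s" "s \<le> 1" for s Y
      unfolding h'_def by (intro continuous_intros cA ch that) auto
    show "integrable lborel (h 0)" "integrable lborel (h 1)" by (auto intro: int_h)
    define G where "G Y = c3 * exp c1 * ((1 + (norm Y)\<^sup>2) * exp (- (l1 / 2) * (norm Y)\<^sup>2))"
      for Y :: "real^'p^'m"
    have G: "integrable lborel G" unfolding G_def
      using integrable_poly_exp_norm[of "l1 / 2" "0 :: real^'p^'m"] l1
      by (intro integrable_mult_right) simp
    have [measurable]: "G \<in> borel_measurable borel" using G by simp
    have hG: "\<bar>h' s Y\<bar> \<le> G Y" if "0 \<le> s" "s \<le> 1" for s Y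
      unfolding G_def by (rule hb') (use that in auto)
    have G0: "0 \<le> G Y" for Y using c3 by (simp add: G_def)
    show "integrable (lborel \<Otimes>\<^sub>M lborel) (\<lambda>(s, Y). indicator {0..1} s * h' s Y)"
    proof (rule Bochner_Integration.integrable_bound)
      show "integrable (lborel \<Otimes>\<^sub>M lborel) (\<lambda>(s, Y). indicator {0..1::real} s * G Y)"
      proof (rule lborel_pair.Fubini_integrable)
        show "(\<lambda>(s, Y). indicator {0..1::real} s * G Y) \<in> borel_measurable (lborel \<Otimes>\<^sub>M lborel)"
          by measurable
        have "integrable lborel (\<lambda>s. indicator {0..1::real} s * (\<integral>Y. G Y \<partial>lborel))"
          by (intro integrable_mult_left integrable_real_indicator) auto
        then show "integrable lborel (\<lambda>s. \<integral>Y. norm (case (s, Y) of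
            (s, Y) \<Rightarrow> indicator {0..1::real} s * G Y) \<partial>lborel)"
          by (simp add: abs_mult G0)
        show "AE s in lborel. integrable lborel (\<lambda>Y. case (s, Y) of
            (s, Y) \<Rightarrow> indicator {0..1::real} s * G Y)"
          using G by simp
      qed
      have "(\<lambda>(s, Y). indicator {0..1} s * h' s Y) \<in> borel_measurable (borel \<Otimes>\<^sub>M borel)"
        unfolding h'_def h_def q_def trA L_def k_def
      proof -
        have [measurable]: "(\<lambda>Y :: real^'p^'m. (Y ** Q) \<bullet> Y) \<in> borel_measurable borel"
          by (intro borel_measurable_continuous_onI continuous_intros mm.continuous_on)
        show "(\<lambda>(s, Y :: real^'p^'m). indicator {0..1} s *
          ((m / 2 * (\<Sum>i\<in>UNIV. (d i - 1) / (1 + s * (d i - 1))) - ((Y ** Q) \<bullet> Y - Y \<bullet> Y) / 2) *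
           exp (m / 2 * (\<Sum>i\<in>UNIV. ln (1 + s * (d i - 1)))
             - ((1 - s) * (Y \<bullet> Y) + s * ((Y ** Q) \<bullet> Y)) / 2)))
          \<in> borel_measurable (borel \<Otimes>\<^sub>M borel)" by measurable
      qed
      then show "(\<lambda>(s, Y). indicator {0..1} s * h' s Y) \<in> borel_measurable (lborel \<Otimes>\<^sub>M lborel)"
        by simp
      show "AE p in lborel \<Otimes>\<^sub>M lborel. norm (case p of (s, Y) \<Rightarrow> indicator {0..1} s * h' s Y)
          \<le> norm (case p of (s, Y) \<Rightarrow> indicator {0..1::real} s * G Y)"
        by (intro always_eventually allI)
           (auto simp: abs_mult G0 hG split: split_indicator)
    qed
  qed
  also have "\<dots> = (\<integral>s. 0 \<partial>(lborel :: real measure))"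
    by (intro Bochner_Integration.integral_cong refl) (auto simp: zero split: split_indicator)
  finally have eq: "(\<integral>Y. h 1 Y \<partial>lborel) = (\<integral>Y. h 0 Y \<partial>lborel)" by simp
  have Q0: "Qs 0 = mat 1" "Qs 1 = Q" by (simp_all add: Qs_def)
  have L0: "L 0 = 0" by (simp add: L_def k_def)
  have "det Q = (\<Prod>i\<in>UNIV. d i)" unfolding QV orthogonal_conjugate(1)[OF V] det_diag ..
  moreover have "ln (\<Prod>i\<in>UNIV. d i) = (\<Sum>i\<in>UNIV. ln (d i))"
    by (rule ln_prod) (use d in \<open>simp_all add: less_imp_neq[THEN not_sym]\<close>)
  ultimately have L1: "L 1 = m / 2 * ln (det Q)" by (simp add: L_def k_def)
  have "exp (L 1) * (\<integral>Y. gauss_weight 0 Q (Y :: real^'p^'m) \<partial>lborel)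
      = (\<integral>Y. gauss_weight 0 (mat 1 :: real^'p^'p) (Y :: real^'p^'m) \<partial>lborel)"
    using eq unfolding hg Q0 L0 by simp
  then have "(\<integral>Y. gauss_weight 0 Q (Y :: real^'p^'m) \<partial>lborel)
      = exp (- L 1) * sqrt (2 * pi) ^ (CARD('m) * CARD('p))"
    unfolding integral_gauss_weight_identity by (simp add: exp_minus field_simps)
  moreover have "exp (- L 1) = det Q powr (- real CARD('m) / 2)"
    using det_pos_def[OF Q] by (simp add: powr_def L1 m_def)
  ultimately show ?thesis by simp
qed

section \<open>The matrix normal distribution\<close>

lemma matrix_normal_density_gauss:
  fixes \<Theta> :: "real^'p^'m"
  shows "matrix_normal_density \<Theta> \<Sigma> Y = ((2 * pi) powr (- (real CARD('m) * real CARD('p)) / 2) *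
    det \<Sigma> powr (- real CARD('m) / 2)) * gauss_weight \<Theta> (matrix_inv \<Sigma>) Y"
  by (simp add: matrix_normal_density_def gauss_weight_def inner_matrix_trace)

lemma matrix_normal_density_pos: "pos_def \<Sigma> \<Longrightarrow> 0 < matrix_normal_density \<Theta> \<Sigma> Y"
  using det_pos_def[of \<Sigma>] by (simp add: matrix_normal_density_gauss)

lemma matrix_normal_density_nonneg: "0 \<le> matrix_normal_density \<Theta> \<Sigma> Y"
  by (simp add: matrix_normal_density_def)

lemma measurable_matrix_normal_density [measurable]:
  "matrix_normal_density \<Theta> \<Sigma> \<in> borel_measurable borel"
  unfolding matrix_normal_density_gauss[abs_def] by measurable

lemma det_matrix_inv:
  assumes "invertible (A :: real^'n^'n)" shows "det (matrix_inv A) = 1 / det A"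
proof -
  have "det (matrix_inv A) * det A = 1"
    by (simp only: det_mul[symmetric] matrix_inv_left[OF assms] det_I)
  then show ?thesis using assms by (simp add: invertible_det_nz field_simps)
qed

lemma integral_matrix_normal_density:
  fixes \<Theta> :: "real^'p^'m"
  assumes \<Sigma>: "pos_def \<Sigma>"
  shows "(\<integral>Y. matrix_normal_density \<Theta> \<Sigma> Y \<partial>lborel) = 1"
proof -
  define Q where "Q = matrix_inv \<Sigma>"
  have Q: "pos_def Q" unfolding Q_def by (rule pos_def_matrix_inv[OF \<Sigma>])
  have "gauss_weight \<Theta> Q Y = gauss_weight 0 Q (Y + (- \<Theta>))" for Y
    by (simp add: gauss_weight_def)
  then have "(\<integral>Y. gauss_weight \<Theta> Q Y \<partial>lborel) = (\<integral>Y. gauss_weight (0 :: real^'p^'m) Q Y \<partial>lborel)"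
    using lborel_integrable_shift(2)[OF integrable_gauss_weight_1[OF Q], of 0 "- \<Theta>"] by simp
  also have "\<dots> = sqrt (2 * pi) ^ (CARD('m) * CARD('p)) * det Q powr (- real CARD('m) / 2)"
    by (rule integral_gauss_weight_0[OF Q])
  finally have g: "(\<integral>Y. gauss_weight \<Theta> Q Y \<partial>lborel)
      = sqrt (2 * pi) ^ (CARD('m) * CARD('p)) * det Q powr (- real CARD('m) / 2)" .
  have d: "0 < det \<Sigma>" by (rule det_pos_def[OF \<Sigma>])
  have "det \<Sigma> powr (- real CARD('m) / 2) * det Q powr (- real CARD('m) / 2) = 1"
    using d by (simp add: Q_def det_matrix_inv[OF invertible_pos_def[OF \<Sigma>]] powr_mult[symmetric])
  moreover have "(2 * pi) powr (- (real CARD('m) * real CARD('p)) / 2)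
      * sqrt (2 * pi) ^ (CARD('m) * CARD('p)) = 1"
  proof -
    have "sqrt (2 * pi) ^ (CARD('m) * CARD('p)) = sqrt (2 * pi) powr (real CARD('m) * real CARD('p))"
      by (subst powr_realpow[symmetric]) auto
    also have "\<dots> = (2 * pi) powr ((real CARD('m) * real CARD('p)) / 2)"
      by (simp add: powr_half_sqrt[symmetric] powr_powr)
    finally show ?thesis by (simp add: powr_add[symmetric])
  qed
  ultimately show ?thesis
    unfolding matrix_normal_density_gauss Q_def[symmetric]
    by (simp add: g mult_ac)
qed

lemma integrable_matrix_normal_density:
  "pos_def \<Sigma> \<Longrightarrow> integrable lborel (matrix_normal_density \<Theta> \<Sigma>)"
  unfolding matrix_normal_density_gauss[abs_def]
  by (intro integrable_mult_right integrable_gauss_weight_1 pos_def_matrix_inv)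

lemma sets_matrix_normal [simp, measurable_cong]: "sets (matrix_normal \<Theta> \<Sigma>) = sets borel"
  by (simp add: matrix_normal_def)

lemma space_matrix_normal [simp]: "space (matrix_normal \<Theta> \<Sigma>) = UNIV"
  by (simp add: matrix_normal_def)

lemma prob_space_matrix_normal:
  assumes \<Sigma>: "pos_def \<Sigma>" shows "prob_space (matrix_normal \<Theta> \<Sigma>)"
proof
  have "emeasure (matrix_normal \<Theta> \<Sigma>) UNIV
      = (\<integral>\<^sup>+Y. ennreal (matrix_normal_density \<Theta> \<Sigma> Y) \<partial>lborel)"
    by (simp add: matrix_normal_def emeasure_density)
  also have "\<dots> = ennreal 1"
    using integral_matrix_normal_density[OF \<Sigma>, of \<Theta>]
      nn_integral_eq_integral[OF integrable_matrix_normal_density[OF \<Sigma>, of \<Theta>]]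
    by (simp add: matrix_normal_density_nonneg)
  finally show "emeasure (matrix_normal \<Theta> \<Sigma>) (space (matrix_normal \<Theta> \<Sigma>)) = 1" by simp
qed

lemma integral_matrix_normal:
  fixes f :: "real^'p^'m \<Rightarrow> real"
  assumes "f \<in> borel_measurable borel"
  shows "(\<integral>Y. f Y \<partial>matrix_normal \<Theta> \<Sigma>) = (\<integral>Y. f Y * matrix_normal_density \<Theta> \<Sigma> Y \<partial>lborel)"
    "integrable (matrix_normal \<Theta> \<Sigma>) f \<longleftrightarrow> integrable lborel (\<lambda>Y. f Y * matrix_normal_density \<Theta> \<Sigma> Y)"
  unfolding matrix_normal_def using assms
  by (auto simp: integral_density integrable_density matrix_normal_density_nonneg mult.commute)

lemma integrable_matrix_normal:
  fixes f :: "real^'p^'m \<Rightarrow> real"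
  assumes \<Sigma>: "pos_def \<Sigma>" and f: "f \<in> borel_measurable borel"
    and bound: "\<And>Y. \<bar>f Y\<bar> \<le> B * (1 + (norm Y)\<^sup>2)"
  shows "integrable (matrix_normal \<Theta> \<Sigma>) f"
proof -
  have "integrable lborel (\<lambda>Y. ((2 * pi) powr (- (real CARD('m) * real CARD('p)) / 2) *
    det \<Sigma> powr (- real CARD('m) / 2)) * (f Y * gauss_weight \<Theta> (matrix_inv \<Sigma>) Y))"
    by (intro integrable_mult_right integrable_gauss_weight[OF pos_def_matrix_inv[OF \<Sigma>] f bound])
  then show ?thesis
    unfolding integral_matrix_normal(2)[OF f] matrix_normal_density_gauss
    by (simp only: mult_ac)
qed

theorem matrix_normal_stein:
  fixes f :: "real^'p^'m \<Rightarrow> real^'p^'m"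
  assumes \<Sigma>: "pos_def \<Sigma>"
    and deriv: "\<And>Y. (f has_derivative f' Y) (at Y)"
    and cont: "\<And>E. E \<in> Basis \<Longrightarrow> continuous_on UNIV (\<lambda>Y. f' Y E \<bullet> E)"
    and bound: "\<And>Y. norm (f Y) \<le> B * (1 + norm Y)"
      "\<And>Y E. E \<in> Basis \<Longrightarrow> \<bar>f' Y E \<bullet> E\<bar> \<le> B * (1 + (norm Y)\<^sup>2)"
  shows "(\<integral>Y. ((Y - \<Theta>) ** matrix_inv \<Sigma>) \<bullet> f Y \<partial>matrix_normal \<Theta> \<Sigma>)
      = (\<integral>Y. (\<Sum>E\<in>Basis. f' Y E \<bullet> E) \<partial>matrix_normal \<Theta> \<Sigma>)"
    and "integrable (matrix_normal \<Theta> \<Sigma>) (\<lambda>Y. ((Y - \<Theta>) ** matrix_inv \<Sigma>) \<bullet> f Y)"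
    and "integrable (matrix_normal \<Theta> \<Sigma>) (\<lambda>Y. \<Sum>E\<in>Basis. f' Y E \<bullet> E)"
proof -
  define c where "c = (2 * pi) powr (- (real CARD('m) * real CARD('p)) / 2) *
    det \<Sigma> powr (- real CARD('m) / 2)"
  have dens: "matrix_normal_density \<Theta> \<Sigma> Y = c * gauss_weight \<Theta> (matrix_inv \<Sigma>) Y" for Y
    unfolding c_def by (rule matrix_normal_density_gauss)
  have ac: "x * (c * y) = c * (x * y)" for x y by simp
  note st = gauss_weight_stein[OF pos_def_matrix_inv[OF \<Sigma>] deriv cont bound, of \<Theta>]
  have cf: "continuous_on UNIV f"
    by (intro continuous_at_imp_continuous_on ballI has_derivative_continuous[OF deriv])
  have m: "(\<lambda>Y. ((Y - \<Theta>) ** matrix_inv \<Sigma>) \<bullet> f Y) \<in> borel_measurable borel"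
    "(\<lambda>Y. \<Sum>E\<in>Basis. f' Y E \<bullet> E) \<in> borel_measurable borel"
    by (intro borel_measurable_continuous_onI continuous_intros cf mm.continuous_on cont; assumption)+
  show "(\<integral>Y. ((Y - \<Theta>) ** matrix_inv \<Sigma>) \<bullet> f Y \<partial>matrix_normal \<Theta> \<Sigma>)
      = (\<integral>Y. (\<Sum>E\<in>Basis. f' Y E \<bullet> E) \<partial>matrix_normal \<Theta> \<Sigma>)"
    unfolding integral_matrix_normal(1)[OF m(1)] integral_matrix_normal(1)[OF m(2)] dens ac
    using st(1) by simp
  show "integrable (matrix_normal \<Theta> \<Sigma>) (\<lambda>Y. ((Y - \<Theta>) ** matrix_inv \<Sigma>) \<bullet> f Y)"
    unfolding integral_matrix_normal(2)[OF m(1)] dens ac by (intro integrable_mult_right st(2))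
  show "integrable (matrix_normal \<Theta> \<Sigma>) (\<lambda>Y. \<Sum>E\<in>Basis. f' Y E \<bullet> E)"
    unfolding integral_matrix_normal(2)[OF m(2)] dens ac by (intro integrable_mult_right st(3))
qed

lemma matrix_normal_stein_linear:
  fixes A :: "real^'p^'p" and C \<Theta> :: "real^'p^'m"
  assumes \<Sigma>: "pos_def \<Sigma>"
  shows "(\<integral>Y. ((Y - \<Theta>) ** matrix_inv \<Sigma>) \<bullet> (Y ** A + C) \<partial>matrix_normal \<Theta> \<Sigma>)
      = real CARD('m) * trace A"
    and "integrable (matrix_normal \<Theta> \<Sigma>) (\<lambda>Y. ((Y - \<Theta>) ** matrix_inv \<Sigma>) \<bullet> (Y ** A + C))"
proof -
  interpret prob_space "matrix_normal \<Theta> \<Sigma>" by (rule prob_space_matrix_normal[OF \<Sigma>])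
  have d: "((\<lambda>Y. Y ** A + C) has_derivative (\<lambda>E. E ** A)) (at Y)" for Y
    using bounded_linear_imp_has_derivative[OF mm.bounded_linear_left[of A]]
    by (auto intro!: derivative_eq_intros)
  have c: "continuous_on UNIV (\<lambda>Y. (E ** A) \<bullet> E)" for E :: "real^'p^'m" by simp
  have b1: "norm (Y ** A + C) \<le> (norm A + norm C) * (1 + norm Y)" for Y
  proof -
    have "norm (Y ** A + C) \<le> norm Y * norm A + norm C"
      using norm_triangle_ineq[of "Y ** A" C] norm_matrix_mult_le[of Y A] by linarith
    moreover have "(norm A + norm C) * (1 + norm Y) = norm A + norm C + norm Y * norm A + norm C * norm Y"
      by (simp add: algebra_simps)
    moreover have "0 \<le> norm C * norm Y" by simp
    ultimately show ?thesis using norm_ge_zero[of A] by linarith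
  qed
  have b2: "\<bar>(E ** A) \<bullet> E\<bar> \<le> (norm A + norm C) * (1 + (norm Y)\<^sup>2)"
    if "E \<in> Basis" for E Y :: "real^'p^'m"
  proof -
    have "\<bar>(E ** A) \<bullet> E\<bar> \<le> norm A + norm C" using norm_Basis_mult_le[OF that, of A] norm_ge_zero[of C] by linarith
    also have "\<dots> \<le> (norm A + norm C) * (1 + (norm Y)\<^sup>2)" by (simp add: algebra_simps)
    finally show ?thesis .
  qed
  note st = matrix_normal_stein[OF \<Sigma>, of "\<lambda>Y. Y ** A + C" "\<lambda>Y E. E ** A", OF d c b1 b2]
  show "(\<integral>Y. ((Y - \<Theta>) ** matrix_inv \<Sigma>) \<bullet> (Y ** A + C) \<partial>matrix_normal \<Theta> \<Sigma>)
      = real CARD('m) * trace A"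
    using st(1) unfolding sum_Basis_mult_right by (simp add: prob_space[unfolded space_matrix_normal])
  show "integrable (matrix_normal \<Theta> \<Sigma>) (\<lambda>Y. ((Y - \<Theta>) ** matrix_inv \<Sigma>) \<bullet> (Y ** A + C))"
    by (rule st(2))
qed

section \<open>The Kullback-Leibler loss in closed form\<close>

lemma ln_matrix_normal_density_ratio:
  fixes \<Theta> \<Theta>' :: "real^'p^'m"
  assumes \<Sigma>: "pos_def \<Sigma>" and \<Sigma>': "pos_def \<Sigma>'"
  shows "ln (matrix_normal_density \<Theta>' \<Sigma>' Y / matrix_normal_density \<Theta> \<Sigma> Y)
    = real CARD('m) / 2 * (ln (det \<Sigma>) - ln (det \<Sigma>'))
      - (((Y - \<Theta>') ** matrix_inv \<Sigma>') \<bullet> (Y - \<Theta>')) / 2 + (((Y - \<Theta>) ** matrix_inv \<Sigma>) \<bullet> (Y - \<Theta>)) / 2"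
proof -
  have l: "ln (matrix_normal_density T S Y) = ln ((2 * pi) powr (- (real CARD('m) * real CARD('p)) / 2))
      - real CARD('m) / 2 * ln (det S) - (((Y - T) ** matrix_inv S) \<bullet> (Y - T)) / 2"
    if "pos_def S" for T :: "real^'p^'m" and S
  proof -
    have "0 < det S" by (rule det_pos_def[OF that])
    then show ?thesis
      unfolding matrix_normal_density_gauss gauss_weight_def
      by (simp add: ln_mult ln_powr)
  qed
  have "ln (matrix_normal_density \<Theta>' \<Sigma>' Y / matrix_normal_density \<Theta> \<Sigma> Y)
      = ln (matrix_normal_density \<Theta>' \<Sigma>' Y) - ln (matrix_normal_density \<Theta> \<Sigma> Y)"
    by (rule ln_divide_pos) (use matrix_normal_density_pos[OF \<Sigma>] matrix_normal_density_pos[OF \<Sigma>'] in auto)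
  moreover have "(c - k * x - u) - (c - k * y - v) = k * (y - x) - u + v" for c k x y u v :: real
    by (simp add: right_diff_distrib)
  ultimately show ?thesis unfolding l[OF \<Sigma>] l[OF \<Sigma>'] by simp
qed

text \<open>
  The log-ratio of the densities is a difference of quadratic forms in \<open>Y\<close>. Their means under the
  estimated distribution are instances of Stein's identity for affine fields.
\<close>
theorem kl_loss_eq:
  fixes \<Theta> \<Theta>' :: "real^'p^'m"
  assumes \<Sigma>: "pos_def \<Sigma>" and \<Sigma>': "pos_def \<Sigma>'"
  shows "kl_loss (\<Theta>', \<Sigma>') \<Theta> \<Sigma>
    = real CARD('m) / 2 * (trace (matrix_inv \<Sigma> ** \<Sigma>') - ln (det \<Sigma>') + ln (det \<Sigma>) - real CARD('p))
      + (((\<Theta>' - \<Theta>) ** matrix_inv \<Sigma>) \<bullet> (\<Theta>' - \<Theta>)) / 2"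
proof -
  interpret prob_space "matrix_normal \<Theta>' \<Sigma>'" by (rule prob_space_matrix_normal[OF \<Sigma>'])
  define Q Q' \<delta> where "Q = matrix_inv \<Sigma>" and "Q' = matrix_inv \<Sigma>'" and "\<delta> = \<Theta>' - \<Theta>"
  have sQ: "transpose Q = Q" and sQ': "transpose Q' = Q'"
    using pos_def_matrix_inv[OF \<Sigma>] pos_def_matrix_inv[OF \<Sigma>'] by (auto simp: pos_def_def Q_def Q'_def)
  define A where "A = Q ** \<Sigma>'"
  have AQ: "A ** Q' = Q"
    by (simp add: A_def Q'_def matrix_mul_assoc[symmetric] matrix_inv_right[OF invertible_pos_def[OF \<Sigma>']])
  have quad: "((Y - \<Theta>) ** Q) \<bullet> (Y - \<Theta>)
      = ((Y - \<Theta>') ** Q') \<bullet> (Y ** A + (2 *\<^sub>R \<delta> - \<Theta>') ** A) + (\<delta> ** Q) \<bullet> \<delta>" for Y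
  proof -
    define D where "D = Y - \<Theta>'"
    have "Y ** A + (2 *\<^sub>R \<delta> - \<Theta>') ** A = (D + 2 *\<^sub>R \<delta>) ** A"
      by (simp add: D_def mat_distrib algebra_simps)
    moreover have "(D ** Q') \<bullet> ((D + 2 *\<^sub>R \<delta>) ** A) = D \<bullet> ((D + 2 *\<^sub>R \<delta>) ** Q)"
      by (subst inner_matrix_mult_right) (simp add: sQ' matrix_mul_assoc[symmetric] AQ)
    moreover have "Y - \<Theta> = D + \<delta>" by (simp add: D_def \<delta>_def)
    moreover have "(\<delta> ** Q) \<bullet> D = D \<bullet> (\<delta> ** Q)" by (rule inner_commute)
    moreover have "(D ** Q) \<bullet> \<delta> = D \<bullet> (\<delta> ** Q)" by (subst inner_matrix_mult_right) (simp only: sQ)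
    moreover have "(D ** Q) \<bullet> D = D \<bullet> (D ** Q)" by (rule inner_commute)
    ultimately show ?thesis
      by (simp add: D_def[symmetric] mm.add_left mm.scaleR_left inner_add_left inner_add_right)
  qed
  have one: "(Y - \<Theta>') = Y ** mat 1 + (- \<Theta>')" for Y by simp
  note st1 = matrix_normal_stein_linear[OF \<Sigma>', of \<Theta>' "mat 1" "- \<Theta>'", folded one Q'_def]
  \<comment> \<open>As \<open>A Q' = Q\<close>, the form in \<open>Q\<close> is a Stein pairing with the precision \<open>Q'\<close>, up to a constant.\<close>
  note st2 = matrix_normal_stein_linear[OF \<Sigma>', of \<Theta>' A "(2 *\<^sub>R \<delta> - \<Theta>') ** A", folded Q'_def]
  have cont: "continuous_on UNIV (\<lambda>Y. real CARD('m) / 2 * (ln (det \<Sigma>) - ln (det \<Sigma>'))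
      - (((Y - \<Theta>') ** Q') \<bullet> (Y - \<Theta>')) / 2 + (((Y - \<Theta>) ** Q) \<bullet> (Y - \<Theta>)) / 2)"
    by (intro continuous_intros mm.continuous_on) auto
  have "kl_loss (\<Theta>', \<Sigma>') \<Theta> \<Sigma> = (\<integral>Y. (real CARD('m) / 2 * (ln (det \<Sigma>) - ln (det \<Sigma>'))
      - (((Y - \<Theta>') ** Q') \<bullet> (Y - \<Theta>')) / 2 + (((Y - \<Theta>) ** Q) \<bullet> (Y - \<Theta>)) / 2)
      * matrix_normal_density \<Theta>' \<Sigma>' Y \<partial>lborel)"
    unfolding kl_loss_def case_prod_conv ln_matrix_normal_density_ratio[OF \<Sigma> \<Sigma>'] Q_def Q'_def ..
  also have "\<dots> = (\<integral>Y. real CARD('m) / 2 * (ln (det \<Sigma>) - ln (det \<Sigma>'))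
      - (((Y - \<Theta>') ** Q') \<bullet> (Y - \<Theta>')) / 2 + (((Y - \<Theta>) ** Q) \<bullet> (Y - \<Theta>)) / 2 \<partial>matrix_normal \<Theta>' \<Sigma>')"
    by (rule integral_matrix_normal(1)[symmetric]) (rule borel_measurable_continuous_onI[OF cont])
  also have "\<dots> = real CARD('m) / 2 * (ln (det \<Sigma>) - ln (det \<Sigma>'))
      - real CARD('m) * trace (mat 1 :: real^'p^'p) / 2
      + (real CARD('m) * trace A + (\<delta> ** Q) \<bullet> \<delta>) / 2"
    unfolding quad using st1 st2 by (simp add: prob_space[unfolded space_matrix_normal])
  also have "trace (mat 1 :: real^'p^'p) = real CARD('p)" by (rule trace_I)
  finally show ?thesis by (simp add: A_def Q_def \<delta>_def field_simps)
qed

section \<open>Calculus of the matrix inverse\<close>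

lemma continuous_on_det: "continuous_on S (det :: real^'n^'n \<Rightarrow> real)"
  unfolding det_def by (intro continuous_intros)

lemma isCont_det: "isCont (det :: real^'n^'n \<Rightarrow> real) A"
  by (rule continuous_on_interior[OF continuous_on_det[of UNIV]]) simp

text \<open>
  Cramer's rule exhibits the entries of the inverse as rational functions of the entries of \<open>A\<close>, hence
  continuous where the determinant does not vanish.
\<close>
lemma matrix_inv_cramer:
  fixes A :: "real^'n^'n"
  assumes "det A \<noteq> 0"
  shows "matrix_inv A $ k $ l = det (\<chi> i j. if j = k then axis l 1 $ i else A $ i $ j) / det A"
proof -
  have inv: "invertible A" using assms by (simp add: invertible_det_nz)
  have "A *v (matrix_inv A *v axis l 1) = axis l 1"
    by (simp add: matrix_vector_mul_assoc matrix_inv_right[OF inv])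
  then have "(matrix_inv A *v axis l 1) $ k = det (\<chi> i j. if j = k then axis l 1 $ i else A $ i $ j) / det A"
    unfolding cramer[OF assms] by simp
  then show ?thesis by (simp add: matrix_vector_mult_basis column_def)
qed

lemma open_invertible: "open {A :: real^'n^'n. det A \<noteq> 0}"
  using continuous_on_det[of UNIV] by (rule open_Collect_neq) simp

lemma isCont_matrix_inv:
  fixes A :: "real^'n^'n"
  assumes "invertible A" shows "isCont matrix_inv A"
proof -
  have A: "det A \<noteq> 0" using assms by (simp add: invertible_det_nz)
  have "\<forall>\<^sub>F B in at A. det B \<noteq> 0"
    using topological_tendstoD[OF tendsto_ident_at open_invertible, of A UNIV] A by simp
  then have ev: "\<forall>\<^sub>F B in at A. det (\<chi> i j. if j = k then axis l 1 $ i else B $ i $ j) / det B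
      = matrix_inv B $ k $ l" for k l
    by eventually_elim (simp add: matrix_inv_cramer)
  have "((\<lambda>B. matrix_inv B $ k $ l) \<longlongrightarrow> matrix_inv A $ k $ l) (at A)" for k l
  proof (rule Lim_transform_eventually[OF _ ev])
    have "((\<lambda>B. (\<chi> i j. if j = k then axis l 1 $ i else B $ i $ j) :: real^'n^'n) \<longlongrightarrow>
        (\<chi> i j. if j = k then axis l 1 $ i else A $ i $ j)) (at A)"
      by (intro vec_tendstoI) (auto intro!: tendsto_intros)
    note num = isCont_tendsto_compose[OF isCont_det this]
    show "((\<lambda>B. det (\<chi> i j. if j = k then axis l 1 $ i else B $ i $ j) / det B)
        \<longlongrightarrow> matrix_inv A $ k $ l) (at A)"
      unfolding matrix_inv_cramer[OF A]
      by (intro tendsto_divide A num isCont_tendsto_compose[OF isCont_det tendsto_ident_at])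
  qed
  then show ?thesis unfolding isCont_def by (intro vec_tendstoI)
qed

lemma tendsto_matrix_inv:
  "(f \<longlongrightarrow> A) F \<Longrightarrow> invertible (A :: real^'n^'n) \<Longrightarrow> ((\<lambda>x. matrix_inv (f x)) \<longlongrightarrow> matrix_inv A) F"
  by (rule isCont_tendsto_compose[OF isCont_matrix_inv])

lemma measurable_det [measurable]: "(det :: real^'n^'n \<Rightarrow> real) \<in> borel_measurable borel"
  by (rule borel_measurable_continuous_onI[OF continuous_on_det])

text \<open>
  The total function \<open>matrix_inv\<close> takes a single arbitrary value on all singular matrices, so it is
  measurable on the whole space.
\<close>
lemma measurable_matrix_inv [measurable]: "(matrix_inv :: real^'n^'n \<Rightarrow> real^'n^'n) \<in> borel_measurable borel"
proof -
  let ?U = "{A :: real^'n^'n. det A \<noteq> 0}"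
  have "(\<lambda>A. if A \<in> ?U then matrix_inv A else (SOME B. False)) \<in> borel_measurable borel"
  proof (rule borel_measurable_continuous_on_if)
    show "?U \<in> sets borel" using open_invertible by simp
    show "continuous_on ?U matrix_inv"
      by (intro continuous_at_imp_continuous_on) (auto simp: isCont_matrix_inv invertible_det_nz)
  qed simp
  moreover have "(\<lambda>A. if A \<in> ?U then matrix_inv A else (SOME B. False)) = matrix_inv"
  proof
    fix A :: "real^'n^'n"
    have "matrix_inv A = (SOME B. False)" if "det A = 0"
    proof -
      have "\<not> invertible A" using that by (simp add: invertible_det_nz)
      then have "(A ** B = mat 1 \<and> B ** A = mat 1) = False" for B
        unfolding invertible_def by blast
      then show ?thesis by (simp only: matrix_inv_def)
    qed
    then show "(if A \<in> ?U then matrix_inv A else (SOME B. False)) = matrix_inv A" by simp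
  qed
  ultimately show ?thesis by simp
qed

lemma has_derivative_matrix_inv:
  fixes A :: "real^'n^'n"
  assumes A: "invertible A"
  shows "(matrix_inv has_derivative (\<lambda>H. - (matrix_inv A ** H ** matrix_inv A))) (at A)"
  unfolding has_derivative_iff_norm
proof
  show "bounded_linear (\<lambda>H. - (matrix_inv A ** H ** matrix_inv A))"
    by (intro bounded_linear_minus
        bounded_linear_compose[OF mm.bounded_linear_left mm.bounded_linear_right])
  have d: "det A \<noteq> 0" using A by (simp add: invertible_det_nz)
  have "\<forall>\<^sub>F B in at A. det B \<noteq> 0"
    using topological_tendstoD[OF tendsto_ident_at open_invertible, of A UNIV] d by simp
  then have ev: "\<forall>\<^sub>F B in at A. norm (norm ((matrix_inv B - matrix_inv A)
      - (- (matrix_inv A ** (B - A) ** matrix_inv A))) / norm (B - A))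
      \<le> norm (matrix_inv A - matrix_inv B) * norm (matrix_inv A)"
  proof eventually_elim
    case (elim B)
    then have B: "invertible B" by (simp add: invertible_det_nz)
    have "matrix_inv B ** (B - A) ** matrix_inv A = matrix_inv A - matrix_inv B"
      by (simp add: mm.diff_left mm.diff_right matrix_inv_left[OF B])
         (simp add: matrix_mul_assoc[symmetric] matrix_inv_right[OF A])
    then have "(matrix_inv B - matrix_inv A) - (- (matrix_inv A ** (B - A) ** matrix_inv A))
        = (matrix_inv A - matrix_inv B) ** (B - A) ** matrix_inv A"
      by (simp add: mm.diff_left[of "matrix_inv A" "matrix_inv B"]
          mm.diff_left[of "matrix_inv A ** (B - A)"])
    then have "norm ((matrix_inv B - matrix_inv A) - (- (matrix_inv A ** (B - A) ** matrix_inv A)))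
        \<le> norm (matrix_inv A - matrix_inv B) * norm (B - A) * norm (matrix_inv A)"
      using order_trans[OF norm_matrix_mult_le mult_right_mono[OF norm_matrix_mult_le norm_ge_zero],
          of "matrix_inv A - matrix_inv B" "B - A" "matrix_inv A"] by simp
    then show ?case
      by (cases "B = A") (auto simp: divide_le_eq mult_ac)
  qed
  have "((\<lambda>B. norm (matrix_inv A - matrix_inv B) * norm (matrix_inv A)) \<longlongrightarrow>
      norm (matrix_inv A - matrix_inv A) * norm (matrix_inv A)) (at A)"
    by (intro tendsto_intros tendsto_matrix_inv A tendsto_ident_at)
  then show "((\<lambda>B. norm ((matrix_inv B - matrix_inv A)
      - (- (matrix_inv A ** (B - A) ** matrix_inv A))) / norm (B - A)) \<longlongrightarrow> 0) (at A)"
    by (intro Lim_null_comparison[OF ev]) simp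
qed

section \<open>Divergences\<close>

lemma sum_Basis_transpose_mult:
  fixes P W :: "real^'p^'m"
  shows "(\<Sum>E\<in>Basis. (P ** transpose E ** W) \<bullet> E) = P \<bullet> W"
proof -
  have "(P ** transpose (axis i (axis j 1)) ** W) \<bullet> axis i (axis j 1) = P $ i $ j * W $ i $ j" for i j
    by (subst inner_commute) (simp only: inner_matrix_unit transpose_matrix_unit matrix_unit_mult)
  then show ?thesis unfolding sum_Basis_matrix by (simp add: inner_vec_def)
qed

lemma sum_Basis_mult_both:
  "(\<Sum>E\<in>(Basis :: (real^'p^'m) set). (U ** E ** V) \<bullet> E) = trace U * trace V"
proof -
  have "(U ** axis i (axis j 1) ** V) \<bullet> (axis i (axis j 1) :: real^'p^'m) = U $ i $ i * V $ j $ j" for i j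
    by (subst inner_commute) (simp only: inner_matrix_unit matrix_unit_mult)
  then show ?thesis unfolding sum_Basis_matrix by (simp add: trace_def sum_product)
qed

text \<open>
  Pairing \<open>D (R + W) = I\<close> with \<open>D = (R + W)\<^sup>-\<^sup>1\<close> and dropping the nonnegative contribution of \<open>W\<close>
  gives \<open>l |D|\<^sup>2 \<le> tr D\<close>. The bound is uniform in \<open>W\<close>, which makes the domination arguments for the
  fields below uniform in the rest of the sample.
\<close>
lemma norm_matrix_inv_bounded:
  fixes R :: "real^'p^'p"
  assumes R: "pos_def R"
  obtains t where "0 \<le> t" "\<forall>W. psd W \<longrightarrow> norm (matrix_inv (R + W)) \<le> t"
proof -
  obtain l where l: "0 < l" "\<forall>D :: real^'p^'p. l * (norm D)\<^sup>2 \<le> (D ** R) \<bullet> D"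
    by (rule pos_def_coercive[OF R]) (rule that)
  have "norm (matrix_inv (R + W)) \<le> norm (mat 1 :: real^'p^'p) / l" if W: "psd W" for W
  proof -
    define D where "D = matrix_inv (R + W)"
    have "psd (transpose (transpose D) ** W ** transpose D)" by (rule psd_congruence[OF W])
    from trace_psd_nonneg[OF this] have "0 \<le> (D ** W) \<bullet> D" by (simp add: inner_matrix_trace)
    moreover have "l * (norm D)\<^sup>2 \<le> (D ** R) \<bullet> D" using l(2) by blast
    moreover have "(D ** R) \<bullet> D + (D ** W) \<bullet> D = mat 1 \<bullet> D"
      using matrix_inv_left[OF invertible_pos_def[OF pos_def_add[OF R W]]]
      by (simp add: D_def inner_add_left[symmetric] mm.add_right[symmetric])
    moreover have "mat 1 \<bullet> D \<le> norm (mat 1 :: real^'p^'p) * norm D" by (rule norm_cauchy_schwarz)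
    ultimately have "l * (norm D)\<^sup>2 \<le> norm (mat 1 :: real^'p^'p) * norm D" by linarith
    then have "l * norm D \<le> norm (mat 1 :: real^'p^'p)"
      by (cases "D = 0") (auto simp: power2_eq_square)
    then show ?thesis using l(1) by (simp add: D_def field_simps)
  qed
  then show ?thesis using l(1) by (intro that[of "norm (mat 1 :: real^'p^'p) / l"]) auto
qed

text \<open>
  Vector fields built from the resolvent of \<open>R + \<gamma> Y\<^sup>T Y\<close>. They serve twice: with \<open>R = S\<close> and
  \<open>\<gamma> = \<beta>\<close> for the normal matrix \<open>X\<close>, and with \<open>\<gamma> = 1\<close> for a single row of the Wishart sample, where
  \<open>R\<close> collects the regularisation and the Gram matrix of the other rows.
\<close>
locale ridge_field =
  fixes R :: "real^'p^'p" and \<gamma> :: real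
  assumes R: "pos_def R" and \<gamma>: "0 \<le> \<gamma>"
begin

definition Tm :: "real^'p^'k \<Rightarrow> real^'p^'p" where
  "Tm Y = R + \<gamma> *\<^sub>R (transpose Y ** Y)"

definition Ti :: "real^'p^'k \<Rightarrow> real^'p^'p" where
  "Ti Y = matrix_inv (Tm Y)"

lemma pos_def_Tm: "pos_def (Tm (Y :: real^'p^'k))"
proof -
  have "psd (transpose Y ** Y)" by (rule psd_gram)
  then show ?thesis unfolding Tm_def by (intro pos_def_add R psd_scaleR \<gamma>)
qed

lemma has_derivative_Tm:
  "(Tm has_derivative (\<lambda>E. \<gamma> *\<^sub>R (transpose E ** Y + transpose Y ** E))) (at (Y :: real^'p^'k))"
proof -
  have "((\<lambda>Y :: real^'p^'k. transpose Y ** Y) has_derivative (\<lambda>E. transpose Y ** E + transpose E ** Y)) (at Y)"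
    by (rule mm.FDERIV[OF bounded_linear_imp_has_derivative[OF bounded_linear_transpose] has_derivative_ident])
  then show ?thesis unfolding Tm_def[abs_def]
    by (auto intro!: derivative_eq_intros simp: add.commute)
qed

lemma has_derivative_Ti:
  "(Ti has_derivative (\<lambda>E. - (\<gamma> *\<^sub>R (Ti Y ** transpose E ** Y ** Ti Y)) - \<gamma> *\<^sub>R (Ti Y ** transpose Y ** E ** Ti Y)))
     (at (Y :: real^'p^'k))"
proof -
  have "((\<lambda>Y. matrix_inv (Tm Y)) has_derivative (\<lambda>E. - (matrix_inv (Tm Y) **
      (\<gamma> *\<^sub>R (transpose E ** Y + transpose Y ** E)) ** matrix_inv (Tm Y)))) (at Y)"
    by (rule has_derivative_compose[OF has_derivative_Tm
          has_derivative_matrix_inv[OF invertible_pos_def[OF pos_def_Tm]]])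
  moreover have "Ti = (\<lambda>Y :: real^'p^'k. matrix_inv (Tm Y))" by (simp add: fun_eq_iff Ti_def)
  ultimately show ?thesis
    by (simp add: mat_distrib matrix_mul_assoc scaleR_add_right)
qed

lemma continuous_Ti: "continuous_on UNIV (Ti :: real^'p^'k \<Rightarrow> _)"
  by (intro continuous_at_imp_continuous_on ballI has_derivative_continuous[OF has_derivative_Ti])


definition field1 :: "real^'p^'p \<Rightarrow> real^'p^'k \<Rightarrow> real^'p^'k" where
  "field1 B Y = Y ** Ti Y ** B"

definition field1' :: "real^'p^'p \<Rightarrow> real^'p^'k \<Rightarrow> real^'p^'k \<Rightarrow> real^'p^'k" where
  "field1' B Y E = E ** (Ti Y ** B) - \<gamma> *\<^sub>R ((Y ** Ti Y) ** transpose E ** (Y ** Ti Y ** B))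
     - \<gamma> *\<^sub>R ((Y ** Ti Y ** transpose Y) ** E ** (Ti Y ** B))"

lemma field1_derivative: "(field1 B has_derivative field1' B Y) (at (Y :: real^'p^'k))"
proof -
  have "((\<lambda>Y. Y ** Ti Y ** B) has_derivative (\<lambda>E. (Y ** (- (\<gamma> *\<^sub>R (Ti Y ** transpose E ** Y ** Ti Y))
      - \<gamma> *\<^sub>R (Ti Y ** transpose Y ** E ** Ti Y)) + E ** Ti Y) ** B)) (at Y)"
    by (rule bounded_linear.has_derivative[OF mm.bounded_linear_left
        mm.FDERIV[OF has_derivative_ident has_derivative_Ti]])
  then show ?thesis
    unfolding field1_def[abs_def] field1'_def[abs_def]
    by (rule has_derivative_eq_rhs) (simp add: fun_eq_iff mat_distrib matrix_mul_assoc)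
qed

text \<open>
  Contracting \<open>U E V\<close> with \<open>E\<close> over all matrix units yields \<open>tr U tr V\<close>, whereas contracting
  \<open>U E\<^sup>T V\<close> yields the inner product of \<open>U\<close> and \<open>V\<close>.
\<close>
lemma field1_divergence:
  "(\<Sum>E\<in>Basis. field1' B (Y :: real^'p^'k) E \<bullet> E) = real CARD('k) * trace (Ti Y ** B)
    - \<gamma> * ((Y ** Ti Y) \<bullet> (Y ** Ti Y ** B) + trace (Y ** Ti Y ** transpose Y) * trace (Ti Y ** B))"
  unfolding field1'_def
  by (simp only: inner_diff_left inner_scaleR_left sum_subtractf sum_distrib_left[symmetric]
      sum_Basis_mult_right sum_Basis_transpose_mult sum_Basis_mult_both) (simp add: algebra_simps)

definition field2 :: "real^'p^'p \<Rightarrow> real^'p^'p \<Rightarrow> real^'p^'k \<Rightarrow> real^'p^'k" where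
  "field2 B D Y = Y ** Ti Y ** B ** Ti Y ** D"

definition field2' :: "real^'p^'p \<Rightarrow> real^'p^'p \<Rightarrow> real^'p^'k \<Rightarrow> real^'p^'k \<Rightarrow> real^'p^'k" where
  "field2' B D Y E = E ** (Ti Y ** B ** Ti Y ** D)
     - \<gamma> *\<^sub>R ((Y ** Ti Y) ** transpose E ** (Y ** Ti Y ** B ** Ti Y ** D))
     - \<gamma> *\<^sub>R ((Y ** Ti Y ** transpose Y) ** E ** (Ti Y ** B ** Ti Y ** D))
     - \<gamma> *\<^sub>R ((Y ** Ti Y ** B ** Ti Y) ** transpose E ** (Y ** Ti Y ** D))
     - \<gamma> *\<^sub>R ((Y ** Ti Y ** B ** Ti Y ** transpose Y) ** E ** (Ti Y ** D))"

lemma field2_derivative: "(field2 B D has_derivative field2' B D Y) (at (Y :: real^'p^'k))"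
proof -
  have "((\<lambda>Y. field1 B Y ** Ti Y ** D) has_derivative (\<lambda>E. (field1 B Y **
      (- (\<gamma> *\<^sub>R (Ti Y ** transpose E ** Y ** Ti Y)) - \<gamma> *\<^sub>R (Ti Y ** transpose Y ** E ** Ti Y))
      + field1' B Y E ** Ti Y) ** D)) (at Y)"
    by (rule bounded_linear.has_derivative[OF mm.bounded_linear_left
        mm.FDERIV[OF field1_derivative has_derivative_Ti]])
  then show ?thesis
    unfolding field1_def field2_def[abs_def] field2'_def[abs_def] field1'_def
    by (rule has_derivative_eq_rhs) (simp add: fun_eq_iff mat_distrib matrix_mul_assoc)
qed

lemma field2_divergence:
  "(\<Sum>E\<in>Basis. field2' B D (Y :: real^'p^'k) E \<bullet> E) = real CARD('k) * trace (Ti Y ** B ** Ti Y ** D)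
    - \<gamma> * ((Y ** Ti Y) \<bullet> (Y ** Ti Y ** B ** Ti Y ** D)
         + trace (Y ** Ti Y ** transpose Y) * trace (Ti Y ** B ** Ti Y ** D)
         + (Y ** Ti Y ** B ** Ti Y) \<bullet> (Y ** Ti Y ** D)
         + trace (Y ** Ti Y ** B ** Ti Y ** transpose Y) * trace (Ti Y ** D))"
  unfolding field2'_def
  by (simp only: inner_diff_left inner_scaleR_left sum_subtractf sum_distrib_left[symmetric]
      sum_Basis_mult_right sum_Basis_transpose_mult sum_Basis_mult_both) (simp add: algebra_simps)

end

section \<open>Stein's identity for the ridge fields\<close>

lemma norm_matrix_mult_mono: "norm A \<le> a \<Longrightarrow> norm B \<le> b \<Longrightarrow> norm ((A :: real^'n^'m) ** (B :: real^'p^'n)) \<le> a * b"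
  by (rule order_trans[OF norm_matrix_mult_le mult_mono]) (auto intro: order_trans[OF norm_ge_zero])

lemma abs_trace_le: "\<bar>trace (A :: real^'n^'n)\<bar> \<le> real CARD('n) * norm A"
proof -
  have "\<bar>A $ i $ i\<bar> \<le> norm A" for i
    using order_trans[OF component_le_norm_cart Finite_Cartesian_Product.norm_nth_le] by blast
  then have "\<bar>trace A\<bar> \<le> (\<Sum>i\<in>(UNIV :: 'n set). norm A)"
    unfolding trace_def by (intro order_trans[OF sum_abs] sum_mono)
  then show ?thesis by simp
qed

context ridge_field
begin

lemma field1_bounds:
  fixes Y :: "real^'p^'k"
  assumes t: "norm (Ti Y) \<le> t" and t0: "0 \<le> t"
  shows "norm (field1 B Y) \<le> (t * norm B + 2 * \<gamma> * (t * t) * norm B) * (1 + norm Y)"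
    and "E \<in> Basis \<Longrightarrow> \<bar>field1' B Y E \<bullet> E\<bar> \<le> (t * norm B + 2 * \<gamma> * (t * t) * norm B) * (1 + (norm Y)\<^sup>2)"
proof -
  define b y where "b = norm B" and "y = norm Y"
  have b: "0 \<le> b" and y: "0 \<le> y" by (auto simp: b_def y_def)
  have nB: "norm B \<le> b" and nY: "norm Y \<le> y" and nY': "norm (transpose Y) \<le> y" by (auto simp: b_def y_def)
  have g: "0 \<le> \<gamma> * (t * t) * b" using \<gamma> t0 b by simp
  have tb: "0 \<le> t * b" using t0 b by simp
  have "norm (field1 B Y) \<le> y * t * b" unfolding field1_def by (intro norm_matrix_mult_mono nY t nB)
  also have "\<dots> \<le> (t * b + 2 * \<gamma> * (t * t) * b) * (1 + y)"
  proof -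
    have "(t * b + 2 * \<gamma> * (t * t) * b) * (1 + y)
        = y * t * b + (t * b + 2 * (\<gamma> * (t * t) * b) + 2 * (\<gamma> * (t * t) * b * y))"
      by (simp add: algebra_simps)
    moreover have "0 \<le> \<gamma> * (t * t) * b * y" using g y by (rule mult_nonneg_nonneg)
    ultimately show ?thesis using g tb by linarith
  qed
  finally show "norm (field1 B Y) \<le> (t * norm B + 2 * \<gamma> * (t * t) * norm B) * (1 + norm Y)"
    by (simp only: b_def y_def)
  assume E: "E \<in> Basis"
  then have nE: "norm E \<le> 1" and nE': "norm (transpose E) \<le> 1" by auto
  have 1: "norm (E ** (Ti Y ** B)) \<le> 1 * (t * b)" by (intro norm_matrix_mult_mono nE t nB)
  have 2: "norm ((Y ** Ti Y) ** transpose E ** (Y ** Ti Y ** B)) \<le> ((y * t) * 1) * (y * t * b)"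
    by (intro norm_matrix_mult_mono nE' nY t nB)
  have 3: "norm ((Y ** Ti Y ** transpose Y) ** E ** (Ti Y ** B)) \<le> ((y * t * y) * 1) * (t * b)"
    by (intro norm_matrix_mult_mono nE nY' nY t nB)
  have "\<bar>field1' B Y E \<bullet> E\<bar> \<le> norm (field1' B Y E) * norm E" by (rule Cauchy_Schwarz_ineq2)
  also have "\<dots> = norm (field1' B Y E)" using E by simp
  also have "\<dots> \<le> norm (E ** (Ti Y ** B)) + \<gamma> * norm ((Y ** Ti Y) ** transpose E ** (Y ** Ti Y ** B))
      + \<gamma> * norm ((Y ** Ti Y ** transpose Y) ** E ** (Ti Y ** B))"
  proof -
    have s: "norm (u - \<gamma> *\<^sub>R v) \<le> norm u + \<gamma> * norm v" for u v :: "real^'p^'k"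
      using norm_triangle_ineq4[of u "\<gamma> *\<^sub>R v"] \<gamma> by simp
    have "norm (a - \<gamma> *\<^sub>R a1 - \<gamma> *\<^sub>R a2) \<le> norm a + \<gamma> * norm a1 + \<gamma> * norm a2" for a a1 a2 :: "real^'p^'k"
      using s[of a a1] s[of "a - \<gamma> *\<^sub>R a1" a2] by linarith
    then show ?thesis unfolding field1'_def .
  qed
  also have "\<dots> \<le> 1 * (t * b) + \<gamma> * (((y * t) * 1) * (y * t * b)) + \<gamma> * (((y * t * y) * 1) * (t * b))"
    by (intro add_mono mult_left_mono 1 2 3 \<gamma>)
  also have "\<dots> \<le> (t * b + 2 * \<gamma> * (t * t) * b) * (1 + y\<^sup>2)"
  proof -
    have "(t * b + 2 * \<gamma> * (t * t) * b) * (1 + y\<^sup>2)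
       = (1 * (t * b) + \<gamma> * (((y * t) * 1) * (y * t * b)) + \<gamma> * (((y * t * y) * 1) * (t * b)))
         + (2 * (\<gamma> * (t * t) * b) + t * b * y\<^sup>2)"
      by (simp add: algebra_simps power2_eq_square)
    moreover have "0 \<le> t * b * y\<^sup>2" using tb by simp
    ultimately show ?thesis using g by linarith
  qed
  finally show "\<bar>field1' B Y E \<bullet> E\<bar> \<le> (t * norm B + 2 * \<gamma> * (t * t) * norm B) * (1 + (norm Y)\<^sup>2)"
    by (simp only: b_def y_def)
qed

lemma field2_bounds:
  fixes Y :: "real^'p^'k" and B D :: "real^'p^'p"
  assumes t: "norm (Ti Y) \<le> t" and t0: "0 \<le> t"
  defines "K \<equiv> t * t * norm B * norm D + 4 * \<gamma> * (t * t * t) * norm B * norm D"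
  shows "norm (field2 B D Y) \<le> K * (1 + norm Y)"
    and "E \<in> Basis \<Longrightarrow> \<bar>field2' B D Y E \<bullet> E\<bar> \<le> K * (1 + (norm Y)\<^sup>2)"
proof -
  define b d y where "b = norm B" and "d = norm D" and "y = norm Y"
  have b: "0 \<le> b" and d: "0 \<le> d" and y: "0 \<le> y" by (auto simp: b_def d_def y_def)
  have nB: "norm B \<le> b" and nD: "norm D \<le> d" and nY: "norm Y \<le> y" and nY': "norm (transpose Y) \<le> y"
    by (auto simp: b_def d_def y_def)
  have K: "K = t * t * b * d + 4 * (\<gamma> * (t * t * t) * b * d)" by (simp add: K_def b_def d_def)
  have g: "0 \<le> \<gamma> * (t * t * t) * b * d" using \<gamma> t0 b d by simp
  have tb: "0 \<le> t * t * b * d" using t0 b d by simp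
  have "norm (field2 B D Y) \<le> y * t * b * t * d" unfolding field2_def by (intro norm_matrix_mult_mono nY t nB nD)
  also have "\<dots> \<le> K * (1 + y)"
  proof -
    have "K * (1 + y) = y * t * b * t * d + (t * t * b * d + 4 * (\<gamma> * (t * t * t) * b * d)
        + 4 * (\<gamma> * (t * t * t) * b * d * y))"
      by (simp add: K algebra_simps)
    moreover have "0 \<le> \<gamma> * (t * t * t) * b * d * y" using g y by (rule mult_nonneg_nonneg)
    ultimately show ?thesis using g tb by linarith
  qed
  finally show "norm (field2 B D Y) \<le> K * (1 + norm Y)" by (simp only: y_def)
  assume E: "E \<in> Basis"
  then have nE: "norm E \<le> 1" and nE': "norm (transpose E) \<le> 1" by auto
  let ?t0 = "E ** (Ti Y ** B ** Ti Y ** D)"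
  let ?t1 = "(Y ** Ti Y) ** transpose E ** (Y ** Ti Y ** B ** Ti Y ** D)"
  let ?t2 = "(Y ** Ti Y ** transpose Y) ** E ** (Ti Y ** B ** Ti Y ** D)"
  let ?t3 = "(Y ** Ti Y ** B ** Ti Y) ** transpose E ** (Y ** Ti Y ** D)"
  let ?t4 = "(Y ** Ti Y ** B ** Ti Y ** transpose Y) ** E ** (Ti Y ** D)"
  have 0: "norm ?t0 \<le> 1 * (t * b * t * d)" by (intro norm_matrix_mult_mono nE t nB nD)
  have 1: "norm ?t1 \<le> ((y * t) * 1) * (y * t * b * t * d)" by (intro norm_matrix_mult_mono nE' nY t nB nD)
  have 2: "norm ?t2 \<le> ((y * t * y) * 1) * (t * b * t * d)" by (intro norm_matrix_mult_mono nE nY' nY t nB nD)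
  have 3: "norm ?t3 \<le> ((y * t * b * t) * 1) * (y * t * d)" by (intro norm_matrix_mult_mono nE' nY t nB nD)
  have 4: "norm ?t4 \<le> ((y * t * b * t * y) * 1) * (t * d)" by (intro norm_matrix_mult_mono nE nY' nY t nB nD)
  have tri: "norm (a - \<gamma> *\<^sub>R a1 - \<gamma> *\<^sub>R a2 - \<gamma> *\<^sub>R a3 - \<gamma> *\<^sub>R a4)
      \<le> norm a + \<gamma> * norm a1 + \<gamma> * norm a2 + \<gamma> * norm a3 + \<gamma> * norm a4" for a a1 a2 a3 a4 :: "real^'p^'k"
  proof -
    have s: "norm (u - \<gamma> *\<^sub>R v) \<le> norm u + \<gamma> * norm v" for u v :: "real^'p^'k"
      using norm_triangle_ineq4[of u "\<gamma> *\<^sub>R v"] \<gamma> by simp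
    show ?thesis
      using s[of a a1] s[of "a - \<gamma> *\<^sub>R a1" a2] s[of "a - \<gamma> *\<^sub>R a1 - \<gamma> *\<^sub>R a2" a3]
        s[of "a - \<gamma> *\<^sub>R a1 - \<gamma> *\<^sub>R a2 - \<gamma> *\<^sub>R a3" a4] by linarith
  qed
  have "\<bar>field2' B D Y E \<bullet> E\<bar> \<le> norm (field2' B D Y E) * norm E" by (rule Cauchy_Schwarz_ineq2)
  also have "\<dots> = norm (field2' B D Y E)" using E by simp
  also have "\<dots> \<le> norm ?t0 + \<gamma> * norm ?t1 + \<gamma> * norm ?t2 + \<gamma> * norm ?t3 + \<gamma> * norm ?t4"
    unfolding field2'_def by (rule tri)
  also have "\<dots> \<le> 1 * (t * b * t * d) + \<gamma> * (((y * t) * 1) * (y * t * b * t * d))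
      + \<gamma> * (((y * t * y) * 1) * (t * b * t * d)) + \<gamma> * (((y * t * b * t) * 1) * (y * t * d))
      + \<gamma> * (((y * t * b * t * y) * 1) * (t * d))"
    by (intro add_mono mult_left_mono 0 1 2 3 4 \<gamma>)
  also have "\<dots> = t * t * b * d + 4 * (\<gamma> * (t * t * t) * b * d * y\<^sup>2)"
    by (simp add: algebra_simps power2_eq_square)
  also have "\<dots> \<le> K * (1 + y\<^sup>2)"
  proof -
    have "K * (1 + y\<^sup>2) = t * t * b * d + 4 * (\<gamma> * (t * t * t) * b * d * y\<^sup>2)
        + (4 * (\<gamma> * (t * t * t) * b * d) + t * t * b * d * y\<^sup>2)"
      by (simp add: K algebra_simps)
    moreover have "0 \<le> t * t * b * d * y\<^sup>2" using tb by simp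
    ultimately show ?thesis using g by linarith
  qed
  finally show "\<bar>field2' B D Y E \<bullet> E\<bar> \<le> K * (1 + (norm Y)\<^sup>2)" by (simp only: y_def)
qed

lemma norm_Ti_bounded:
  obtains t where "0 \<le> t" "\<forall>Y :: real^'p^'k. norm (Ti Y) \<le> t"
proof -
  obtain t where t: "0 \<le> t" "\<forall>W. psd W \<longrightarrow> norm (matrix_inv (R + W)) \<le> t"
    by (rule norm_matrix_inv_bounded[OF R]) (rule that)
  have "norm (Ti Y) \<le> t" for Y :: "real^'p^'k"
    unfolding Ti_def Tm_def using t(2) psd_scaleR[OF psd_gram \<gamma>] by blast
  with t(1) show ?thesis using that by blast
qed

lemma field1_stein:
  fixes \<Theta> :: "real^'p^'k"
  assumes \<Sigma>: "pos_def \<Sigma>"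
  shows "(\<integral>Y. ((Y - \<Theta>) ** matrix_inv \<Sigma>) \<bullet> field1 B Y \<partial>matrix_normal \<Theta> \<Sigma>)
      = (\<integral>Y. (\<Sum>E\<in>Basis. field1' B Y E \<bullet> E) \<partial>matrix_normal \<Theta> \<Sigma>)"
    and "integrable (matrix_normal \<Theta> \<Sigma>) (\<lambda>Y. ((Y - \<Theta>) ** matrix_inv \<Sigma>) \<bullet> field1 B Y)"
    and "integrable (matrix_normal \<Theta> \<Sigma>) (\<lambda>Y. \<Sum>E\<in>Basis. field1' B Y E \<bullet> E)"
proof -
  obtain t where t: "0 \<le> t" "\<forall>Y :: real^'p^'k. norm (Ti Y) \<le> t" by (rule norm_Ti_bounded) (rule that)
  have c: "continuous_on UNIV (\<lambda>Y. field1' B Y E \<bullet> E)" for E :: "real^'p^'k"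
    unfolding field1'_def
    by (intro continuous_intros mm.continuous_on continuous_Ti
        bounded_linear.continuous_on[OF bounded_linear_transpose])
  have tY: "norm (Ti Y) \<le> t" for Y :: "real^'p^'k" using t(2) by blast
  note prems = field1_derivative c field1_bounds(1)[OF tY t(1)] field1_bounds(2)[OF tY t(1)]
  show "(\<integral>Y. ((Y - \<Theta>) ** matrix_inv \<Sigma>) \<bullet> field1 B Y \<partial>matrix_normal \<Theta> \<Sigma>)
      = (\<integral>Y. (\<Sum>E\<in>Basis. field1' B Y E \<bullet> E) \<partial>matrix_normal \<Theta> \<Sigma>)"
    by (rule matrix_normal_stein(1)[OF \<Sigma> prems])
  show "integrable (matrix_normal \<Theta> \<Sigma>) (\<lambda>Y. ((Y - \<Theta>) ** matrix_inv \<Sigma>) \<bullet> field1 B Y)"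
    by (rule matrix_normal_stein(2)[OF \<Sigma> prems])
  show "integrable (matrix_normal \<Theta> \<Sigma>) (\<lambda>Y. \<Sum>E\<in>Basis. field1' B Y E \<bullet> E)"
    by (rule matrix_normal_stein(3)[OF \<Sigma> prems])
qed

lemma field2_stein:
  fixes \<Theta> :: "real^'p^'k"
  assumes \<Sigma>: "pos_def \<Sigma>"
  shows "(\<integral>Y. ((Y - \<Theta>) ** matrix_inv \<Sigma>) \<bullet> field2 B D Y \<partial>matrix_normal \<Theta> \<Sigma>)
      = (\<integral>Y. (\<Sum>E\<in>Basis. field2' B D Y E \<bullet> E) \<partial>matrix_normal \<Theta> \<Sigma>)"
proof -
  obtain t where t: "0 \<le> t" "\<forall>Y :: real^'p^'k. norm (Ti Y) \<le> t" by (rule norm_Ti_bounded) (rule that)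
  have c: "continuous_on UNIV (\<lambda>Y. field2' B D Y E \<bullet> E)" for E :: "real^'p^'k"
    unfolding field2'_def
    by (intro continuous_intros mm.continuous_on continuous_Ti
        bounded_linear.continuous_on[OF bounded_linear_transpose])
  have tY: "norm (Ti Y) \<le> t" for Y :: "real^'p^'k" using t(2) by blast
  show ?thesis
    by (rule matrix_normal_stein(1)[OF \<Sigma> field2_derivative c field2_bounds(1)[OF tY t(1)]
      field2_bounds(2)[OF tY t(1)]])
qed

end

section \<open>The Wishart distribution as the law of a Gram matrix\<close>

text \<open>
  The sample is a family of \<open>1 \<times> p\<close> matrices, so that each row follows a matrix normal law with one
  row and Stein's identity applies to it as it stands.
\<close>
definition gram :: "nat \<Rightarrow> (nat \<Rightarrow> real^'p^1) \<Rightarrow> real^'p^'p" where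
  "gram n z = (\<Sum>i<n. transpose (z i) ** z i)"

abbreviation rows_law :: "nat \<Rightarrow> real^'p^'p \<Rightarrow> (nat \<Rightarrow> real^'p^1) measure" where
  "rows_law n \<Sigma> \<equiv> Pi\<^sub>M {..<n} (\<lambda>_. matrix_normal (0 :: real^'p^1) \<Sigma>)"

lemma wishart_gram: "wishart n (\<Sigma> :: real^'p^'p) = distr (rows_law n \<Sigma>) borel (gram n)"
  by (simp add: wishart_def gram_def[abs_def])

lemma psd_gram_rows: "psd (gram n z)"
  unfolding gram_def by (intro psd_sum psd_gram) auto

lemma measurable_outer [measurable]:
  "(\<lambda>y :: real^'p^'k. transpose y ** y) \<in> borel_measurable borel"
  by (intro borel_measurable_continuous_onI mm.continuous_on
      bounded_linear.continuous_on[OF bounded_linear_transpose] continuous_intros)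

lemma measurable_row:
  fixes \<Sigma> :: "real^'p^'p"
  shows "i < n \<Longrightarrow> (\<lambda>z. z i) \<in> measurable (rows_law n \<Sigma>) borel"
  using measurable_component_singleton[of i "{..<n}" "\<lambda>_. matrix_normal (0 :: real^'p^1) \<Sigma>"]
  by (simp add: measurable_cong_sets[OF refl sets_matrix_normal])

lemma measurable_gram:
  fixes \<Sigma> :: "real^'p^'p"
  shows "gram n \<in> borel_measurable (rows_law n \<Sigma>)"
  unfolding gram_def[abs_def]
  by (intro borel_measurable_sum measurable_compose[OF measurable_row measurable_outer]) auto

lemma prob_space_rows_law: "pos_def (\<Sigma> :: real^'p^'p) \<Longrightarrow> prob_space (rows_law n \<Sigma>)"
  by (intro prob_space_PiM prob_space_matrix_normal)

lemma integrable_row_norm: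
  fixes \<Sigma> :: "real^'p^'p"
  assumes \<Sigma>: "pos_def \<Sigma>" and i: "i < n"
  shows "integrable (rows_law n \<Sigma>) (\<lambda>z. 1 + (norm (z i))\<^sup>2)"
proof -
  have d: "distr (rows_law n \<Sigma>) (matrix_normal 0 \<Sigma>) (\<lambda>z. z i) = matrix_normal 0 \<Sigma>"
    by (rule distr_PiM_component[where M = "\<lambda>_. matrix_normal 0 \<Sigma>"])
      (use i prob_space_matrix_normal[OF \<Sigma>] in auto)
  have "integrable (matrix_normal (0 :: real^'p^1) \<Sigma>) (\<lambda>y. 1 + (norm y)\<^sup>2)"
    by (rule integrable_matrix_normal[OF \<Sigma>, where B = 1]) auto
  then have "integrable (distr (rows_law n \<Sigma>) (matrix_normal 0 \<Sigma>) (\<lambda>z. z i)) (\<lambda>y. 1 + (norm y)\<^sup>2)"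
    by (simp only: d)
  then show ?thesis
    by (subst (asm) integrable_distr_eq) (use i in auto)
qed

text \<open>
  Given the other rows, the Gram matrix is \<open>S\<^sub>0 + y\<^sup>T y\<close> with a positive semidefinite \<open>S\<^sub>0\<close> that does not
  depend on the row \<open>y\<close>. An identity in \<open>y\<close> that holds for every such \<open>S\<^sub>0\<close> therefore holds for each row
  of the sample, and it is summed over the rows.
\<close>
lemma rows_law_stein:
  fixes F G :: "real^'p^'p \<Rightarrow> real^'p^1 \<Rightarrow> real" and \<Sigma> :: "real^'p^'p"
  assumes \<Sigma>: "pos_def \<Sigma>"
    and meas: "case_prod F \<in> borel_measurable borel" "case_prod G \<in> borel_measurable borel"
    and bound: "\<And>S0 y. psd S0 \<Longrightarrow> \<bar>F (S0 + transpose y ** y) y\<bar> \<le> C * (1 + (norm y)\<^sup>2)"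
      "\<And>S0 y. psd S0 \<Longrightarrow> \<bar>G (S0 + transpose y ** y) y\<bar> \<le> C * (1 + (norm y)\<^sup>2)"
    and stein: "\<And>S0. psd S0 \<Longrightarrow>
      (\<integral>y. F (S0 + transpose y ** y) y \<partial>matrix_normal 0 \<Sigma>) = (\<integral>y. G (S0 + transpose y ** y) y \<partial>matrix_normal 0 \<Sigma>)"
  shows "(\<integral>z. (\<Sum>i<n. F (gram n z) (z i)) - (\<Sum>i<n. G (gram n z) (z i)) \<partial>rows_law n \<Sigma>) = 0"
proof -
  let ?N = "matrix_normal (0 :: real^'p^1) \<Sigma>"
  interpret N: prob_space ?N by (rule prob_space_matrix_normal[OF \<Sigma>])
  interpret product_sigma_finite "\<lambda>_::nat. ?N"
    by (intro product_sigma_finite.intro N.sigma_finite_measure_axioms)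
  have row: "integrable (rows_law n \<Sigma>) (\<lambda>z. F (gram n z) (z i) - G (gram n z) (z i))
      \<and> (\<integral>z. F (gram n z) (z i) - G (gram n z) (z i) \<partial>rows_law n \<Sigma>) = 0" if i: "i < n" for i
  proof
    define I where "I = {..<n} - {i}"
    have I: "finite I" "i \<notin> I" "insert i I = {..<n}" using i by (auto simp: I_def)
    define S0 where "S0 z = (\<Sum>j\<in>I. transpose (z j) ** z j)" for z :: "nat \<Rightarrow> real^'p^1"
    have S0: "psd (S0 z)" for z unfolding S0_def by (intro psd_sum psd_gram I)
    have gram: "gram n z = S0 z + transpose (z i) ** z i" for z
      using sum.insert[OF I(1,2), of "\<lambda>j. transpose (z j) ** z j"]
      by (simp add: gram_def S0_def I(3) add.commute)
    have gmeas: "(\<lambda>z. (gram n z, z i)) \<in> measurable (rows_law n \<Sigma>) borel"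
      unfolding borel_prod[symmetric] by (intro measurable_Pair measurable_gram measurable_row i)
    have mF: "(\<lambda>z. F (gram n z) (z i)) \<in> borel_measurable (rows_law n \<Sigma>)"
      using measurable_compose[OF gmeas meas(1)] by simp
    have mG: "(\<lambda>z. G (gram n z) (z i)) \<in> borel_measurable (rows_law n \<Sigma>)"
      using measurable_compose[OF gmeas meas(2)] by simp
    have C: "C * (1 + (norm y)\<^sup>2) \<le> \<bar>C\<bar> * (1 + (norm y)\<^sup>2)" for y :: "real^'p^1"
      by (intro mult_right_mono) auto
    have dom: "integrable (rows_law n \<Sigma>) (\<lambda>z. \<bar>C\<bar> * (1 + (norm (z i))\<^sup>2))"
      by (intro integrable_mult_right integrable_row_norm \<Sigma> i)
    have iF: "integrable (rows_law n \<Sigma>) (\<lambda>z. F (gram n z) (z i))"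
    proof (rule Bochner_Integration.integrable_bound[OF dom mF], intro always_eventually allI)
      fix z show "norm (F (gram n z) (z i)) \<le> norm (\<bar>C\<bar> * (1 + (norm (z i))\<^sup>2))"
        using order_trans[OF bound(1)[OF S0[of z], of "z i"] C] by (simp add: gram abs_mult)
    qed
    have iG: "integrable (rows_law n \<Sigma>) (\<lambda>z. G (gram n z) (z i))"
    proof (rule Bochner_Integration.integrable_bound[OF dom mG], intro always_eventually allI)
      fix z show "norm (G (gram n z) (z i)) \<le> norm (\<bar>C\<bar> * (1 + (norm (z i))\<^sup>2))"
        using order_trans[OF bound(2)[OF S0[of z], of "z i"] C] by (simp add: gram abs_mult)
    qed
    show int: "integrable (rows_law n \<Sigma>) (\<lambda>z. F (gram n z) (z i) - G (gram n z) (z i))"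
      using iF iG by (rule Bochner_Integration.integrable_diff)
    have inner: "(\<integral>y. F (gram n (x(i := y))) ((x(i := y)) i) - G (gram n (x(i := y))) ((x(i := y)) i) \<partial>?N) = 0" for x
    proof -
      have g: "gram n (x(i := y)) = S0 x + transpose y ** y" for y
      proof -
        have "S0 (x(i := y)) = S0 x" unfolding S0_def using I by (intro sum.cong) auto
        then show ?thesis by (simp add: gram)
      qed
      have pm: "(\<lambda>y. (S0 x + transpose y ** y, y)) \<in> borel_measurable borel"
        unfolding borel_prod[symmetric] by measurable
      have "integrable ?N (\<lambda>y. F (S0 x + transpose y ** y) y)"
        by (rule integrable_matrix_normal[OF \<Sigma> _ bound(1)[OF S0]])
          (use measurable_compose[OF pm meas(1)] in simp)
      moreover have "integrable ?N (\<lambda>y. G (S0 x + transpose y ** y) y)"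
        by (rule integrable_matrix_normal[OF \<Sigma> _ bound(2)[OF S0]])
          (use measurable_compose[OF pm meas(2)] in simp)
      ultimately show ?thesis using stein[OF S0[of x]] by (simp add: g)
    qed
    have "(\<integral>z. F (gram n z) (z i) - G (gram n z) (z i) \<partial>Pi\<^sub>M (insert i I) (\<lambda>_. ?N))
        = (\<integral>x. (\<integral>y. F (gram n (x(i := y))) ((x(i := y)) i) - G (gram n (x(i := y))) ((x(i := y)) i) \<partial>?N)
            \<partial>Pi\<^sub>M I (\<lambda>_. ?N))"
      by (rule product_integral_insert[OF I(1,2)]) (use int I(3) in simp)
    then show "(\<integral>z. F (gram n z) (z i) - G (gram n z) (z i) \<partial>rows_law n \<Sigma>) = 0"
      unfolding inner I(3) by simp
  qed
  have "(\<integral>z. (\<Sum>i<n. F (gram n z) (z i)) - (\<Sum>i<n. G (gram n z) (z i)) \<partial>rows_law n \<Sigma>)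
      = (\<integral>z. (\<Sum>i<n. F (gram n z) (z i) - G (gram n z) (z i)) \<partial>rows_law n \<Sigma>)"
    by (simp add: sum_subtractf)
  also have "\<dots> = (\<Sum>i<n. \<integral>z. F (gram n z) (z i) - G (gram n z) (z i) \<partial>rows_law n \<Sigma>)"
    by (rule Bochner_Integration.integral_sum) (use row in auto)
  also have "\<dots> = 0" using row by (intro sum.neutral) auto
  finally show ?thesis .
qed

lemma sum_rows_inner:
  fixes z :: "nat \<Rightarrow> real^'p^1" and A W :: "real^'p^'p"
  shows
  "(\<Sum>i<n. (z i ** A) \<bullet> (z i ** W)) = trace (A ** transpose W ** gram n z)"
proof -
  have "(y ** A) \<bullet> (y ** W) = trace (A ** transpose W ** (transpose y ** y))" for y :: "real^'p^1"
  proof -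
    have "(y ** A) \<bullet> (y ** W) = trace (y ** (A ** transpose W ** transpose y))"
      by (simp add: inner_matrix_trace matrix_transpose_mul matrix_mul_assoc)
    also have "\<dots> = trace ((A ** transpose W ** transpose y) ** y)" by (rule trace_mul_sym)
    finally show ?thesis by (simp only: matrix_mul_assoc)
  qed
  then show ?thesis by (simp add: gram_def mm.sum_right trace_sum)
qed

lemma sum_rows_trace:
  fixes z :: "nat \<Rightarrow> real^'p^1" and A :: "real^'p^'p"
  shows
  "(\<Sum>i<n. trace (z i ** A ** transpose (z i))) = trace (A ** gram n z)"
proof -
  have "trace (y ** A ** transpose y) = trace (A ** (transpose y ** y))" for y :: "real^'p^1"
  proof -
    have "trace (y ** A ** transpose y) = trace (y ** (A ** transpose y))" by (simp only: matrix_mul_assoc)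
    also have "\<dots> = trace ((A ** transpose y) ** y)" by (rule trace_mul_sym)
    finally show ?thesis by (simp only: matrix_mul_assoc)
  qed
  then show ?thesis by (simp add: gram_def mm.sum_right trace_sum)
qed

section \<open>Nonsingularity of the Wishart matrix and integrability of its log-determinant\<close>

text \<open>
  Almost everywhere the integrand is at most \<open>|s + t|\<^bsup>-1/2\<^esup>\<close>, uniformly in \<open>e\<close>. This is at most \<open>1\<close> off \<open>[-1,1]\<close> and
  has integral \<open>2\<close> over each half of that interval, whence \<open>5 = 1 + 2 + 2\<close>.
\<close>
lemma nn_integral_inv_sqrt_window:
  fixes s e :: real
  assumes e: "0 < e"
  shows "(\<integral>\<^sup>+t. indicator {0..1} t * ennreal ((e + (s + t)\<^sup>2) powr (- 1 / 4)) \<partial>lborel) \<le> ennreal 5"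
proof -
  define w where "w x = indicator {0..1} x * x powr (- 1 / 2)" for x :: real
  have [measurable]: "w \<in> borel_measurable borel" unfolding w_def by measurable
  have w: "(\<integral>\<^sup>+x. ennreal (w x) \<partial>lborel) = ennreal 2"
  proof (rule nn_integral_has_integral_lborel)
    have "((\<lambda>x::real. x powr (- 1 / 2)) has_integral (1 powr (- 1 / 2 + 1) / (- 1 / 2 + 1))) {0..1}"
      by (rule has_integral_powr_from_0) auto
    then have "((\<lambda>x::real. x powr (- 1 / 2)) has_integral 2) {0..1}" by simp
    then have "((\<lambda>x::real. if x \<in> {0..1} then x powr (- 1 / 2) else 0) has_integral 2) UNIV"
      by (simp only: has_integral_restrict_UNIV)
    moreover have "(\<lambda>x::real. if x \<in> {0..1} then x powr (- 1 / 2) else 0) = w"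
      by (auto simp: w_def fun_eq_iff)
    ultimately show "(w has_integral 2) UNIV" by simp
  qed (auto simp: w_def)
  have pw: "(e + x\<^sup>2) powr (- 1 / 4) \<le> 1 + w x + w (- x)" if "x \<noteq> 0" for x
  proof -
    have "(e + x\<^sup>2) powr (- 1 / 4) \<le> (x\<^sup>2) powr (- 1 / 4)"
      using that e by (intro powr_mono2') auto
    also have "(x\<^sup>2) powr (- 1 / 4) = \<bar>x\<bar> powr (- 1 / 2)"
    proof -
      have "x\<^sup>2 = \<bar>x\<bar> powr 2" using that by simp
      then show ?thesis by (simp only: powr_powr) simp
    qed
    also have "\<dots> \<le> 1 + w x + w (- x)"
    proof (cases "\<bar>x\<bar> \<le> 1")
      case True
      then show ?thesis using that by (cases "0 < x") (auto simp: w_def indicator_def)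
    next
      case False
      then have "\<bar>x\<bar> powr (- 1 / 2) \<le> 1 powr (- 1 / 2)" by (intro powr_mono2') auto
      moreover have "0 \<le> w x" "0 \<le> w (- x)" by (auto simp: w_def)
      ultimately show ?thesis by simp
    qed
    finally show ?thesis .
  qed
  have shift: "(\<integral>\<^sup>+t. ennreal (w (s + t)) \<partial>lborel) = ennreal 2"
    using nn_integral_real_affine[of "\<lambda>x. ennreal (w x)" 1 s] w by simp
  have refl: "(\<integral>\<^sup>+t. ennreal (w (- (s + t))) \<partial>lborel) = ennreal 2"
    using nn_integral_real_affine[of "\<lambda>x. ennreal (w x)" "-1" "- s"] w by (simp add: algebra_simps)
  have "(\<integral>\<^sup>+t. indicator {0..1} t * ennreal ((e + (s + t)\<^sup>2) powr (- 1 / 4)) \<partial>lborel)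
      \<le> (\<integral>\<^sup>+t. indicator {0..1} t + (ennreal (w (s + t)) + ennreal (w (- (s + t)))) \<partial>lborel)"
  proof (rule nn_integral_mono_AE)
    show "AE t in lborel. indicator {0..1} t * ennreal ((e + (s + t)\<^sup>2) powr (- 1 / 4))
        \<le> indicator {0..1} t + (ennreal (w (s + t)) + ennreal (w (- (s + t))))"
      using AE_lborel_singleton[of "- s"]
    proof eventually_elim
      case (elim t)
      then have "s + t \<noteq> 0" by auto
      from pw[OF this] have "ennreal ((e + (s + t)\<^sup>2) powr (- 1 / 4))
          \<le> ennreal (1 + w (s + t) + w (- (s + t)))" by (rule ennreal_leI)
      also have "\<dots> = 1 + (ennreal (w (s + t)) + ennreal (w (- (s + t))))"
        by (simp add: w_def ennreal_plus add.assoc del: minus_add_distrib)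
      finally show ?case by (auto split: split_indicator)
    qed
  qed
  also have "\<dots> = 1 + (ennreal 2 + ennreal 2)"
    by (subst nn_integral_add, simp, simp, subst nn_integral_add) (simp_all only: shift refl, auto)
  also have "\<dots> = ennreal 5" by simp
  finally show ?thesis .
qed

text \<open>
  Instead of choosing coordinates along \<open>v\<close>, the integral is averaged over its translates by \<open>t v\<close> with
  \<open>0 \<le> t \<le> 1\<close>. The average over \<open>t\<close> smooths the singularity in \<open>v \<bullet> y\<close>, and the translation changes the
  Gaussian weight by at most the factor \<open>e\<^sup>a\<close> when its exponent is halved.
\<close>
lemma nn_integral_inv_sqrt_gauss:
  fixes v :: "'a::euclidean_space" and e a :: real
  assumes v: "norm v = 1" and e: "0 < e" and a: "0 < a"
  shows "(\<integral>\<^sup>+y. ennreal ((e + (v \<bullet> y)\<^sup>2) powr (- 1 / 4)) * ennreal (exp (- a * (norm y)\<^sup>2)) \<partial>lborel)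
    \<le> ennreal (5 * exp a * sqrt (pi / (a / 2)) ^ DIM('a))"
proof -
  define f where "f y = ennreal ((e + (v \<bullet> y)\<^sup>2) powr (- 1 / 4)) * ennreal (exp (- a * (norm y)\<^sup>2))" for y
  have [measurable]: "f \<in> borel_measurable borel" unfolding f_def by measurable
  have vv: "v \<bullet> v = 1" using v by (simp add: norm_eq_1)
  have shift: "(\<integral>\<^sup>+y. f (y + t *\<^sub>R v) \<partial>lborel) = (\<integral>\<^sup>+y. f y \<partial>lborel)" for t
  proof -
    have "distr lborel borel (\<lambda>y. y + t *\<^sub>R v) = lborel"
      using lborel_distr_plus[of "t *\<^sub>R v"] by (simp add: add.commute[of _ "t *\<^sub>R v"] cong: distr_cong)
    then have "(\<integral>\<^sup>+y. f y \<partial>lborel) = (\<integral>\<^sup>+y. f y \<partial>distr lborel borel (\<lambda>y. y + t *\<^sub>R v))" by simp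
    also have "\<dots> = (\<integral>\<^sup>+y. f (y + t *\<^sub>R v) \<partial>lborel)" by (rule nn_integral_distr) auto
    finally show ?thesis by simp
  qed
  have bd: "indicator {0..1} t * f (y + t *\<^sub>R v) \<le> ennreal (exp a * exp (- (a / 2) * (norm y)\<^sup>2))
      * (indicator {0..1} t * ennreal ((e + (v \<bullet> y + t)\<^sup>2) powr (- 1 / 4)))" for y t
  proof (cases "t \<in> {0..1}")
    case True
    have "norm y \<le> norm (y + t *\<^sub>R v) + \<bar>t\<bar>"
      using norm_triangle_ineq4[of "y + t *\<^sub>R v" "t *\<^sub>R v"] v by simp
    then have "(norm y)\<^sup>2 \<le> (norm (y + t *\<^sub>R v) + \<bar>t\<bar>)\<^sup>2" by (intro power_mono) auto
    also have "\<dots> \<le> 2 * (norm (y + t *\<^sub>R v))\<^sup>2 + 2 * t\<^sup>2"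
      using sum_squares_bound[of "norm (y + t *\<^sub>R v)" "\<bar>t\<bar>"] by (simp add: power2_sum)
    also have "\<dots> \<le> 2 * (norm (y + t *\<^sub>R v))\<^sup>2 + 2"
      using True by (simp add: power_le_one)
    finally have n: "(norm y)\<^sup>2 \<le> 2 * (norm (y + t *\<^sub>R v))\<^sup>2 + 2" .
    have "a * (norm y)\<^sup>2 \<le> a * (2 * (norm (y + t *\<^sub>R v))\<^sup>2 + 2)"
      using n a by (intro mult_left_mono) auto
    then have "- a * (norm (y + t *\<^sub>R v))\<^sup>2 \<le> a + - (a / 2) * (norm y)\<^sup>2"
      by (simp add: algebra_simps)
    then have "exp (- a * (norm (y + t *\<^sub>R v))\<^sup>2) \<le> exp (a + - (a / 2) * (norm y)\<^sup>2)"
      by (simp only: exp_le_cancel_iff)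
    then have "exp (- a * (norm (y + t *\<^sub>R v))\<^sup>2) \<le> exp a * exp (- (a / 2) * (norm y)\<^sup>2)"
      by (simp only: exp_add)
    moreover have "v \<bullet> (y + t *\<^sub>R v) = v \<bullet> y + t" by (simp add: inner_add_right vv)
    ultimately have "f (y + t *\<^sub>R v) \<le> ennreal ((e + (v \<bullet> y + t)\<^sup>2) powr (- 1 / 4))
        * ennreal (exp a * exp (- (a / 2) * (norm y)\<^sup>2))"
      unfolding f_def by (simp only:) (intro mult_left_mono ennreal_leI, auto)
    moreover have "indicator {0..1} t = (1 :: ennreal)" using True by simp
    ultimately show ?thesis by (simp only: mult_1_left mult.commute)
  next
    case False
    then have "indicator {0..1} t = (0 :: ennreal)" by simp
    then show ?thesis by (simp only: mult_zero_left) simp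
  qed
  have "(\<integral>\<^sup>+y. f y \<partial>lborel) = (\<integral>\<^sup>+t. indicator {0..1::real} t * (\<integral>\<^sup>+y. f y \<partial>lborel) \<partial>lborel)"
    by (simp add: nn_integral_multc)
  also have "\<dots> = (\<integral>\<^sup>+t. (\<integral>\<^sup>+y. indicator {0..1} t * f (y + t *\<^sub>R v) \<partial>lborel) \<partial>lborel)"
    by (intro nn_integral_cong) (simp add: nn_integral_cmult shift)
  also have "\<dots> = (\<integral>\<^sup>+y. (\<integral>\<^sup>+t. indicator {0..1} t * f (y + t *\<^sub>R v) \<partial>lborel) \<partial>lborel)"
    by (rule lborel_pair.Fubini') measurable
  also have "\<dots> \<le> (\<integral>\<^sup>+y. (\<integral>\<^sup>+t. ennreal (exp a * exp (- (a / 2) * (norm y)\<^sup>2))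
      * (indicator {0..1} t * ennreal ((e + (v \<bullet> y + t)\<^sup>2) powr (- 1 / 4))) \<partial>lborel) \<partial>lborel)"
    by (intro nn_integral_mono bd)
  also have "\<dots> = (\<integral>\<^sup>+y. ennreal (exp a * exp (- (a / 2) * (norm y)\<^sup>2))
      * (\<integral>\<^sup>+t. indicator {0..1} t * ennreal ((e + (v \<bullet> y + t)\<^sup>2) powr (- 1 / 4)) \<partial>lborel) \<partial>lborel)"
    by (intro nn_integral_cong nn_integral_cmult) measurable
  also have "\<dots> \<le> (\<integral>\<^sup>+y. ennreal (exp a * exp (- (a / 2) * (norm y)\<^sup>2)) * ennreal 5 \<partial>(lborel :: 'a measure))"
    by (intro nn_integral_mono mult_left_mono nn_integral_inv_sqrt_window e) auto
  also have "\<dots> = (\<integral>\<^sup>+y. ennreal (5 * exp a) * ennreal (exp (- (a / 2) * (norm y)\<^sup>2)) \<partial>(lborel :: 'a measure))"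
  proof (intro nn_integral_cong)
    fix y :: 'a
    have "ennreal (exp a * g) * ennreal 5 = ennreal (5 * exp a) * ennreal g" for g
    proof -
      have "ennreal (exp a * g) * ennreal 5 = ennreal ((exp a * g) * 5)"
        by (rule ennreal_mult''[symmetric]) simp
      moreover have "ennreal (5 * exp a) * ennreal g = ennreal ((5 * exp a) * g)"
        by (rule ennreal_mult'[symmetric]) simp
      ultimately show ?thesis by (simp only: mult_ac)
    qed
    then show "ennreal (exp a * exp (- (a / 2) * (norm y)\<^sup>2)) * ennreal 5
        = ennreal (5 * exp a) * ennreal (exp (- (a / 2) * (norm y)\<^sup>2))" .
  qed
  also have "\<dots> = ennreal (5 * exp a) * ennreal (sqrt (pi / (a / 2)) ^ DIM('a))"
    using a by (subst nn_integral_cmult) (auto simp: nn_integral_exp_norm[of "a / 2", where 'a = 'a, simplified])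
  finally show ?thesis using a by (simp add: f_def ennreal_mult)
qed

lemma nn_integral_inv_sqrt_matrix_normal:
  fixes \<Sigma> :: "real^'p^'p"
  assumes \<Sigma>: "pos_def \<Sigma>"
  obtains C where "0 \<le> C" "\<forall>v e. norm v = 1 \<longrightarrow> 0 < e \<longrightarrow>
    (\<integral>\<^sup>+y. ennreal ((e + (v \<bullet> y)\<^sup>2) powr (- 1 / 4)) \<partial>matrix_normal (0 :: real^'p^'k) \<Sigma>) \<le> ennreal C"
proof -
  define c where "c = (2 * pi) powr (- (real CARD('k) * real CARD('p)) / 2) * det \<Sigma> powr (- real CARD('k) / 2)"
  have c: "0 \<le> c" by (simp add: c_def)
  obtain l where l: "0 < l" "\<forall>D :: real^'p^'k. l * (norm D)\<^sup>2 \<le> (D ** matrix_inv \<Sigma>) \<bullet> D"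
    by (rule pos_def_coercive[OF pos_def_matrix_inv[OF \<Sigma>]]) (rule that)
  have dens: "matrix_normal_density 0 \<Sigma> Y \<le> c * exp (- (l / 2) * (norm Y)\<^sup>2)" for Y :: "real^'p^'k"
    unfolding matrix_normal_density_gauss c_def[symmetric] gauss_weight_def
    using l(2)[rule_format, of Y] c by (intro mult_left_mono) auto
  define C where "C = c * (5 * exp (l / 2) * sqrt (pi / (l / 2 / 2)) ^ DIM(real^'p^'k))"
  have "(\<integral>\<^sup>+y. ennreal ((e + (v \<bullet> y)\<^sup>2) powr (- 1 / 4)) \<partial>matrix_normal (0 :: real^'p^'k) \<Sigma>) \<le> ennreal C"
    if v: "norm v = 1" and e: "0 < e" for v e
  proof -
    have "(\<integral>\<^sup>+y. ennreal ((e + (v \<bullet> y)\<^sup>2) powr (- 1 / 4)) \<partial>matrix_normal (0 :: real^'p^'k) \<Sigma>)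
        = (\<integral>\<^sup>+y. ennreal (matrix_normal_density 0 \<Sigma> y) * ennreal ((e + (v \<bullet> y)\<^sup>2) powr (- 1 / 4)) \<partial>lborel)"
      unfolding matrix_normal_def by (rule nn_integral_density) measurable
    also have "\<dots> \<le> (\<integral>\<^sup>+y. ennreal c * (ennreal ((e + (v \<bullet> y)\<^sup>2) powr (- 1 / 4))
        * ennreal (exp (- (l / 2) * (norm y)\<^sup>2))) \<partial>lborel)"
    proof (intro nn_integral_mono)
      fix y :: "real^'p^'k"
      have "ennreal (matrix_normal_density 0 \<Sigma> y) \<le> ennreal c * ennreal (exp (- (l / 2) * (norm y)\<^sup>2))"
        using ennreal_leI[OF dens[of y]] c by (simp add: ennreal_mult)
      then have "ennreal (matrix_normal_density 0 \<Sigma> y) * ennreal ((e + (v \<bullet> y)\<^sup>2) powr (- 1 / 4))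
          \<le> (ennreal c * ennreal (exp (- (l / 2) * (norm y)\<^sup>2))) * ennreal ((e + (v \<bullet> y)\<^sup>2) powr (- 1 / 4))"
        by (rule mult_right_mono) simp
      then show "ennreal (matrix_normal_density 0 \<Sigma> y) * ennreal ((e + (v \<bullet> y)\<^sup>2) powr (- 1 / 4))
          \<le> ennreal c * (ennreal ((e + (v \<bullet> y)\<^sup>2) powr (- 1 / 4)) * ennreal (exp (- (l / 2) * (norm y)\<^sup>2)))"
        by (simp only: mult_ac)
    qed
    also have "\<dots> = ennreal c * (\<integral>\<^sup>+y. ennreal ((e + (v \<bullet> y)\<^sup>2) powr (- 1 / 4))
        * ennreal (exp (- (l / 2) * (norm y)\<^sup>2)) \<partial>lborel)"
      by (rule nn_integral_cmult) measurable
    also have "\<dots> \<le> ennreal c * ennreal (5 * exp (l / 2) * sqrt (pi / (l / 2 / 2)) ^ DIM(real^'p^'k))"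
      by (intro mult_left_mono nn_integral_inv_sqrt_gauss v e) (use l in auto)
    also have "\<dots> = ennreal C" unfolding C_def using c l by (simp add: ennreal_mult)
    finally show ?thesis .
  qed
  moreover have "0 \<le> C" using c l by (simp add: C_def)
  ultimately show ?thesis using that by blast
qed

lemma unit_vector_orthogonal_to_rows:
  fixes z :: "nat \<Rightarrow> real^'p^1"
  assumes "k < CARD('p)"
  obtains v :: "real^'p^1" where "norm v = 1" "v ** gram k z = 0"
proof -
  have "card (z ` {..<k}) \<le> k" using card_image_le[of "{..<k}" z] by simp
  then have "dim (z ` {..<k}) < DIM(real^'p^1)"
    using dim_le_card'[of "z ` {..<k}"] assms by simp
  then obtain w where w: "w \<noteq> 0" "\<And>y. y \<in> span (z ` {..<k}) \<Longrightarrow> orthogonal w y"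
    using orthogonal_to_subspace_exists by blast
  define v where "v = (1 / norm w) *\<^sub>R w"
  have "v ** (transpose (z j) ** z j) = 0" if "j < k" for j
  proof -
    have "z j \<in> span (z ` {..<k})" using that by (intro span_base) auto
    then have "v \<bullet> z j = 0" using w(2) by (simp add: v_def orthogonal_def)
    then have "v ** transpose (z j) = 0"
      by (simp add: vec_eq_iff matrix_matrix_mult_def transpose_def inner_vec_def forall_1)
    then show ?thesis by (simp add: matrix_mul_assoc)
  qed
  then have "v ** gram k z = 0" unfolding gram_def mm.sum_right by (intro sum.neutral) auto
  moreover have "norm v = 1" using w(1) by (simp add: v_def)
  ultimately show ?thesis using that by blast
qed

lemma det_add_psd_ge:
  fixes A W :: "real^'p^'p"
  assumes A: "pos_def A" and W: "psd W"
  shows "det A * (1 + trace (matrix_inv A ** W)) \<le> det (A + W)" "det A \<le> det (A + W)"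
proof -
  obtain N :: "real^'p^'p" where N: "psd N" "det (A + W) = det A * det (mat 1 + N)"
    "trace N = trace (matrix_inv A ** W)" by (rule whitening[OF A W]) (rule that)
  have d: "0 < det A" by (rule det_pos_def[OF A])
  show "det A * (1 + trace (matrix_inv A ** W)) \<le> det (A + W)"
    using det_1_plus_ge_trace[OF N(1)] d by (simp add: N(2) N(3)[symmetric])
  moreover have "det A * 1 \<le> det A * (1 + trace N)"
    using trace_psd_nonneg[OF N(1)] d by (intro mult_left_mono) auto
  ultimately show "det A \<le> det (A + W)" by (simp add: N(3))
qed

text \<open>
  By \<open>det_add_psd_ge\<close> the determinant of \<open>A = e I + S\<close> grows at least by the factor \<open>1 + y A\<^sup>-\<^sup>1 y\<^sup>T\<close>.
  As \<open>v\<close> is a unit eigenvector of \<open>A\<close> for the eigenvalue \<open>e\<close>, the quadratic form is at least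
  \<open>(v \<bullet> y)\<^sup>2 / e\<close>.
\<close>
lemma det_add_row_ge:
  fixes S :: "real^'p^'p" and v y :: "real^'p^1"
  assumes S: "psd S" and e: "0 < e" and v: "norm v = 1" "v ** S = 0"
  shows "det (mat e + S) * ((e + (v \<bullet> y)\<^sup>2) / e) \<le> det (mat e + S + transpose y ** y)"
proof -
  define A where "A = mat e + S"
  have A: "pos_def A" unfolding A_def by (intro pos_def_add pos_def_mat S e)
  define J where "J = matrix_inv A"
  have AJ: "A ** J = mat 1" "J ** A = mat 1"
    unfolding J_def using matrix_inv_right matrix_inv_left invertible_pos_def[OF A] by auto
  have sA: "transpose A = A" using A by (simp add: pos_def_def)
  have vA: "v ** A = e *\<^sub>R v"
    by (simp add: A_def mm.add_right v(2) mat_eq_scaleR[of e] mm.scaleR_right)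
  define c where "c = (v \<bullet> y) / e"
  \<comment> \<open>Completing the square: \<open>c v\<close> is the \<open>A\<close>-orthogonal projection of \<open>y A\<^sup>-\<^sup>1\<close> to the line of \<open>v\<close>.\<close>
  define w where "w = y ** J - c *\<^sub>R v"
  have vJ: "v \<bullet> (y ** J) = c"
  proof -
    have "e * (v \<bullet> (y ** J)) = (v ** A) \<bullet> (y ** J)" by (simp add: vA)
    also have "\<dots> = v \<bullet> (y ** J ** A)" by (subst inner_matrix_mult_right) (simp only: sA)
    also have "y ** J ** A = y" by (simp add: matrix_mul_assoc[symmetric] AJ)
    finally show ?thesis using e by (simp add: c_def field_simps)
  qed
  have "(w ** A) \<bullet> w = trace (transpose (transpose w) ** A ** transpose w)"
    by (simp add: inner_matrix_trace)
  also have "\<dots> \<ge> 0" by (intro trace_psd_nonneg psd_congruence pos_def_imp_psd A)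
  finally have "0 \<le> (w ** A) \<bullet> w" .
  also have "w ** A = y - (c * e) *\<^sub>R v"
    by (simp add: w_def mm.diff_left mm.scaleR_left vA matrix_mul_assoc[symmetric] AJ)
  also have "(y - (c * e) *\<^sub>R v) \<bullet> w = y \<bullet> (y ** J) - c * (v \<bullet> y) - c * e * c + c * e * c * (v \<bullet> v)"
    by (simp add: w_def inner_diff_left inner_diff_right vJ inner_commute[of y v] algebra_simps)
  also have "\<dots> = y \<bullet> (y ** J) - (v \<bullet> y)\<^sup>2 / e"
    using e v(1) by (simp add: c_def dot_square_norm power2_eq_square)
  finally have "(v \<bullet> y)\<^sup>2 / e \<le> y \<bullet> (y ** J)" by simp
  moreover have "y \<bullet> (y ** J) = trace (J ** (transpose y ** y))"
  proof -
    have "y \<bullet> (y ** J) = (y ** J) \<bullet> y" by (rule inner_commute)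
    also have "\<dots> = trace ((y ** J) ** transpose y)" by (rule inner_matrix_trace)
    also have "\<dots> = trace (y ** (J ** transpose y))" by (simp only: matrix_mul_assoc)
    also have "\<dots> = trace ((J ** transpose y) ** y)" by (rule trace_mul_sym)
    finally show ?thesis by (simp only: matrix_mul_assoc)
  qed
  moreover have "(e + (v \<bullet> y)\<^sup>2) / e = 1 + (v \<bullet> y)\<^sup>2 / e" using e by (simp add: add_divide_distrib)
  ultimately have "det A * ((e + (v \<bullet> y)\<^sup>2) / e) \<le> det A * (1 + trace (J ** (transpose y ** y)))"
    using det_pos_def[OF A] by (intro mult_left_mono) auto
  also have "\<dots> \<le> det (A + transpose y ** y)"
    unfolding J_def by (rule det_add_psd_ge(1)[OF A psd_gram])
  finally show ?thesis by (simp only: A_def)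
qed

lemma gram_Suc_update: "gram (Suc k) (z(k := y)) = gram k z + transpose y ** y"
  by (simp add: gram_def)

text \<open>
  The sample is revealed row by row. Before row \<open>k < p\<close> there is a unit vector orthogonal to the
  previous rows, so by \<open>det_add_row_ge\<close> each of the first \<open>p\<close> rows costs a factor
  \<open>C e\<^bsup>1/4\<^esup>\<close>. These factors cancel the initial value \<open>e\<^bsup>-p/4\<^esup>\<close> exactly, and
  further rows can only increase the determinant. The bound is therefore uniform in \<open>e\<close>.
\<close>
lemma nn_integral_det_gram_bound:
  fixes \<Sigma> :: "real^'p^'p"
  assumes \<Sigma>: "pos_def \<Sigma>"
  obtains C where "0 \<le> C" "\<forall>n e. CARD('p) \<le> n \<longrightarrow> 0 < e \<longrightarrow>
    (\<integral>\<^sup>+z. ennreal (det (mat e + gram n z) powr (- 1 / 4)) \<partial>rows_law n \<Sigma>) \<le> ennreal C"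
proof -
  let ?N = "matrix_normal (0 :: real^'p^1) \<Sigma>"
  interpret N: prob_space ?N by (rule prob_space_matrix_normal[OF \<Sigma>])
  interpret product_sigma_finite "\<lambda>_::nat. ?N"
    by (intro product_sigma_finite.intro N.sigma_finite_measure_axioms)
  obtain C where C: "0 \<le> C" "\<forall>v e. norm v = 1 \<longrightarrow> 0 < e \<longrightarrow>
    (\<integral>\<^sup>+y. ennreal ((e + (v \<bullet> y)\<^sup>2) powr (- 1 / 4)) \<partial>?N) \<le> ennreal C"
    by (rule nn_integral_inv_sqrt_matrix_normal[OF \<Sigma>, where 'k = 1]) (rule that)
  define \<phi> where "\<phi> e k z = ennreal (det (mat e + gram k z) powr (- 1 / 4))"
    for e k and z :: "nat \<Rightarrow> real^'p^1"
  have meas: "\<phi> e k \<in> borel_measurable (rows_law k \<Sigma>)" for e k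
    using measurable_gram[measurable] unfolding \<phi>_def by measurable
  have step: "(\<integral>\<^sup>+z. \<phi> e (Suc k) z \<partial>rows_law (Suc k) \<Sigma>)
      = (\<integral>\<^sup>+z. (\<integral>\<^sup>+y. \<phi> e (Suc k) (z(k := y)) \<partial>?N) \<partial>rows_law k \<Sigma>)" for e k
    using product_nn_integral_insert[of "{..<k}" k "\<phi> e (Suc k)"] meas[of e "Suc k"]
    by (simp add: lessThan_Suc)
  have pd: "pos_def (mat e + gram k z)" if "0 < e" for e k and z :: "nat \<Rightarrow> real^'p^1"
    by (intro pos_def_add pos_def_mat psd_gram_rows that)
  have small: "(\<integral>\<^sup>+z. \<phi> e k z \<partial>rows_law k \<Sigma>) \<le> ennreal (e powr (- (real CARD('p) - real k) / 4) * C ^ k)"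
    if e: "0 < e" and "k \<le> CARD('p)" for e k
    using that(2)
  proof (induction k)
    case 0
    have "det (mat e :: real^'p^'p) = e ^ CARD('p)"
      by (subst det_diagonal) (auto simp: mat_def)
    then have "\<phi> e 0 z = ennreal (e powr (- real CARD('p) / 4))" for z
      using e by (simp add: \<phi>_def gram_def powr_powr flip: powr_realpow)
    then show ?case
      using prob_space.emeasure_space_1[OF prob_space_rows_law[OF \<Sigma>, of 0]] by simp
  next
    case (Suc k)
    then have k: "k < CARD('p)" by simp
    have inner: "(\<integral>\<^sup>+y. \<phi> e (Suc k) (z(k := y)) \<partial>?N) \<le> \<phi> e k z * ennreal (e powr (1 / 4) * C)" for z
    proof -
      obtain v :: "real^'p^1" where v: "norm v = 1" "v ** gram k z = 0"
        by (rule unit_vector_orthogonal_to_rows[OF k]) (rule that)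
      have d: "0 < det (mat e + gram k z)" by (rule det_pos_def[OF pd[OF e]])
      have "\<phi> e (Suc k) (z(k := y)) \<le> (\<phi> e k z * ennreal (e powr (1 / 4))) * ennreal ((e + (v \<bullet> y)\<^sup>2) powr (- 1 / 4))"
        for y
      proof -
        have p: "0 < e + (v \<bullet> y)\<^sup>2" using e by (simp add: add_pos_nonneg)
        have "det (mat e + gram k z + transpose y ** y) powr (- 1 / 4)
            \<le> (det (mat e + gram k z) * ((e + (v \<bullet> y)\<^sup>2) / e)) powr (- 1 / 4)"
          using d p e by (intro powr_mono2' det_add_row_ge psd_gram_rows v) auto
        also have "\<dots> = det (mat e + gram k z) powr (- 1 / 4) * (e powr (1 / 4) * (e + (v \<bullet> y)\<^sup>2) powr (- 1 / 4))"
          using d p e by (simp add: powr_mult powr_divide powr_minus_divide)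
        finally have "det (mat e + gram k z + transpose y ** y) powr (- 1 / 4)
            \<le> det (mat e + gram k z) powr (- 1 / 4) * (e powr (1 / 4) * (e + (v \<bullet> y)\<^sup>2) powr (- 1 / 4))" .
        from ennreal_leI[OF this] show ?thesis
          by (simp add: \<phi>_def gram_Suc_update add.assoc ennreal_mult mult.assoc)
      qed
      then have "(\<integral>\<^sup>+y. \<phi> e (Suc k) (z(k := y)) \<partial>?N)
          \<le> (\<integral>\<^sup>+y. (\<phi> e k z * ennreal (e powr (1 / 4))) * ennreal ((e + (v \<bullet> y)\<^sup>2) powr (- 1 / 4)) \<partial>?N)"
        by (rule nn_integral_mono)
      also have "\<dots> = (\<phi> e k z * ennreal (e powr (1 / 4))) * (\<integral>\<^sup>+y. ennreal ((e + (v \<bullet> y)\<^sup>2) powr (- 1 / 4)) \<partial>?N)"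
        by (rule nn_integral_cmult) measurable
      also have "\<dots> \<le> (\<phi> e k z * ennreal (e powr (1 / 4))) * ennreal C"
        using C(2) v(1) e by (intro mult_left_mono) auto
      finally show ?thesis using C(1) by (simp add: ennreal_mult mult.assoc)
    qed
    have "(\<integral>\<^sup>+z. \<phi> e (Suc k) z \<partial>rows_law (Suc k) \<Sigma>)
        \<le> (\<integral>\<^sup>+z. \<phi> e k z * ennreal (e powr (1 / 4) * C) \<partial>rows_law k \<Sigma>)"
      unfolding step by (intro nn_integral_mono inner)
    also have "\<dots> = (\<integral>\<^sup>+z. \<phi> e k z \<partial>rows_law k \<Sigma>) * ennreal (e powr (1 / 4) * C)"
      by (rule nn_integral_multc[OF meas])
    also have "\<dots> \<le> ennreal (e powr (- (real CARD('p) - real k) / 4) * C ^ k) * ennreal (e powr (1 / 4) * C)"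
      using Suc by (intro mult_right_mono) auto
    also have "\<dots> = ennreal (e powr (- (real CARD('p) - real k) / 4) * C ^ k * (e powr (1 / 4) * C))"
      using C(1) by (intro ennreal_mult[symmetric]) auto
    also have "e powr (- (real CARD('p) - real k) / 4) * C ^ k * (e powr (1 / 4) * C)
        = (e powr (- (real CARD('p) - real k) / 4) * e powr (1 / 4)) * C ^ Suc k"
      by simp
    also have "e powr (- (real CARD('p) - real k) / 4) * e powr (1 / 4) = e powr (- (real CARD('p) - real (Suc k)) / 4)"
      by (simp add: powr_add[symmetric] field_simps)
    finally show ?case .
  qed
  have "(\<integral>\<^sup>+z. \<phi> e n z \<partial>rows_law n \<Sigma>) \<le> ennreal (C ^ CARD('p))"
    if e: "0 < e" and "CARD('p) \<le> n" for e n
    using that(2)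
  proof (induction n rule: dec_induct)
    case base
    then show ?case using small[OF e, of "CARD('p)"] e by simp
  next
    case (step k)
    have inner: "\<phi> e (Suc k) (z(k := y)) \<le> \<phi> e k z" for z y
    proof -
      have "det (mat e + gram k z + transpose y ** y) powr (- 1 / 4) \<le> det (mat e + gram k z) powr (- 1 / 4)"
        using det_pos_def[OF pd[OF e]] by (intro powr_mono2' det_add_psd_ge(2) pd e psd_gram) auto
      then show ?thesis by (simp add: \<phi>_def gram_Suc_update add.assoc ennreal_leI)
    qed
    have "(\<integral>\<^sup>+z. \<phi> e (Suc k) z \<partial>rows_law (Suc k) \<Sigma>) \<le> (\<integral>\<^sup>+z. (\<integral>\<^sup>+y. \<phi> e k z \<partial>?N) \<partial>rows_law k \<Sigma>)"
      unfolding \<open>\<And>k e. (\<integral>\<^sup>+z. \<phi> e (Suc k) z \<partial>rows_law (Suc k) \<Sigma>)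
      = (\<integral>\<^sup>+z. (\<integral>\<^sup>+y. \<phi> e (Suc k) (z(k := y)) \<partial>?N) \<partial>rows_law k \<Sigma>)\<close>
      by (intro nn_integral_mono inner)
    also have "\<dots> = (\<integral>\<^sup>+z. \<phi> e k z \<partial>rows_law k \<Sigma>)"
      using N.emeasure_space_1 by simp
    finally show ?case using step.IH by (rule order_trans)
  qed
  then show ?thesis using C(1) that[of "C ^ CARD('p)"] by (simp add: \<phi>_def)
qed

lemma pos_def_if_psd_det:
  assumes "psd (S :: real^'p^'p)" "det S \<noteq> 0" shows "pos_def S"
proof -
  obtain C :: "real^'p^'p" where C: "S = transpose C ** C" by (rule psd_root[OF assms(1)]) (rule that)
  then have "invertible C" using assms(2) by (auto simp: invertible_det_nz det_mul)
  then show ?thesis unfolding C by (rule pos_def_gram)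
qed

text \<open>
  Fatou's lemma as the regularisation \<open>e\<close> tends to \<open>0\<close> gives a finite mean of
  \<open>(det S)\<^bsup>-1/4\<^esup>\<close>. Hence \<open>det S \<noteq> 0\<close> almost surely, and \<open>- log det S \<le> 4 (det S)\<^bsup>-1/4\<^esup>\<close>. In the other
  direction \<open>log det S \<le> tr S\<close>.
\<close>
theorem gram_pos_def_and_ln_det_integrable:
  fixes \<Sigma> :: "real^'p^'p"
  assumes \<Sigma>: "pos_def \<Sigma>" and n: "CARD('p) \<le> n"
  shows "AE z in rows_law n \<Sigma>. pos_def (gram n z)"
    and "integrable (rows_law n \<Sigma>) (\<lambda>z. ln (det (gram n z)))"
    and "integrable (rows_law n \<Sigma>) (\<lambda>z. trace (B ** gram n z))"
proof -
  obtain C where C: "0 \<le> C" "\<forall>n e. CARD('p) \<le> n \<longrightarrow> 0 < e \<longrightarrow>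
    (\<integral>\<^sup>+z. ennreal (det (mat e + gram n z) powr (- 1 / 4)) \<partial>rows_law n \<Sigma>) \<le> ennreal C"
    by (rule nn_integral_det_gram_bound[OF \<Sigma>]) (rule that)
  define e where "e j = 1 / real (Suc j)" for j
  have e: "0 < e j" for j by (simp add: e_def)
  have e0: "e \<longlonglongrightarrow> 0" unfolding e_def by (rule LIMSEQ_Suc[OF lim_1_over_n])
  define \<phi> where "\<phi> j z = ennreal (det (mat (e j) + gram n z) powr (- 1 / 4))"
    for j and z :: "nat \<Rightarrow> real^'p^1"
  have [measurable]: "\<phi> j \<in> borel_measurable (rows_law n \<Sigma>)" for j
    using measurable_gram[measurable] unfolding \<phi>_def by measurable
  have det_lim: "(\<lambda>j. det (mat (e j) + gram n z)) \<longlonglongrightarrow> det (gram n z)" for z :: "nat \<Rightarrow> real^'p^1"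
  proof -
    have "(\<lambda>j. e j *\<^sub>R mat 1 + gram n z) \<longlonglongrightarrow> 0 *\<^sub>R mat 1 + gram n z"
      by (intro tendsto_intros e0)
    then have "(\<lambda>j. mat (e j) + gram n z) \<longlonglongrightarrow> gram n z"
      unfolding mat_eq_scaleR[symmetric] by simp
    then show ?thesis by (rule isCont_tendsto_compose[OF isCont_det])
  qed
  have "(\<integral>\<^sup>+z. liminf (\<lambda>j. \<phi> j z) \<partial>rows_law n \<Sigma>) \<le> liminf (\<lambda>j. \<integral>\<^sup>+z. \<phi> j z \<partial>rows_law n \<Sigma>)"
    by (rule nn_integral_liminf) measurable
  also have "\<dots> \<le> limsup (\<lambda>j. \<integral>\<^sup>+z. \<phi> j z \<partial>rows_law n \<Sigma>)"
    by (rule Liminf_le_Limsup) simp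
  also have "\<dots> \<le> ennreal C"
    by (rule Limsup_bounded) (use C(2) n e in \<open>auto simp: \<phi>_def\<close>)
  finally have fin: "(\<integral>\<^sup>+z. liminf (\<lambda>j. \<phi> j z) \<partial>rows_law n \<Sigma>) \<le> ennreal C" .
  have ae: "AE z in rows_law n \<Sigma>. liminf (\<lambda>j. \<phi> j z) \<noteq> \<infinity>"
    by (rule nn_integral_PInf_AE, measurable) (use fin in \<open>auto simp: top_unique\<close>)
  have nz: "det (gram n z) \<noteq> 0" if "liminf (\<lambda>j. \<phi> j z) \<noteq> \<infinity>" for z
  proof
    assume z: "det (gram n z) = 0"
    have "ennreal (real K) \<le> liminf (\<lambda>j. \<phi> j z)" for K :: nat
    proof (rule Liminf_bounded)
      \<comment> \<open>The threshold below which the \<open>-1/4\<close> power exceeds \<open>K\<close>.\<close>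
      define x where "x = (real (Suc K)) powr (-4)"
      have "0 < x" by (simp add: x_def)
      then have "\<forall>\<^sub>F j in sequentially. det (mat (e j) + gram n z) < x"
        using order_tendstoD(2)[OF det_lim[of z], of x] z by simp
      then show "\<forall>\<^sub>F j in sequentially. ennreal (real K) \<le> \<phi> j z"
      proof eventually_elim
        case (elim j)
        have "0 < det (mat (e j) + gram n z)"
          by (intro det_pos_def pos_def_add pos_def_mat psd_gram_rows e)
        then have "x powr (- 1 / 4) \<le> det (mat (e j) + gram n z) powr (- 1 / 4)"
          using elim by (intro powr_mono2') auto
        moreover have "x powr (- 1 / 4) = real (Suc K)" by (simp add: x_def powr_powr)
        ultimately show ?case unfolding \<phi>_def by (intro ennreal_leI) simp
      qed
    qed
    then have "liminf (\<lambda>j. \<phi> j z) = \<infinity>"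
      using ennreal_Ex_less_of_nat[of "liminf (\<lambda>j. \<phi> j z)"]
      by (metis ennreal_of_nat_eq_real_of_nat infinity_ennreal_def less_top linorder_not_le)
    with that show False by simp
  qed
  show pd: "AE z in rows_law n \<Sigma>. pos_def (gram n z)"
    using ae by eventually_elim (intro pos_def_if_psd_det psd_gram_rows nz)
  have mdet: "(\<lambda>z. det (gram n z)) \<in> borel_measurable (rows_law n \<Sigma>)"
    by (rule measurable_compose[OF measurable_gram measurable_det])
  have "(\<integral>\<^sup>+z. ennreal (det (gram n z) powr (- 1 / 4)) \<partial>rows_law n \<Sigma>) \<le> (\<integral>\<^sup>+z. liminf (\<lambda>j. \<phi> j z) \<partial>rows_law n \<Sigma>)"
  proof (rule nn_integral_mono_AE)
    show "AE z in rows_law n \<Sigma>. ennreal (det (gram n z) powr (- 1 / 4)) \<le> liminf (\<lambda>j. \<phi> j z)"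
      using pd
    proof eventually_elim
      case (elim z)
      then have "0 < det (gram n z)" by (rule det_pos_def)
      then have "(\<lambda>j. \<phi> j z) \<longlonglongrightarrow> ennreal (det (gram n z) powr (- 1 / 4))"
        unfolding \<phi>_def by (intro tendsto_ennrealI tendsto_powr det_lim tendsto_const) auto
      then show ?case by (simp add: lim_imp_Liminf)
    qed
  qed
  with fin have "(\<integral>\<^sup>+z. ennreal (det (gram n z) powr (- 1 / 4)) \<partial>rows_law n \<Sigma>) < \<infinity>"
    by (auto intro: le_less_trans order_trans)
  then have int_det: "integrable (rows_law n \<Sigma>) (\<lambda>z. det (gram n z) powr (- 1 / 4))"
    using measurable_gram[measurable] by (intro integrableI_nonneg) auto
  show int_tr: "integrable (rows_law n \<Sigma>) (\<lambda>z. trace (B ** gram n z))" for B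
  proof (rule Bochner_Integration.integrable_bound)
    show "integrable (rows_law n \<Sigma>) (\<lambda>z. \<Sum>i<n. norm B * (1 + (norm (z i))\<^sup>2))"
      by (intro Bochner_Integration.integrable_sum integrable_mult_right integrable_row_norm \<Sigma>) auto
    show "(\<lambda>z. trace (B ** gram n z)) \<in> borel_measurable (rows_law n \<Sigma>)"
      by (intro measurable_compose[OF measurable_gram] borel_measurable_continuous_onI
          bounded_linear.continuous_on[OF bounded_linear_trace] mm.continuous_on continuous_intros)
    show "AE z in rows_law n \<Sigma>. norm (trace (B ** gram n z)) \<le> norm (\<Sum>i<n. norm B * (1 + (norm (z i))\<^sup>2))"
    proof (intro always_eventually allI)
      fix z :: "nat \<Rightarrow> real^'p^1"
      have "\<bar>(z i ** B) \<bullet> z i\<bar> \<le> norm B * (1 + (norm (z i))\<^sup>2)" for i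
      proof -
        have "\<bar>(z i ** B) \<bullet> z i\<bar> \<le> norm (z i ** B) * norm (z i)" by (rule Cauchy_Schwarz_ineq2)
        also have "\<dots> \<le> (norm (z i) * norm B) * norm (z i)" by (intro mult_right_mono norm_matrix_mult_le) auto
        also have "\<dots> \<le> norm B * (1 + (norm (z i))\<^sup>2)" by (simp add: power2_eq_square algebra_simps)
        finally show ?thesis .
      qed
      then have "\<bar>\<Sum>i<n. (z i ** B) \<bullet> z i\<bar> \<le> (\<Sum>i<n. norm B * (1 + (norm (z i))\<^sup>2))"
        by (intro order_trans[OF sum_abs] sum_mono)
      moreover have "(\<Sum>i<n. (z i ** B) \<bullet> z i) = trace (B ** gram n z)"
        using sum_rows_inner[of z B "mat 1" n] by simp
      ultimately show "norm (trace (B ** gram n z)) \<le> norm (\<Sum>i<n. norm B * (1 + (norm (z i))\<^sup>2))"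
        by simp
    qed
  qed
  show "integrable (rows_law n \<Sigma>) (\<lambda>z. ln (det (gram n z)))"
  proof (rule Bochner_Integration.integrable_bound)
    show "integrable (rows_law n \<Sigma>) (\<lambda>z. 4 * det (gram n z) powr (- 1 / 4) + trace (mat 1 ** gram n z))"
      by (intro Bochner_Integration.integrable_add integrable_mult_right int_det int_tr)
    show "(\<lambda>z. ln (det (gram n z))) \<in> borel_measurable (rows_law n \<Sigma>)"
      using mdet by (rule borel_measurable_ln)
    show "AE z in rows_law n \<Sigma>. norm (ln (det (gram n z)))
        \<le> norm (4 * det (gram n z) powr (- 1 / 4) + trace (mat 1 ** gram n z))"
      using pd
    proof eventually_elim
      case (elim z)
      define d where "d = det (gram n z)"
      have d: "0 < d" unfolding d_def by (rule det_pos_def[OF elim])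
      have "ln (d powr (- 1 / 4)) \<le> d powr (- 1 / 4) - 1" using d by (intro ln_le_minus_one) simp
      then have "- ln d \<le> 4 * d powr (- 1 / 4)" using d by (simp add: ln_powr)
      moreover have "ln d \<le> trace (gram n z)"
        unfolding d_def using ln_det_le_trace[OF elim] by simp
      moreover have "0 \<le> trace (gram n z)" by (intro trace_psd_nonneg psd_gram_rows)
      moreover have "0 \<le> d powr (- 1 / 4)" by simp
      ultimately have "\<bar>ln d\<bar> \<le> 4 * d powr (- 1 / 4) + trace (gram n z)" by linarith
      then show ?case by (simp add: d_def)
    qed
  qed
qed

section \<open>Stein-Haff identities for the Wishart distribution\<close>

lemma measurable_matrix_mult [measurable (raw)]:
  fixes f :: "'a \<Rightarrow> real^'n^'m" and g :: "'a \<Rightarrow> real^'p^'n"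
  assumes "f \<in> borel_measurable M" "g \<in> borel_measurable M"
  shows "(\<lambda>x. f x ** g x) \<in> borel_measurable M"
  using assms by (rule borel_measurable_continuous_Pair) (intro mm.continuous_on continuous_intros)

lemma measurable_transpose [measurable]:
  "(transpose :: real^'n^'m \<Rightarrow> real^'m^'n) \<in> borel_measurable borel"
  by (intro borel_measurable_continuous_onI bounded_linear.continuous_on[OF bounded_linear_transpose]
      continuous_intros)

lemma measurable_trace [measurable]: "(trace :: real^'n^'n \<Rightarrow> real) \<in> borel_measurable borel"
  by (intro borel_measurable_continuous_onI bounded_linear.continuous_on[OF bounded_linear_trace]
      continuous_intros)

lemma tendsto_trace: "(f \<longlongrightarrow> a) F \<Longrightarrow> ((\<lambda>x. trace (f x :: real^'n^'n)) \<longlongrightarrow> trace a) F"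
  by (rule bounded_linear.tendsto[OF bounded_linear_trace])

lemma transpose_inverse_pos_def: "pos_def (A :: real^'n^'n) \<Longrightarrow> transpose (matrix_inv A) = matrix_inv A"
  using pos_def_matrix_inv[of A] by (simp add: pos_def_def)

text \<open>
  The defects of the Stein-Haff identities for \<open>tr(Q M P S)\<close> and \<open>tr(Q M P M P S)\<close>, where
  \<open>P\<close> stands for \<open>(R + S)\<^sup>-\<^sup>1\<close> with \<open>R\<close> constant. They are kept as functions of a free matrix \<open>P\<close>, so that
  the same expressions can be used for the regularised and for the limiting resolvent.
\<close>
definition haff1 :: "nat \<Rightarrow> real^'p^'p \<Rightarrow> real^'p^'p \<Rightarrow> real^'p^'p \<Rightarrow> real^'p^'p \<Rightarrow> real" where
  "haff1 n Q M P S = trace (Q ** M ** P ** S) - (real n * trace (P ** M)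
     - (trace (P ** M ** P ** S) + trace (P ** S) * trace (P ** M)))"

definition haff2 :: "nat \<Rightarrow> real^'p^'p \<Rightarrow> real^'p^'p \<Rightarrow> real^'p^'p \<Rightarrow> real^'p^'p \<Rightarrow> real" where
  "haff2 n Q M P S = trace (Q ** M ** P ** M ** P ** S) - (real n * trace (P ** M ** P ** M)
     - (trace (P ** M ** P ** M ** P ** S) + trace (P ** S) * trace (P ** M ** P ** M)
        + trace (P ** M ** P ** M ** P ** S) + trace (P ** M ** P ** S) * trace (P ** M)))"

text \<open>
  Stein's identity in each row \<open>y\<close> for the field \<open>y P M\<close>. Summing over the rows turns
  \<open>y\<^sup>T y\<close> into the Gram matrix.
\<close>
lemma haff1_regular:
  fixes \<Sigma> R0 M :: "real^'p^'p"
  assumes \<Sigma>: "pos_def \<Sigma>" and R0: "pos_def R0" and M: "transpose M = M"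
  shows "(\<integral>z. haff1 n (matrix_inv \<Sigma>) M (matrix_inv (R0 + gram n z)) (gram n z) \<partial>rows_law n \<Sigma>) = 0"
proof -
  define Q where "Q = matrix_inv \<Sigma>"
  define P where "P S = matrix_inv (R0 + S)" for S
  define F where "F S y = (y ** Q) \<bullet> (y ** (P S ** M))" for S and y :: "real^'p^1"
  define G where "G S y = trace (P S ** M) - ((y ** P S) \<bullet> (y ** (P S ** M))
      + trace (y ** P S ** transpose y) * trace (P S ** M))" for S and y :: "real^'p^1"
  obtain t where t: "0 \<le> t" "\<forall>W. psd W \<longrightarrow> norm (matrix_inv (R0 + W)) \<le> t"
    by (rule norm_matrix_inv_bounded[OF R0]) (rule that)
  define K where "K = t * norm M + 2 * 1 * (t * t) * norm M"
  have K: "0 \<le> K" using t by (simp add: K_def)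
  define C where "C = norm Q * K + real DIM(real^'p^1) * K"
  have loc: "ridge_field (R0 + S0) 1" if "psd S0" for S0
    by standard (auto intro: pos_def_add R0 that)
  have Ti: "ridge_field.Ti (R0 + S0) 1 y = P (S0 + transpose y ** y)" if "psd S0" for S0 and y :: "real^'p^1"
    by (simp add: ridge_field.Ti_def[OF loc[OF that]] ridge_field.Tm_def[OF loc[OF that]] P_def add.assoc)
  have Ff: "F (S0 + transpose y ** y) y = ((y - 0) ** Q) \<bullet> ridge_field.field1 (R0 + S0) 1 M y"
    if "psd S0" for S0 y
    by (simp add: F_def ridge_field.field1_def[OF loc[OF that]] Ti[OF that] matrix_mul_assoc)
  have Gf: "G (S0 + transpose y ** y) y = (\<Sum>E\<in>Basis. ridge_field.field1' (R0 + S0) 1 M y E \<bullet> E)"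
    if "psd S0" for S0 y
    unfolding ridge_field.field1_divergence[OF loc[OF that]] Ti[OF that]
    by (simp add: G_def matrix_mul_assoc)
  have tb: "norm (ridge_field.Ti (R0 + S0) 1 y) \<le> t" if "psd S0" for S0 and y :: "real^'p^1"
    unfolding Ti[OF that] P_def using t(2) psd_add[OF that psd_gram] by blast
  have "(\<integral>z. (\<Sum>i<n. F (gram n z) (z i)) - (\<Sum>i<n. G (gram n z) (z i)) \<partial>rows_law n \<Sigma>) = 0"
  proof (rule rows_law_stein[OF \<Sigma>])
    show "case_prod F \<in> borel_measurable borel" "case_prod G \<in> borel_measurable borel"
      unfolding F_def G_def P_def borel_prod[symmetric] by measurable
    fix S0 :: "real^'p^'p" assume S0: "psd S0"
    fix y :: "real^'p^1"
    have 1: "norm (ridge_field.field1 (R0 + S0) 1 M y) \<le> K * (1 + norm y)"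
      unfolding K_def by (rule ridge_field.field1_bounds(1)[OF loc[OF S0] tb[OF S0] t(1)])
    have 2: "\<bar>ridge_field.field1' (R0 + S0) 1 M y E \<bullet> E\<bar> \<le> K * (1 + (norm y)\<^sup>2)" if "E \<in> Basis" for E
      unfolding K_def by (rule ridge_field.field1_bounds(2)[OF loc[OF S0] tb[OF S0] t(1) that])
    have y2: "norm y * (1 + norm y) \<le> 2 * (1 + (norm y)\<^sup>2)"
    proof -
      have "0 \<le> (norm y - 1 / 2) * (norm y - 1 / 2)" by simp
      then show ?thesis by (simp add: power2_eq_square algebra_simps)
    qed
    have DIM1: "2 \<le> real DIM(real^'p^1) + 1" by (simp add: Suc_le_eq)
    show "\<bar>F (S0 + transpose y ** y) y\<bar> \<le> (2 * C) * (1 + (norm y)\<^sup>2)"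
    proof -
      have "\<bar>F (S0 + transpose y ** y) y\<bar> \<le> norm (y ** Q) * norm (ridge_field.field1 (R0 + S0) 1 M y)"
        unfolding Ff[OF S0] using Cauchy_Schwarz_ineq2 by simp
      also have "\<dots> \<le> (norm y * norm Q) * (K * (1 + norm y))"
        by (intro mult_mono norm_matrix_mult_le 1) auto
      also have "\<dots> = (norm Q * K) * (norm y * (1 + norm y))" by simp
      also have "\<dots> \<le> (norm Q * K) * (2 * (1 + (norm y)\<^sup>2))"
        using K by (intro mult_left_mono y2) auto
      also have "\<dots> = (2 * (norm Q * K)) * (1 + (norm y)\<^sup>2)" by simp
      also have "\<dots> \<le> (2 * C) * (1 + (norm y)\<^sup>2)"
        using K by (intro mult_right_mono) (auto simp: C_def)
      finally show ?thesis .
    qed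
    show "\<bar>G (S0 + transpose y ** y) y\<bar> \<le> (2 * C) * (1 + (norm y)\<^sup>2)"
    proof -
      have "\<bar>G (S0 + transpose y ** y) y\<bar> \<le> (\<Sum>E\<in>(Basis :: (real^'p^1) set). K * (1 + (norm y)\<^sup>2))"
        unfolding Gf[OF S0] by (intro order_trans[OF sum_abs] sum_mono 2)
      also have "\<dots> = (real DIM(real^'p^1) * K) * (1 + (norm y)\<^sup>2)" by simp
      also have "\<dots> \<le> (2 * C) * (1 + (norm y)\<^sup>2)"
        using K by (intro mult_right_mono) (auto simp: C_def)
      finally show ?thesis .
    qed
    show "(\<integral>y. F (S0 + transpose y ** y) y \<partial>matrix_normal 0 \<Sigma>) = (\<integral>y. G (S0 + transpose y ** y) y \<partial>matrix_normal 0 \<Sigma>)"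
      unfolding Ff[OF S0] Gf[OF S0] Q_def by (rule ridge_field.field1_stein(1)[OF loc[OF S0] \<Sigma>])
  qed
  moreover have "(\<Sum>i<n. F (gram n z) (z i)) - (\<Sum>i<n. G (gram n z) (z i))
      = haff1 n Q M (P (gram n z)) (gram n z)" for z
  proof -
    define S where "S = gram n z"
    have sP: "transpose (P S) = P S"
      unfolding P_def S_def by (intro transpose_inverse_pos_def pos_def_add R0 psd_gram_rows)
    have "(\<Sum>i<n. F S (z i)) = trace (Q ** (M ** P S) ** S)"
      unfolding F_def S_def sum_rows_inner by (simp add: matrix_transpose_mul M sP[unfolded S_def])
    moreover have "(\<Sum>i<n. G S (z i)) = real n * trace (P S ** M)
        - (trace (P S ** (M ** P S) ** S) + trace (P S ** S) * trace (P S ** M))"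
      unfolding G_def sum_subtractf sum.distrib sum_distrib_right[symmetric]
      unfolding S_def sum_rows_inner sum_rows_trace
      by (simp add: matrix_transpose_mul M sP[unfolded S_def])
    ultimately show ?thesis by (simp add: haff1_def S_def matrix_mul_assoc)
  qed
  ultimately show ?thesis by (simp add: Q_def P_def)
qed

text \<open>
  The same argument for the field \<open>y P M P M\<close>.
\<close>
lemma haff2_regular:
  fixes \<Sigma> R0 M :: "real^'p^'p"
  assumes \<Sigma>: "pos_def \<Sigma>" and R0: "pos_def R0" and M: "transpose M = M"
  shows "(\<integral>z. haff2 n (matrix_inv \<Sigma>) M (matrix_inv (R0 + gram n z)) (gram n z) \<partial>rows_law n \<Sigma>) = 0"
proof -
  define Q where "Q = matrix_inv \<Sigma>"
  define P where "P S = matrix_inv (R0 + S)" for S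
  define F where "F S y = (y ** Q) \<bullet> (y ** (P S ** M ** P S ** M))" for S and y :: "real^'p^1"
  define G where "G S y = trace (P S ** M ** P S ** M) - ((y ** P S) \<bullet> (y ** (P S ** M ** P S ** M))
      + trace (y ** P S ** transpose y) * trace (P S ** M ** P S ** M)
      + (y ** (P S ** M ** P S)) \<bullet> (y ** (P S ** M))
      + trace (y ** (P S ** M ** P S) ** transpose y) * trace (P S ** M))" for S and y :: "real^'p^1"
  obtain t where t: "0 \<le> t" "\<forall>W. psd W \<longrightarrow> norm (matrix_inv (R0 + W)) \<le> t"
    by (rule norm_matrix_inv_bounded[OF R0]) (rule that)
  define K where "K = t * t * norm M * norm M + 4 * 1 * (t * t * t) * norm M * norm M"
  have K: "0 \<le> K" using t by (simp add: K_def)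
  define C where "C = norm Q * K + real DIM(real^'p^1) * K"
  have loc: "ridge_field (R0 + S0) 1" if "psd S0" for S0
    by standard (auto intro: pos_def_add R0 that)
  have Ti: "ridge_field.Ti (R0 + S0) 1 y = P (S0 + transpose y ** y)" if "psd S0" for S0 and y :: "real^'p^1"
    by (simp add: ridge_field.Ti_def[OF loc[OF that]] ridge_field.Tm_def[OF loc[OF that]] P_def add.assoc)
  have Ff: "F (S0 + transpose y ** y) y = ((y - 0) ** Q) \<bullet> ridge_field.field2 (R0 + S0) 1 M M y"
    if "psd S0" for S0 y
    by (simp add: F_def ridge_field.field2_def[OF loc[OF that]] Ti[OF that] matrix_mul_assoc)
  have Gf: "G (S0 + transpose y ** y) y = (\<Sum>E\<in>Basis. ridge_field.field2' (R0 + S0) 1 M M y E \<bullet> E)"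
    if "psd S0" for S0 y
    unfolding ridge_field.field2_divergence[OF loc[OF that]] Ti[OF that]
    by (simp add: G_def matrix_mul_assoc)
  have tb: "norm (ridge_field.Ti (R0 + S0) 1 y) \<le> t" if "psd S0" for S0 and y :: "real^'p^1"
    unfolding Ti[OF that] P_def using t(2) psd_add[OF that psd_gram] by blast
  have "(\<integral>z. (\<Sum>i<n. F (gram n z) (z i)) - (\<Sum>i<n. G (gram n z) (z i)) \<partial>rows_law n \<Sigma>) = 0"
  proof (rule rows_law_stein[OF \<Sigma>])
    show "case_prod F \<in> borel_measurable borel" "case_prod G \<in> borel_measurable borel"
      unfolding F_def G_def P_def borel_prod[symmetric] by measurable
    fix S0 :: "real^'p^'p" assume S0: "psd S0"
    fix y :: "real^'p^1"
    have 1: "norm (ridge_field.field2 (R0 + S0) 1 M M y) \<le> K * (1 + norm y)"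
      unfolding K_def by (rule ridge_field.field2_bounds(1)[OF loc[OF S0] tb[OF S0] t(1)])
    have 2: "\<bar>ridge_field.field2' (R0 + S0) 1 M M y E \<bullet> E\<bar> \<le> K * (1 + (norm y)\<^sup>2)" if "E \<in> Basis" for E
      unfolding K_def by (rule ridge_field.field2_bounds(2)[OF loc[OF S0] tb[OF S0] t(1) that])
    have y2: "norm y * (1 + norm y) \<le> 2 * (1 + (norm y)\<^sup>2)"
    proof -
      have "0 \<le> (norm y - 1 / 2) * (norm y - 1 / 2)" by simp
      then show ?thesis by (simp add: power2_eq_square algebra_simps)
    qed
    show "\<bar>F (S0 + transpose y ** y) y\<bar> \<le> (2 * C) * (1 + (norm y)\<^sup>2)"
    proof -
      have "\<bar>F (S0 + transpose y ** y) y\<bar> \<le> norm (y ** Q) * norm (ridge_field.field2 (R0 + S0) 1 M M y)"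
        unfolding Ff[OF S0] using Cauchy_Schwarz_ineq2 by simp
      also have "\<dots> \<le> (norm y * norm Q) * (K * (1 + norm y))"
        by (intro mult_mono norm_matrix_mult_le 1) auto
      also have "\<dots> = (norm Q * K) * (norm y * (1 + norm y))" by simp
      also have "\<dots> \<le> (norm Q * K) * (2 * (1 + (norm y)\<^sup>2))"
        using K by (intro mult_left_mono y2) auto
      also have "\<dots> = (2 * (norm Q * K)) * (1 + (norm y)\<^sup>2)" by simp
      also have "\<dots> \<le> (2 * C) * (1 + (norm y)\<^sup>2)"
        using K by (intro mult_right_mono) (auto simp: C_def)
      finally show ?thesis .
    qed
    show "\<bar>G (S0 + transpose y ** y) y\<bar> \<le> (2 * C) * (1 + (norm y)\<^sup>2)"
    proof -
      have "\<bar>G (S0 + transpose y ** y) y\<bar> \<le> (\<Sum>E\<in>(Basis :: (real^'p^1) set). K * (1 + (norm y)\<^sup>2))"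
        unfolding Gf[OF S0] by (intro order_trans[OF sum_abs] sum_mono 2)
      also have "\<dots> = (real DIM(real^'p^1) * K) * (1 + (norm y)\<^sup>2)" by simp
      also have "\<dots> \<le> (2 * C) * (1 + (norm y)\<^sup>2)"
        using K by (intro mult_right_mono) (auto simp: C_def)
      finally show ?thesis .
    qed
    show "(\<integral>y. F (S0 + transpose y ** y) y \<partial>matrix_normal 0 \<Sigma>) = (\<integral>y. G (S0 + transpose y ** y) y \<partial>matrix_normal 0 \<Sigma>)"
      unfolding Ff[OF S0] Gf[OF S0] Q_def by (rule ridge_field.field2_stein[OF loc[OF S0] \<Sigma>])
  qed
  moreover have "(\<Sum>i<n. F (gram n z) (z i)) - (\<Sum>i<n. G (gram n z) (z i))
      = haff2 n Q M (P (gram n z)) (gram n z)" for z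
  proof -
    define S where "S = gram n z"
    have sP: "transpose (P S) = P S"
      unfolding P_def S_def by (intro transpose_inverse_pos_def pos_def_add R0 psd_gram_rows)
    have "(\<Sum>i<n. F S (z i)) = trace (Q ** (M ** (P S ** (M ** P S))) ** S)"
      unfolding F_def S_def sum_rows_inner by (simp add: matrix_transpose_mul M sP[unfolded S_def])
    moreover have "(\<Sum>i<n. G S (z i)) = real n * trace (P S ** M ** P S ** M)
        - (trace (P S ** (M ** (P S ** (M ** P S))) ** S) + trace (P S ** S) * trace (P S ** M ** P S ** M)
          + trace (P S ** M ** P S ** (M ** P S) ** S) + trace (P S ** M ** P S ** S) * trace (P S ** M))"
      unfolding G_def sum_subtractf sum.distrib sum_distrib_right[symmetric]
      unfolding S_def sum_rows_inner sum_rows_trace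
      by (simp add: matrix_transpose_mul M sP[unfolded S_def])
    ultimately show ?thesis by (simp add: haff2_def S_def matrix_mul_assoc)
  qed
  ultimately show ?thesis by (simp add: Q_def P_def)
qed

text \<open>
  Replacing \<open>A\<close> by the larger matrix \<open>T\<close> cancels one factor \<open>P\<close>. Taking for \<open>A\<close> a summand of \<open>T\<close>
  bounds traces of resolvent products by constants.
\<close>
lemma trace_inverse_dominated:
  fixes T A V :: "real^'p^'p"
  assumes T: "pos_def T" and A: "psd A" "psd (T - A)" and V: "psd V"
  defines "P \<equiv> matrix_inv T"
  shows "0 \<le> trace (P ** V ** P ** A)" "trace (P ** V ** P ** A) \<le> trace (P ** V)"
    "0 \<le> trace (P ** A)" "trace (P ** A) \<le> real CARD('p)"
proof -
  have P: "psd P" unfolding P_def by (intro pos_def_imp_psd pos_def_matrix_inv T)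
  have sP: "transpose P = P" unfolding P_def by (rule transpose_inverse_pos_def[OF T])
  have PT: "P ** T = mat 1" unfolding P_def by (rule matrix_inv_left[OF invertible_pos_def[OF T]])
  have PVP: "psd (P ** V ** P)" using psd_congruence[OF V, of P] by (simp add: sP)
  show "0 \<le> trace (P ** V ** P ** A)" by (rule trace_psd_mult_nonneg[OF PVP A(1)])
  show "0 \<le> trace (P ** A)" by (rule trace_psd_mult_nonneg[OF P A(1)])
  have "0 \<le> trace (P ** V ** P ** (T - A))" by (rule trace_psd_mult_nonneg[OF PVP A(2)])
  moreover have "P ** V ** P ** T = P ** V" by (simp add: matrix_mul_assoc[symmetric] PT)
  ultimately show "trace (P ** V ** P ** A) \<le> trace (P ** V)"
    by (simp add: mm.diff_right trace_sub)
  have "0 \<le> trace (P ** (T - A))" by (rule trace_psd_mult_nonneg[OF P A(2)])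
  then show "trace (P ** A) \<le> real CARD('p)" by (simp add: mm.diff_right trace_sub PT trace_I)
qed

text \<open>
  The domination for the limit \<open>e \<rightarrow> 0\<close>. The norm of \<open>P\<close> alone is not bounded uniformly in \<open>e\<close>, but
  \<open>P\<close> occurs only next to one of the summands \<open>e I\<close>, \<open>b M\<close>, \<open>S\<close> of its inverse, or inside
  \<open>W = X P X\<^sup>T\<close>. The traces are then controlled by \<open>trace_inverse_dominated\<close>, and \<open>W\<close> by its
  trace.
\<close>
lemma haff_bounded:
  fixes X :: "real^'p^'m" and Q :: "real^'p^'p"
  assumes b: "0 < b"
  obtains C where "\<forall>e S. 0 < e \<longrightarrow> psd S \<longrightarrow>
      \<bar>haff1 n Q (transpose X ** X) (matrix_inv (mat e + b *\<^sub>R (transpose X ** X) + S)) S\<bar> \<le> C"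
    "\<forall>e S. 0 < e \<longrightarrow> psd S \<longrightarrow>
      \<bar>haff2 n Q (transpose X ** X) (matrix_inv (mat e + b *\<^sub>R (transpose X ** X) + S)) S\<bar> \<le> C"
proof -
  define M where "M = transpose X ** X"
  have M: "psd M" unfolding M_def by (rule psd_gram)
  have sM: "transpose M = M" using M by (simp add: psd_def)
  define p where "p = real CARD('p)"
  have p: "0 \<le> p" by (simp add: p_def)
  define x where "x = norm X"
  define c1 where "c1 = p * norm Q * (norm M + norm M * p + b * (x * (p / b) * x))"
  define c2 where "c2 = p * norm Q * (x * (p / b) * x + x * (p / b) * x * p + b * (x * (p / b) * (p / b) * x))"
  define C1 where "C1 = c1 + (real n * (p / b) + (p / b + p * (p / b)))"
  define C2 where "C2 = c2 + (real n * (p / b / b) + (p / b / b + p * (p / b / b) + p / b / b + p / b * (p / b)))"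
  have "\<bar>haff1 n Q M (matrix_inv (mat e + b *\<^sub>R M + S)) S\<bar> \<le> C1 \<and>
      \<bar>haff2 n Q M (matrix_inv (mat e + b *\<^sub>R M + S)) S\<bar> \<le> C2" if e: "0 < e" and S: "psd S" for e S
  proof -
    define T where "T = mat e + b *\<^sub>R M + S"
    have E: "psd (mat e :: real^'p^'p)" by (intro pos_def_imp_psd pos_def_mat e)
    have bM: "psd (b *\<^sub>R M)" using b by (intro psd_scaleR M) auto
    have T: "pos_def T" unfolding T_def by (intro pos_def_add pos_def_mat e bM S)
    define P where "P = matrix_inv T"
    have P: "psd P" unfolding P_def by (intro pos_def_imp_psd pos_def_matrix_inv T)
    have PT: "P ** T = mat 1" unfolding P_def by (rule matrix_inv_left[OF invertible_pos_def[OF T]])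
    have TS: "psd (T - S)" "psd (T - b *\<^sub>R M)" "psd (T - mat e)"
      using psd_add[OF E bM] psd_add[OF E S] psd_add[OF bM S] by (simp_all add: T_def algebra_simps)
    \<comment> \<open>This removes the unbounded matrix \<open>S\<close> from the terms that contain \<open>Q\<close>.\<close>
    have PS: "P ** S = mat 1 - e *\<^sub>R P - b *\<^sub>R (P ** M)"
    proof -
      have "S = T - e *\<^sub>R mat 1 - b *\<^sub>R M" by (simp add: T_def mat_eq_scaleR[of e])
      then show ?thesis by (simp add: mm.diff_right mm.scaleR_right PT)
    qed
    have MPM: "psd (M ** P ** M)" using psd_congruence[OF P, of M] by (simp add: sM)
    note bS = trace_inverse_dominated[OF T S TS(1), folded P_def, folded p_def]
    note bMM = trace_inverse_dominated[OF T bM TS(2), folded P_def, folded p_def]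
    note bE = trace_inverse_dominated[OF T E TS(3), folded P_def, folded p_def]
    have a: "0 \<le> trace (P ** S)" "trace (P ** S) \<le> p" by (rule bS(3)[OF M], rule bS(4)[OF M])
    have u1: "0 \<le> trace (P ** M)" "trace (P ** M) \<le> p / b"
      using bMM(3)[OF M] bMM(4)[OF M] b by (auto simp: mm.scaleR_right trace_scaleR field_simps zero_le_mult_iff)
    have a1: "0 \<le> trace (P ** M ** P ** S)" "trace (P ** M ** P ** S) \<le> p / b"
      using bS(1)[OF M] bS(2)[OF M] u1 by auto
    have u2: "0 \<le> trace (P ** M ** P ** M)" "trace (P ** M ** P ** M) \<le> p / b / b"
    proof -
      have "0 \<le> b * trace (P ** M ** P ** M)" "b * trace (P ** M ** P ** M) \<le> p / b"
        using bMM(1)[OF M] bMM(2)[OF M] u1 by (auto simp: mm.scaleR_right trace_scaleR)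
      then show "0 \<le> trace (P ** M ** P ** M)" "trace (P ** M ** P ** M) \<le> p / b / b"
        using b by (auto simp: zero_le_mult_iff pos_le_divide_eq mult.commute)
    qed
    have a2: "0 \<le> trace (P ** M ** P ** M ** P ** S)" "trace (P ** M ** P ** M ** P ** S) \<le> p / b / b"
      using bS(1)[OF MPM] bS(2)[OF MPM] u2 by (auto simp: matrix_mul_assoc)
    define W where "W = X ** P ** transpose X"
    have W: "psd W" unfolding W_def using psd_congruence[OF P, of "transpose X"] by simp
    have nW: "norm W \<le> p / b"
    proof -
      have "norm W \<le> trace W" by (rule norm_psd_le_trace[OF W])
      also have "trace W = trace (X ** (P ** transpose X))" by (simp only: W_def matrix_mul_assoc)
      also have "\<dots> = trace ((P ** transpose X) ** X)" by (rule trace_mul_sym)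
      also have "\<dots> = trace (P ** M)" by (simp only: M_def matrix_mul_assoc)
      finally show ?thesis using u1 by simp
    qed
    have nX: "norm X \<le> x" "norm (transpose X) \<le> x" by (auto simp: x_def)
    have W1: "M ** P ** M = transpose X ** W ** X" "M ** P ** M ** P ** M = transpose X ** W ** W ** X"
      by (simp_all add: M_def W_def matrix_mul_assoc)
    have nMPM1: "norm (M ** P ** M) \<le> x * (p / b) * x"
      unfolding W1(1) by (rule norm_matrix_mult_mono[OF norm_matrix_mult_mono[OF nX(2) nW] nX(1)])
    have nMPM2: "norm (M ** P ** M ** P ** M) \<le> x * (p / b) * (p / b) * x"
      unfolding W1(2) by (rule norm_matrix_mult_mono[OF norm_matrix_mult_mono[OF norm_matrix_mult_mono[OF nX(2) nW] nW] nX(1)])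
    note nMPM = nMPM1 nMPM2
    have nP: "norm (e *\<^sub>R P) \<le> p"
    proof -
      have "norm (e *\<^sub>R P) \<le> trace (e *\<^sub>R P)" using e by (intro norm_psd_le_trace psd_scaleR P) auto
      also have "trace (e *\<^sub>R P) = trace (P ** mat e)"
        by (simp add: mat_eq_scaleR[of e] mm.scaleR_right)
      also have "trace (P ** mat e) \<le> p" by (rule bE(4)[OF M])
      finally show ?thesis .
    qed
    have bn: "norm (b *\<^sub>R A) \<le> b * a" if "norm A \<le> a" for A :: "real^'p^'p" and a
      using mult_left_mono[OF that, of b] b by simp
    have q1: "\<bar>trace (Q ** M ** P ** S)\<bar> \<le> c1"
    proof -
      have eq: "Q ** M ** P ** S = Q ** (M - M ** (e *\<^sub>R P) - b *\<^sub>R (M ** P ** M))"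
        by (simp add: matrix_mul_assoc[symmetric] PS mat_distrib)
      have "norm (M - M ** (e *\<^sub>R P) - b *\<^sub>R (M ** P ** M)) \<le> norm M + norm (M ** (e *\<^sub>R P)) + norm (b *\<^sub>R (M ** P ** M))"
        using norm_triangle_ineq4[of "M - M ** (e *\<^sub>R P)" "b *\<^sub>R (M ** P ** M)"]
          norm_triangle_ineq4[of M "M ** (e *\<^sub>R P)"] by linarith
      also have "\<dots> \<le> norm M + norm M * p + b * (x * (p / b) * x)"
        by (rule add_mono[OF add_mono[OF order_refl norm_matrix_mult_mono[OF order_refl nP]] bn[OF nMPM(1)]])
      finally have "norm (Q ** M ** P ** S) \<le> norm Q * (norm M + norm M * p + b * (x * (p / b) * x))"
        unfolding eq by (intro norm_matrix_mult_mono order_refl)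
      then have "p * norm (Q ** M ** P ** S) \<le> c1" unfolding c1_def mult.assoc[of p] using p by (rule mult_left_mono)
      then show ?thesis using abs_trace_le[of "Q ** M ** P ** S"] by (simp add: p_def)
    qed
    have q2: "\<bar>trace (Q ** M ** P ** M ** P ** S)\<bar> \<le> c2"
    proof -
      have eq: "Q ** M ** P ** M ** P ** S = Q ** (M ** P ** M - M ** P ** M ** (e *\<^sub>R P) - b *\<^sub>R (M ** P ** M ** P ** M))"
        by (simp add: matrix_mul_assoc[symmetric] PS mat_distrib)
      have "norm (M ** P ** M - M ** P ** M ** (e *\<^sub>R P) - b *\<^sub>R (M ** P ** M ** P ** M))
          \<le> norm (M ** P ** M) + norm (M ** P ** M ** (e *\<^sub>R P)) + norm (b *\<^sub>R (M ** P ** M ** P ** M))"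
        using norm_triangle_ineq4[of "M ** P ** M - M ** P ** M ** (e *\<^sub>R P)" "b *\<^sub>R (M ** P ** M ** P ** M)"]
          norm_triangle_ineq4[of "M ** P ** M" "M ** P ** M ** (e *\<^sub>R P)"] by linarith
      also have "\<dots> \<le> x * (p / b) * x + x * (p / b) * x * p + b * (x * (p / b) * (p / b) * x)"
        by (rule add_mono[OF add_mono[OF nMPM(1) norm_matrix_mult_mono[OF nMPM(1) nP]] bn[OF nMPM(2)]])
      finally have "norm (Q ** M ** P ** M ** P ** S)
          \<le> norm Q * (x * (p / b) * x + x * (p / b) * x * p + b * (x * (p / b) * (p / b) * x))"
        unfolding eq by (intro norm_matrix_mult_mono order_refl)
      then have "p * norm (Q ** M ** P ** M ** P ** S) \<le> c2" unfolding c2_def mult.assoc[of p] using p by (rule mult_left_mono)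
      then show ?thesis using abs_trace_le[of "Q ** M ** P ** M ** P ** S"] by (simp add: p_def)
    qed
    have pm: "\<bar>g * h\<bar> \<le> g' * h'" if "0 \<le> g" "g \<le> g'" "0 \<le> h" "h \<le> h'" for g h g' h' :: real
      using mult_mono[OF that(2,4)] that by simp
    have nu: "\<bar>real n * trace (P ** M)\<bar> \<le> real n * (p / b)" "\<bar>real n * trace (P ** M ** P ** M)\<bar> \<le> real n * (p / b / b)"
      by (rule pm[OF of_nat_0_le_iff order_refl u1], rule pm[OF of_nat_0_le_iff order_refl u2])
    have pr: "\<bar>trace (P ** S) * trace (P ** M)\<bar> \<le> p * (p / b)"
      "\<bar>trace (P ** S) * trace (P ** M ** P ** M)\<bar> \<le> p * (p / b / b)"
      "\<bar>trace (P ** M ** P ** S) * trace (P ** M)\<bar> \<le> p / b * (p / b)"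
      by (rule pm[OF a u1], rule pm[OF a u2], rule pm[OF a1 u1])
    have "\<bar>haff1 n Q M P S\<bar> \<le> C1"
      unfolding haff1_def C1_def using q1 nu(1) pr(1) a1 by linarith
    moreover have "\<bar>haff2 n Q M P S\<bar> \<le> C2"
      unfolding haff2_def C2_def using q2 nu(2) pr(2,3) a2 by linarith
    ultimately show ?thesis by (simp add: P_def T_def)
  qed
  then show ?thesis
    by (intro that[of "max C1 C2"]) (auto simp: M_def[symmetric] le_max_iff_disj)
qed

lemma measurable_haff [measurable]:
  fixes M Q :: "real^'p^'p"
  shows "(\<lambda>S. haff1 n Q M (matrix_inv (A + S)) S) \<in> borel_measurable borel"
    "(\<lambda>S. haff2 n Q M (matrix_inv (A + S)) S) \<in> borel_measurable borel"
  unfolding haff1_def haff2_def by measurable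

text \<open>
  The matrix \<open>b M\<close> is singular if \<open>m < p\<close>, so the identities are first taken with \<open>e I + b M\<close> in its
  place. Dominated convergence applies because \<open>S\<close> is almost surely positive definite, which makes the
  resolvents converge.
\<close>
theorem stein_haff:
  fixes \<Sigma> :: "real^'p^'p" and X :: "real^'p^'m"
  assumes \<Sigma>: "pos_def \<Sigma>" and n: "CARD('p) \<le> n" and b: "0 < b"
  defines "M \<equiv> transpose X ** X"
  shows "(\<integral>S. haff1 n (matrix_inv \<Sigma>) M (matrix_inv (b *\<^sub>R M + S)) S \<partial>wishart n \<Sigma>) = 0"
    and "(\<integral>S. haff2 n (matrix_inv \<Sigma>) M (matrix_inv (b *\<^sub>R M + S)) S \<partial>wishart n \<Sigma>) = 0"
proof -
  interpret prob_space "rows_law n \<Sigma>" by (rule prob_space_rows_law[OF \<Sigma>])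
  define Q where "Q = matrix_inv \<Sigma>"
  have M: "psd M" unfolding M_def by (rule psd_gram)
  have sM: "transpose M = M" using M by (simp add: psd_def)
  obtain C where C: "\<forall>e S. 0 < e \<longrightarrow> psd S \<longrightarrow> \<bar>haff1 n Q M (matrix_inv (mat e + b *\<^sub>R M + S)) S\<bar> \<le> C"
    "\<forall>e S. 0 < e \<longrightarrow> psd S \<longrightarrow> \<bar>haff2 n Q M (matrix_inv (mat e + b *\<^sub>R M + S)) S\<bar> \<le> C"
    by (rule haff_bounded[OF b, of n Q X, folded M_def]) (rule that)
  define e where "e j = 1 / real (Suc j)" for j
  have e: "0 < e j" for j by (simp add: e_def)
  have e0: "e \<longlonglongrightarrow> 0" unfolding e_def by (rule LIMSEQ_Suc[OF lim_1_over_n])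
  have Pl: "(\<lambda>j. matrix_inv (mat (e j) + b *\<^sub>R M + S)) \<longlonglongrightarrow> matrix_inv (b *\<^sub>R M + S)" if S: "pos_def S" for S
  proof (rule tendsto_matrix_inv)
    have "(\<lambda>j. e j *\<^sub>R mat 1 + b *\<^sub>R M + S) \<longlonglongrightarrow> 0 *\<^sub>R mat 1 + b *\<^sub>R M + S"
      by (intro tendsto_intros e0)
    then show "(\<lambda>j. mat (e j) + b *\<^sub>R M + S) \<longlonglongrightarrow> b *\<^sub>R M + S"
      unfolding mat_eq_scaleR[symmetric] by simp
    have "pos_def (S + b *\<^sub>R M)" using b by (intro pos_def_add S psd_scaleR M) auto
    then show "invertible (b *\<^sub>R M + S)" by (simp add: invertible_pos_def add.commute)
  qed
  have "(\<lambda>j. \<integral>z. haff1 n Q M (matrix_inv (mat (e j) + b *\<^sub>R M + gram n z)) (gram n z) \<partial>rows_law n \<Sigma>)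
      \<longlonglongrightarrow> (\<integral>z. haff1 n Q M (matrix_inv (b *\<^sub>R M + gram n z)) (gram n z) \<partial>rows_law n \<Sigma>)"
  proof (rule integral_dominated_convergence[where w = "\<lambda>_. C"])
    show "AE z in rows_law n \<Sigma>. (\<lambda>j. haff1 n Q M (matrix_inv (mat (e j) + b *\<^sub>R M + gram n z)) (gram n z))
        \<longlonglongrightarrow> haff1 n Q M (matrix_inv (b *\<^sub>R M + gram n z)) (gram n z)"
      using gram_pos_def_and_ln_det_integrable(1)[OF \<Sigma> n]
    proof eventually_elim
      case (elim z)
      show ?case unfolding haff1_def by (intro tendsto_intros tendsto_trace mm.tendsto Pl[OF elim])
    qed
    show "AE z in rows_law n \<Sigma>. norm (haff1 n Q M (matrix_inv (mat (e j) + b *\<^sub>R M + gram n z)) (gram n z)) \<le> C" for j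
      unfolding real_norm_def
      by (intro always_eventually allI C(1)[rule_format] e psd_gram_rows)
  qed (auto intro: measurable_compose[OF measurable_gram measurable_haff(1)])
  moreover have "(\<integral>z. haff1 n Q M (matrix_inv (mat (e j) + b *\<^sub>R M + gram n z)) (gram n z) \<partial>rows_law n \<Sigma>) = 0" for j
    unfolding Q_def by (rule haff1_regular[OF \<Sigma> _ sM]) (intro pos_def_add pos_def_mat e psd_scaleR M, use b in simp)
  ultimately have "(\<integral>z. haff1 n Q M (matrix_inv (b *\<^sub>R M + gram n z)) (gram n z) \<partial>rows_law n \<Sigma>) = 0"
    by (simp add: LIMSEQ_const_iff)
  then show "(\<integral>S. haff1 n (matrix_inv \<Sigma>) M (matrix_inv (b *\<^sub>R M + S)) S \<partial>wishart n \<Sigma>) = 0"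
    unfolding wishart_gram Q_def by (subst integral_distr[OF measurable_gram measurable_haff(1)])
  have "(\<lambda>j. \<integral>z. haff2 n Q M (matrix_inv (mat (e j) + b *\<^sub>R M + gram n z)) (gram n z) \<partial>rows_law n \<Sigma>)
      \<longlonglongrightarrow> (\<integral>z. haff2 n Q M (matrix_inv (b *\<^sub>R M + gram n z)) (gram n z) \<partial>rows_law n \<Sigma>)"
  proof (rule integral_dominated_convergence[where w = "\<lambda>_. C"])
    show "AE z in rows_law n \<Sigma>. (\<lambda>j. haff2 n Q M (matrix_inv (mat (e j) + b *\<^sub>R M + gram n z)) (gram n z))
        \<longlonglongrightarrow> haff2 n Q M (matrix_inv (b *\<^sub>R M + gram n z)) (gram n z)"
      using gram_pos_def_and_ln_det_integrable(1)[OF \<Sigma> n]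
    proof eventually_elim
      case (elim z)
      show ?case unfolding haff2_def by (intro tendsto_intros tendsto_trace mm.tendsto Pl[OF elim])
    qed
    show "AE z in rows_law n \<Sigma>. norm (haff2 n Q M (matrix_inv (mat (e j) + b *\<^sub>R M + gram n z)) (gram n z)) \<le> C" for j
      unfolding real_norm_def
      by (intro always_eventually allI C(2)[rule_format] e psd_gram_rows)
  qed (auto intro: measurable_compose[OF measurable_gram measurable_haff(2)])
  moreover have "(\<integral>z. haff2 n Q M (matrix_inv (mat (e j) + b *\<^sub>R M + gram n z)) (gram n z) \<partial>rows_law n \<Sigma>) = 0" for j
    unfolding Q_def by (rule haff2_regular[OF \<Sigma> _ sM]) (intro pos_def_add pos_def_mat e psd_scaleR M, use b in simp)
  ultimately have "(\<integral>z. haff2 n Q M (matrix_inv (b *\<^sub>R M + gram n z)) (gram n z) \<partial>rows_law n \<Sigma>) = 0"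
    by (simp add: LIMSEQ_const_iff)
  then show "(\<integral>S. haff2 n (matrix_inv \<Sigma>) M (matrix_inv (b *\<^sub>R M + S)) S \<partial>wishart n \<Sigma>) = 0"
    unfolding wishart_gram Q_def by (subst integral_distr[OF measurable_gram measurable_haff(2)])
qed

section \<open>Algebra of the improved estimator\<close>

lemma trace_pos_def_pos: assumes "pos_def (A :: real^'n^'n)" shows "0 < trace A"
proof -
  have "A \<noteq> 0"
    using det_pos_def[OF assms] by (auto simp: det_0[where 'n='n, unfolded mat_0])
  then have "0 < norm A" by simp
  then show ?thesis using norm_psd_le_trace[OF pos_def_imp_psd[OF assms]] by linarith
qed

lemma det_scaleR: "det (c *\<^sub>R (A :: real^'n^'n)) = c ^ CARD('n) * det A"
proof -
  have "c *\<^sub>R A = mat c ** A" by (simp add: mat_eq_scaleR[of c] mm.scaleR_left)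
  moreover have "det (mat c :: real^'n^'n) = c ^ CARD('n)" by (subst det_diagonal) (auto simp: mat_def)
  ultimately show ?thesis by (simp add: det_mul)
qed

text \<open>
  The definitions make no assumptions, so that these quantities are total functions of \<open>(X, S)\<close>, as
  required for integrating them over the whole sample space.
\<close>
locale ridge_defs =
  fixes X :: "real^'p^'m" and S :: "real^'p^'p" and \<beta> :: real
begin

definition M where "M = transpose X ** X"
definition P where "P = matrix_inv (\<beta> *\<^sub>R M + S)"
definition K where "K = \<beta> *\<^sub>R (X ** P ** transpose X)"
definition G where "G = mat 1 - K"
definition H where "H = M ** P ** S"
definition Z where "Z = X ** P ** S"
definition u1 where "u1 = trace (P ** M)"
definition u2 where "u2 = trace (P ** M ** P ** M)"
definition u3 where "u3 = trace (P ** M ** P ** M ** P ** M)"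

end

locale ridge = ridge_defs X S \<beta> for X :: "real^'p^'m" and S :: "real^'p^'p" and \<beta> :: real +
  assumes S: "pos_def S" and \<beta>: "0 < \<beta>"
begin

lemma psd_M: "psd M" unfolding M_def by (rule psd_gram)
lemma transpose_S: "transpose S = S" using S by (simp add: pos_def_def)

lemma pos_def_T: "pos_def (\<beta> *\<^sub>R M + S)"
  using pos_def_add[OF S psd_scaleR[OF psd_M, of \<beta>]] \<beta> by (simp add: add.commute)

lemma pos_def_P: "pos_def P" unfolding P_def by (rule pos_def_matrix_inv[OF pos_def_T])
lemma transpose_P: "transpose P = P" using pos_def_P by (simp add: pos_def_def)

lemma PS: "P ** S = mat 1 - \<beta> *\<^sub>R (P ** M)"
proof -
  have "P ** (\<beta> *\<^sub>R M + S) = mat 1"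
    unfolding P_def by (rule matrix_inv_left[OF invertible_pos_def[OF pos_def_T]])
  then show ?thesis by (simp add: mm.add_right mm.scaleR_right algebra_simps)
qed

lemma SP: "S ** P = mat 1 - \<beta> *\<^sub>R (M ** P)"
proof -
  have "(\<beta> *\<^sub>R M + S) ** P = mat 1"
    unfolding P_def by (rule matrix_inv_right[OF invertible_pos_def[OF pos_def_T]])
  then show ?thesis by (simp add: mm.add_left mm.scaleR_left algebra_simps)
qed

text \<open>
  The Woodbury formula for the \<open>m \<times> m\<close> inverse in the covariance estimator.
\<close>
lemma G_inverse: "matrix_inv (mat 1 + \<beta> *\<^sub>R (X ** matrix_inv S ** transpose X)) = G"
proof (rule matrix_inv_unique)
  define J where "J = matrix_inv S"
  have JS: "J ** S = mat 1" unfolding J_def by (rule matrix_inv_left[OF invertible_pos_def[OF S]])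
  have "J ** S ** P = J - \<beta> *\<^sub>R (J ** M ** P)"
    by (simp only: matrix_mul_assoc[symmetric] SP) (simp add: mm.diff_right mm.scaleR_right)
  then have P: "P = J - \<beta> *\<^sub>R (J ** M ** P)" by (simp only: JS matrix_mul_lid)
  have J: "J = P + \<beta> *\<^sub>R (J ** M ** P)" by (rule eq_diff_eq[THEN iffD1, OF P, symmetric])
  have "(mat 1 + \<beta> *\<^sub>R (X ** J ** transpose X)) ** G
      = mat 1 + \<beta> *\<^sub>R (X ** J ** transpose X) - \<beta> *\<^sub>R (X ** (P + \<beta> *\<^sub>R (J ** M ** P)) ** transpose X)"
    unfolding G_def K_def M_def
    by (simp add: mat_distrib matrix_mul_assoc scaleR_add_right)
  also have "\<dots> = mat 1" unfolding J[symmetric] by simp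
  finally show "(mat 1 + \<beta> *\<^sub>R (X ** matrix_inv S ** transpose X)) ** G = mat 1" by (simp only: J_def)
qed

lemma psd_K: "psd K"
  unfolding K_def using psd_congruence[OF pos_def_imp_psd[OF pos_def_P], of "transpose X"] \<beta>
  by (intro psd_scaleR) auto

lemma pos_def_G: "pos_def G"
proof -
  have "psd (X ** matrix_inv S ** transpose X)"
    using psd_congruence[OF pos_def_imp_psd[OF pos_def_matrix_inv[OF S]], of "transpose X"] by simp
  then show ?thesis
    unfolding G_inverse[symmetric] using \<beta>
    by (intro pos_def_matrix_inv pos_def_add pos_def_mat psd_scaleR) auto
qed

lemma H_eq: "H = transpose X ** G ** X"
proof -
  have "H = M ** (P ** S)" by (simp only: H_def matrix_mul_assoc)
  also have "\<dots> = transpose X ** G ** X"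
    by (simp add: PS G_def K_def M_def mat_distrib matrix_mul_assoc)
  finally show ?thesis .
qed

lemma psd_H: "psd H" unfolding H_eq by (rule psd_congruence[OF pos_def_imp_psd[OF pos_def_G]])

lemma Z_eq: "Z = G ** X"
proof -
  have "Z = X ** (P ** S)" by (simp only: Z_def matrix_mul_assoc)
  also have "\<dots> = G ** X" by (simp add: PS G_def K_def M_def mat_distrib matrix_mul_assoc)
  finally show ?thesis .
qed

text \<open>
  Factor \<open>I + \<beta> S\<^sup>-\<^sup>1 M = S\<^sup>-\<^sup>1 (S + \<beta> M)\<close>.
\<close>
lemma Theta_G_eq: "Theta_G \<alpha> \<beta> X S = X - \<alpha> *\<^sub>R Z"
proof -
  define J where "J = matrix_inv S"
  have JS: "J ** S = mat 1" unfolding J_def by (rule matrix_inv_left[OF invertible_pos_def[OF S]])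
  have TP: "(\<beta> *\<^sub>R M + S) ** P = mat 1"
    unfolding P_def by (rule matrix_inv_right[OF invertible_pos_def[OF pos_def_T]])
  have "matrix_inv (mat 1 + \<beta> *\<^sub>R (J ** transpose X ** X)) = P ** S"
  proof (rule matrix_inv_unique)
    have "mat 1 + \<beta> *\<^sub>R (J ** transpose X ** X) = J ** (\<beta> *\<^sub>R M + S)"
      by (simp add: mm.add_right mm.scaleR_right JS M_def matrix_mul_assoc)
    then have "(mat 1 + \<beta> *\<^sub>R (J ** transpose X ** X)) ** (P ** S) = J ** ((\<beta> *\<^sub>R M + S) ** P) ** S"
      by (simp only: matrix_mul_assoc)
    then show "(mat 1 + \<beta> *\<^sub>R (J ** transpose X ** X)) ** (P ** S) = mat 1" by (simp add: TP JS)
  qed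
  then show ?thesis by (simp add: Theta_G_def J_def Z_def matrix_mul_assoc)
qed

lemma Sigma_G1_eq: "Sigma_G1 n \<alpha> \<beta> X S = (1 / real n) *\<^sub>R (S + \<alpha> *\<^sub>R H)"
  unfolding Sigma_G1_def Sigma_hat0_def G_inverse H_eq by (simp add: scaleR_add_right)

lemma trace_K:
  "trace K = \<beta> * u1" "trace (K ** K) = \<beta> * \<beta> * u2" "trace (K ** K ** K) = \<beta> * \<beta> * \<beta> * u3"
proof -
  have c: "trace (X ** A ** transpose X) = trace (A ** M)" for A
  proof -
    have "trace (X ** A ** transpose X) = trace (X ** (A ** transpose X))" by (simp only: matrix_mul_assoc)
    also have "\<dots> = trace ((A ** transpose X) ** X)" by (rule trace_mul_sym)
    finally show ?thesis by (simp only: M_def matrix_mul_assoc)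
  qed
  show "trace K = \<beta> * u1" by (simp add: K_def trace_scaleR c u1_def)
  have "K ** K = (\<beta> * \<beta>) *\<^sub>R (X ** (P ** M ** P) ** transpose X)"
    by (simp add: K_def M_def mat_distrib matrix_mul_assoc)
  then show "trace (K ** K) = \<beta> * \<beta> * u2" by (simp add: trace_scaleR c u2_def)
  have "K ** K ** K = (\<beta> * \<beta> * \<beta>) *\<^sub>R (X ** (P ** M ** P ** M ** P) ** transpose X)"
    by (simp add: K_def M_def mat_distrib matrix_mul_assoc)
  then show "trace (K ** K ** K) = \<beta> * \<beta> * \<beta> * u3" by (simp add: trace_scaleR c u3_def)
qed

text \<open>
  These are moments of the eigenvalues of \<open>K\<close>, which lie in \<open>[0,1)\<close>. Each inequality is the
  nonnegativity, for \<open>G\<close> the positivity, of the trace of a product of \<open>K\<close> and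
  \<open>G = I - K\<close>: in order
  \<open>K\<close>, \<open>K\<^sup>2\<close>, \<open>K G\<close>, \<open>G\<close>, \<open>G K G\<close>, \<open>G\<^sup>2\<close>, \<open>K\<^sup>3\<close>, \<open>K\<^sup>2 G\<close>.
\<close>
lemma k_bounds:
  defines "k1 \<equiv> \<beta> * u1" and "k2 \<equiv> \<beta> * \<beta> * u2" and "k3 \<equiv> \<beta> * \<beta> * \<beta> * u3"
  shows "0 \<le> k1" "0 \<le> k2" "k2 \<le> k1" "k1 < real CARD('m)" "0 \<le> k1 - 2 * k2 + k3"
    "0 \<le> real CARD('m) - 2 * k1 + k2" "0 \<le> k3" "k3 \<le> k2"
proof -
  note k = trace_K[folded k1_def k2_def k3_def]
  have sK: "transpose K = K" and sG: "transpose G = G"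
    using psd_K pos_def_G by (auto simp: psd_def pos_def_def)
  have pG: "psd G" by (rule pos_def_imp_psd[OF pos_def_G])
  have KK: "psd (K ** K)" using psd_gram[of K] by (simp add: sK)
  show "0 \<le> k1" using trace_psd_nonneg[OF psd_K] by (simp only: k)
  show "0 \<le> k2" using trace_psd_nonneg[OF KK] by (simp only: k)
  have "0 \<le> trace (K ** G)" by (rule trace_psd_mult_nonneg[OF psd_K pG])
  then show "k2 \<le> k1" by (simp add: G_def mm.diff_right trace_sub k)
  show "k1 < real CARD('m)" using trace_pos_def_pos[OF pos_def_G] by (simp add: G_def trace_sub trace_I k)
  have "0 \<le> trace (G ** K ** G)" using trace_psd_nonneg[OF psd_congruence[OF psd_K, of G]] by (simp only: sG)
  moreover have "G ** K ** G = K - K ** K - K ** K + K ** K ** K"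
    by (simp add: G_def mm.diff_left mm.diff_right)
  ultimately have "0 \<le> k1 - k2 - k2 + k3" by (simp only: trace_sub trace_add k)
  then show "0 \<le> k1 - 2 * k2 + k3" by linarith
  have "0 \<le> trace (G ** G)" using trace_psd_nonneg[OF psd_gram[of G]] by (simp only: sG)
  moreover have "G ** G = mat 1 - K - K + K ** K" by (simp add: G_def mm.diff_left mm.diff_right)
  ultimately have "0 \<le> real CARD('m) - k1 - k1 + k2" by (simp only: trace_sub trace_add trace_I k)
  then show "0 \<le> real CARD('m) - 2 * k1 + k2" by linarith
  show "0 \<le> k3" using trace_psd_mult_nonneg[OF KK psd_K] by (simp only: k)
  have "0 \<le> trace (K ** K ** G)" by (rule trace_psd_mult_nonneg[OF KK pG])
  then show "k3 \<le> k2" by (simp add: G_def mm.diff_right trace_sub k)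
qed

lemma norm_Z_le: "norm Z \<le> real CARD('m) * norm X"
proof -
  have "norm G \<le> trace G" by (rule norm_psd_le_trace[OF pos_def_imp_psd[OF pos_def_G]])
  also have "\<dots> \<le> real CARD('m)" using k_bounds(1) by (simp add: G_def trace_sub trace_I trace_K)
  finally show ?thesis unfolding Z_eq by (intro norm_matrix_mult_mono order_refl)
qed

lemma trace_PS: "trace (P ** S) = real CARD('p) - \<beta> * u1"
  by (simp add: PS trace_sub trace_I trace_scaleR u1_def)

lemma trace_PMPS: "trace (P ** M ** P ** S) = u1 - \<beta> * u2"
proof -
  have "P ** M ** P ** S = P ** M ** (P ** S)" by (simp only: matrix_mul_assoc)
  then show ?thesis by (simp add: PS mat_distrib matrix_mul_assoc trace_sub trace_scaleR u1_def u2_def)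
qed

lemma trace_PMPMPS: "trace (P ** M ** P ** M ** P ** S) = u2 - \<beta> * u3"
proof -
  have "P ** M ** P ** M ** P ** S = P ** M ** P ** M ** (P ** S)" by (simp only: matrix_mul_assoc)
  then show ?thesis by (simp add: PS mat_distrib matrix_mul_assoc trace_sub trace_scaleR u2_def u3_def)
qed

lemma haff1_eq: "haff1 n Q M P S = trace (Q ** H)
    - (real n * u1 - (u1 - \<beta> * u2) - (real CARD('p) - \<beta> * u1) * u1)"
  by (simp add: haff1_def H_def trace_PS trace_PMPS u1_def[symmetric] matrix_mul_assoc)

lemma haff2_eq: "haff2 n Q M P S = trace (Q ** M ** P ** H)
    - (real n * u2 - 2 * (u2 - \<beta> * u3) - (real CARD('p) - \<beta> * u1) * u2 - (u1 - \<beta> * u2) * u1)"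
  by (simp add: haff2_def H_def trace_PS trace_PMPS trace_PMPMPS u1_def[symmetric] u2_def[symmetric]
      matrix_mul_assoc algebra_simps)

lemma quad_Z: "(Z ** Q) \<bullet> Z = trace (Q ** H) - \<beta> * trace (Q ** M ** P ** H)"
proof -
  have "(Z ** Q) \<bullet> Z = trace (Z ** (Q ** transpose Z))" by (simp only: inner_matrix_trace matrix_mul_assoc)
  also have "\<dots> = trace ((Q ** transpose Z) ** Z)" by (rule trace_mul_sym)
  also have "(Q ** transpose Z) ** Z = Q ** (S ** P) ** M ** P ** S"
    by (simp add: Z_def M_def matrix_transpose_mul transpose_S transpose_P matrix_mul_assoc)
  also have "\<dots> = Q ** H - \<beta> *\<^sub>R (Q ** M ** P ** H)"
    by (simp add: SP mat_distrib matrix_mul_assoc H_def)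
  finally show ?thesis by (simp add: trace_sub trace_scaleR)
qed

text \<open>
  The correction \<open>Z\<close>, as a function of \<open>X\<close>, is one of the ridge fields, and its divergence is a function
  of the traces \<open>u\<^sub>1\<close> and \<open>u\<^sub>2\<close>.
\<close>
lemma field1_S:
  shows "ridge_field.field1 S \<beta> S X = Z"
    and "(\<Sum>E\<in>Basis. ridge_field.field1' S \<beta> S X E \<bullet> E)
      = real CARD('m) * (real CARD('p) - \<beta> * u1) - \<beta> * ((u1 - \<beta> * u2) + u1 * (real CARD('p) - \<beta> * u1))"
proof -
  have loc: "ridge_field S \<beta>" using S \<beta> by unfold_locales auto
  have Ti: "ridge_field.Ti S \<beta> X = P"
    by (simp add: ridge_field.Ti_def[OF loc] ridge_field.Tm_def[OF loc] P_def M_def add.commute)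
  show "ridge_field.field1 S \<beta> S X = Z" by (simp add: ridge_field.field1_def[OF loc] Ti Z_def)
  have t1: "trace (X ** P ** transpose X) = u1"
    using trace_K(1) \<beta> by (simp add: K_def trace_scaleR)
  have t2: "(X ** P) \<bullet> (X ** P ** S) = u1 - \<beta> * u2"
  proof -
    have "(X ** P) \<bullet> (X ** P ** S) = trace (X ** (P ** S ** P ** transpose X))"
      by (simp add: inner_matrix_trace matrix_transpose_mul transpose_S transpose_P matrix_mul_assoc)
    also have "\<dots> = trace ((P ** S ** P ** transpose X) ** X)" by (rule trace_mul_sym)
    also have "(P ** S ** P ** transpose X) ** X = (P ** S) ** P ** M" by (simp only: M_def matrix_mul_assoc)
    also have "\<dots> = P ** M - \<beta> *\<^sub>R (P ** M ** P ** M)" by (simp add: PS mat_distrib)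
    finally show ?thesis by (simp add: trace_sub trace_scaleR u1_def u2_def)
  qed
  show "(\<Sum>E\<in>Basis. ridge_field.field1' S \<beta> S X E \<bullet> E)
      = real CARD('m) * (real CARD('p) - \<beta> * u1) - \<beta> * ((u1 - \<beta> * u2) + u1 * (real CARD('p) - \<beta> * u1))"
    unfolding ridge_field.field1_divergence[OF loc] Ti t1 t2 trace_PS ..
qed

text \<open>
  Whitening by \<open>S\<close>. The eigenvalues are at most \<open>c\<close> because \<open>c S - \<alpha> H = c S P S\<close> is positive
  semidefinite, and they have sum \<open>\<alpha> tr(M P) = c \<beta> u\<^sub>1\<close>.
\<close>
lemma ln_det_bounds:
  assumes \<alpha>: "0 < \<alpha>"
  defines "l \<equiv> ln (det (S + \<alpha> *\<^sub>R H)) - ln (det S)" and "c \<equiv> \<alpha> / \<beta>"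
  shows "2 * c / (2 + c) * (\<beta> * u1) \<le> l" "l \<le> c * (\<beta> * u1)"
proof -
  have W: "psd (\<alpha> *\<^sub>R H)" using \<alpha> by (intro psd_scaleR psd_H) auto
  obtain N :: "real^'p^'p" where N: "psd N" "det (S + \<alpha> *\<^sub>R H) = det S * det (mat 1 + N)"
    "trace N = trace (matrix_inv S ** (\<alpha> *\<^sub>R H))"
    "\<forall>c. psd (c *\<^sub>R S - \<alpha> *\<^sub>R H) \<longrightarrow> psd (mat c - N)"
    by (rule whitening[OF S W]) (rule that)
  have trN: "trace N = c * (\<beta> * u1)"
  proof -
    have "trace (matrix_inv S ** (M ** P ** S)) = trace ((M ** P ** S) ** matrix_inv S)" by (rule trace_mul_sym)
    also have "\<dots> = trace (M ** P)" by (simp add: inv_cancel(1)[OF invertible_pos_def[OF S]])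
    also have "\<dots> = u1" unfolding u1_def by (rule trace_mul_sym)
    finally show ?thesis using \<beta> by (simp add: N(3) H_def mm.scaleR_right trace_scaleR c_def)
  qed
  have "c *\<^sub>R S - \<alpha> *\<^sub>R H = c *\<^sub>R (S ** P ** S)"
  proof -
    have "S ** P ** S = S - \<beta> *\<^sub>R H" by (simp add: SP mm.diff_left mm.scaleR_left H_def)
    then show ?thesis using \<beta> by (simp add: c_def scaleR_diff_right)
  qed
  moreover have "psd (S ** P ** S)"
    using psd_congruence[OF pos_def_imp_psd[OF pos_def_P], of S] by (simp only: transpose_S)
  ultimately have cN: "psd (mat c - N)"
    using N(4) \<alpha> \<beta> by (simp add: psd_scaleR c_def)
  note b = ln_det_1_plus_ge[OF N(1) cN]
  have "l = ln (det (mat 1 + N))"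
    unfolding l_def N(2) using det_pos_def[OF S] b(2) by (subst ln_mult_pos) auto
  then show "2 * c / (2 + c) * (\<beta> * u1) \<le> l" "l \<le> c * (\<beta> * u1)"
    using b(1,3) by (simp_all add: trN)
qed

end

section \<open>The risk comparison\<close>

text \<open>
  The parameters stand for \<open>k\<^sub>j = tr K\<^sup>j\<close> and \<open>l = log(det(S + \<alpha> H)/det S)\<close>. The first line is the
  covariance part and the rest is the mean part.
  
  In the covariance part \<open>k\<^sub>2 + k\<^sub>1\<^sup>2 \<le> (1 + m) k\<^sub>1\<close>, and the bound on \<open>c\<close> implies
  \<open>(n - p + m)(2 + c) \<le> 2n\<close>, so this part is at most \<open>0\<close> by the lower bound on \<open>l\<close>. In the mean part
  set \<open>q = k\<^sub>1 - k\<^sub>2 = tr(K G)\<close> and \<open>g = m - k\<^sub>1 = tr G\<close>. The last line is at most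
  \<open>\<alpha> c (n - p + 2m + 1) g \<le> 2\<alpha> (p - m - 1) g\<close>, while the bracket above it is
  \<open>(p - m - 1) g + g\<^sup>2 + tr(G\<^sup>2)\<close>; the term \<open>g\<^sup>2 > 0\<close> makes the inequality strict.
\<close>
lemma risk_difference_negative:
  fixes n p m k1 k2 k3 \<alpha> \<beta> c l :: real
  assumes m: "1 \<le> m" and p: "m + 1 < p" and n: "p \<le> n" and \<alpha>: "0 < \<alpha>" and c: "0 < c"
    and cond: "c * (n - p + 2 * m + 1) \<le> 2 * (p - m - 1)"
    and k: "0 \<le> k1" "0 \<le> k2" "k2 \<le> k1" "k1 < m" "0 \<le> k1 - 2 * k2 + k3" "0 \<le> m - 2 * k1 + k2"
    and l: "2 * c / (2 + c) * k1 \<le> l"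
  shows "m * (c / n * ((n - p - 1) * k1 + k2 + k1 * k1)) - m * l
     - 2 * \<alpha> * (m * p - (m + 1 + p) * k1 + k2 + k1 * k1)
     + \<alpha> * c * ((n - p - 1) * (k1 - k2) + 2 * (k2 - k3) + 2 * k1 * (k1 - k2)) < 0"
proof -
  have n0: "0 < n" using m p n by linarith
  have "(n - p - 1) * k1 + k2 + k1 * k1 \<le> (n - p + m) * k1"
  proof -
    have "k1 * k1 \<le> m * k1" using k by (intro mult_right_mono) auto
    then show ?thesis using k(3) by (simp add: algebra_simps)
  qed
  then have "c / n * ((n - p - 1) * k1 + k2 + k1 * k1) \<le> c / n * ((n - p + m) * k1)"
    using c n0 by (intro mult_left_mono) auto
  also have "\<dots> = (c / n * (n - p + m)) * k1" by simp
  also have "\<dots> \<le> (2 * c / (2 + c)) * k1"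
  proof (rule mult_right_mono[OF _ k(1)])
    have "c * (n - p + m) \<le> c * (n - p + 2 * m + 1)" using c m by (intro mult_left_mono) auto
    then have "c * (n - p + m) \<le> 2 * (p - m)" using cond by (simp add: algebra_simps)
    then have "(n - p + m) * (2 + c) \<le> 2 * n" by (simp add: algebra_simps)
    then have "c * ((n - p + m) * (2 + c)) \<le> c * (2 * n)" using c by (intro mult_left_mono) auto
    then show "c / n * (n - p + m) \<le> 2 * c / (2 + c)"
      using c n0 by (simp add: field_simps)
  qed
  finally have "c / n * ((n - p - 1) * k1 + k2 + k1 * k1) \<le> l" using l by linarith
  then have g1: "m * (c / n * ((n - p - 1) * k1 + k2 + k1 * k1)) \<le> m * l"
    using m by (intro mult_left_mono) auto
  define q where "q = k1 - k2"
  define g where "g = m - k1"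
  have q: "0 \<le> q" "q \<le> g" and g: "0 < g" using k by (auto simp: q_def g_def)
  have "(n - p - 1) * q + 2 * (k2 - k3) + 2 * k1 * q \<le> (n - p + 2 * m + 1) * q"
  proof -
    have "k2 - k3 \<le> q" using k(5) by (simp add: q_def)
    moreover have "k1 * q \<le> m * q" using k q by (intro mult_right_mono) auto
    ultimately show ?thesis by (simp add: algebra_simps)
  qed
  also have "\<dots> \<le> (n - p + 2 * m + 1) * g" using q n m by (intro mult_left_mono) auto
  finally have "c * ((n - p - 1) * q + 2 * (k2 - k3) + 2 * k1 * q) \<le> c * ((n - p + 2 * m + 1) * g)"
    using c by (intro mult_left_mono) auto
  also have "\<dots> = (c * (n - p + 2 * m + 1)) * g" by simp
  also have "\<dots> \<le> (2 * (p - m - 1)) * g" using cond g by (intro mult_right_mono) auto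
  finally have "c * ((n - p - 1) * q + 2 * (k2 - k3) + 2 * k1 * q) < 2 * ((p - m - 1) * g + g * g)"
    using mult_pos_pos[OF g g] by (simp only: distrib_left mult.assoc)
  also have "\<dots> \<le> 2 * (m * p - (m + 1 + p) * k1 + k2 + k1 * k1)"
  proof -
    have "m * p - (m + 1 + p) * k1 + k2 + k1 * k1 = (p - m - 1) * g + g * g + (m - 2 * k1 + k2)"
      by (simp add: g_def algebra_simps)
    then show ?thesis using k(6) by simp
  qed
  finally have g2: "\<alpha> * (c * ((n - p - 1) * q + 2 * (k2 - k3) + 2 * k1 * q))
      < \<alpha> * (2 * (m * p - (m + 1 + p) * k1 + k2 + k1 * k1))"
    using \<alpha> by (rule mult_strict_left_mono)
  have combine: "A - L - 2 * \<alpha> * B + \<alpha> * c * E < 0" if "A \<le> L" "\<alpha> * (c * E) < \<alpha> * (2 * B)" for A L B E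
  proof -
    have "2 * \<alpha> * B = \<alpha> * (2 * B)" "\<alpha> * c * E = \<alpha> * (c * E)" by simp_all
    then show ?thesis using that by linarith
  qed
  show ?thesis by (rule combine[OF g1 g2[unfolded q_def]])
qed

section \<open>The Wishart law on the sample space\<close>

lemma sets_wishart [simp, measurable_cong]: "sets (wishart n \<Sigma>) = sets borel"
  by (simp add: wishart_def)


lemma prob_space_wishart: "pos_def (\<Sigma> :: real^'p^'p) \<Longrightarrow> prob_space (wishart n \<Sigma>)"
  unfolding wishart_gram by (intro prob_space.prob_space_distr prob_space_rows_law measurable_gram)

lemma closed_psd: "closed {S :: real^'p^'p. psd S}"
proof -
  have "continuous_on UNIV (\<lambda>S :: real^'p^'p. x \<bullet> (S *v x))" for x
    by (rule linear_continuous_on)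
      (auto simp: linear_conv_bounded_linear[symmetric] matrix_vector_mult_add_rdistrib inner_add_right
        scaleR_matrix_vector_assoc[symmetric] intro!: linearI)
  then have "closed {S :: real^'p^'p. 0 \<le> x \<bullet> (S *v x)}" for x
    by (intro closed_Collect_le) auto
  moreover have "closed {S :: real^'p^'p. transpose S = S}"
    by (intro closed_Collect_eq bounded_linear.continuous_on[OF bounded_linear_transpose] continuous_intros)
  moreover have "{S :: real^'p^'p. psd S} = {S. transpose S = S} \<inter> (\<Inter>x. {S. 0 \<le> x \<bullet> (S *v x)})"
    by (auto simp: psd_def)
  ultimately show ?thesis by auto
qed

lemma sets_pos_def: "{S :: real^'p^'p. pos_def S} \<in> sets borel"
proof -
  have "{S :: real^'p^'p. pos_def S} = {S. psd S} \<inter> {S. det S \<noteq> 0}"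
    using pos_def_if_psd_det pos_def_imp_psd det_pos_def by fastforce
  then show ?thesis by (simp only:) (intro sets.Int borel_closed borel_open closed_psd open_invertible)
qed

lemma wishart_pos_def_and_integrable:
  fixes \<Sigma> :: "real^'p^'p"
  assumes \<Sigma>: "pos_def \<Sigma>" and n: "CARD('p) \<le> n"
  shows "AE S in wishart n \<Sigma>. pos_def S"
    and "integrable (wishart n \<Sigma>) (\<lambda>S. ln (det S))"
    and "integrable (wishart n \<Sigma>) (\<lambda>S. trace (B ** S))"
proof -
  note g = gram_pos_def_and_ln_det_integrable[OF \<Sigma> n]
  show "AE S in wishart n \<Sigma>. pos_def S"
    unfolding wishart_gram
    by (subst AE_distr_iff[OF measurable_gram]) (use sets_pos_def g(1) in auto)
  show "integrable (wishart n \<Sigma>) (\<lambda>S. ln (det S))"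
    unfolding wishart_gram by (subst integrable_distr_eq[OF measurable_gram]) (use g(2) in auto)
  show "integrable (wishart n \<Sigma>) (\<lambda>S. trace (B ** S))"
    unfolding wishart_gram by (subst integrable_distr_eq[OF measurable_gram]) (use g(3) in auto)
qed

lemma integrable_pair_fst:
  fixes f :: "'a \<Rightarrow> real"
  assumes "prob_space B" "integrable A f" shows "integrable (A \<Otimes>\<^sub>M B) (\<lambda>w. f (fst w))"
proof -
  have "integrable (distr (A \<Otimes>\<^sub>M B) A fst) f"
    using assms(2) by (simp add: prob_space.distr_pair_fst[OF assms(1)])
  then show ?thesis by (subst (asm) integrable_distr_eq) (use assms(2) in auto)
qed

lemma integrable_pair_snd:
  fixes f :: "'b \<Rightarrow> real"
  assumes "prob_space A" "prob_space B" "integrable B f" shows "integrable (A \<Otimes>\<^sub>M B) (\<lambda>w. f (snd w))"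
proof -
  interpret pair_sigma_finite B A
    using assms(1,2) by (intro pair_sigma_finite.intro prob_space_imp_sigma_finite)
  show ?thesis
    using integrable_product_swap[OF integrable_pair_fst[OF assms(1,3)]]
    by (simp add: case_prod_unfold)
qed

section \<open>Losses of the two estimators\<close>

text \<open>
  After whitening by \<open>\<Sigma>\<close> the covariance part is \<open>tr N - log det N - p \<ge> 0\<close>. Nonnegativity is what allows
  the \<open>[0,\<infinity>]\<close>-valued risk to be computed as a Bochner integral.
\<close>
lemma kl_loss_nonneg:
  fixes \<Theta> \<Theta>' :: "real^'p^'m"
  assumes \<Sigma>: "pos_def \<Sigma>" and \<Sigma>': "pos_def \<Sigma>'"
  shows "0 \<le> kl_loss (\<Theta>', \<Sigma>') \<Theta> \<Sigma>"
proof -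
  obtain N :: "real^'p^'p" where N: "trace N = trace (matrix_inv \<Sigma> ** \<Sigma>')"
    "pos_def \<Sigma>' \<longrightarrow> pos_def N \<and> det \<Sigma>' = det \<Sigma> * det N"
    by (rule whitening[OF \<Sigma> pos_def_imp_psd[OF \<Sigma>']]) (rule that)
  have "ln (det \<Sigma>') = ln (det \<Sigma>) + ln (det N)"
    using N(2) \<Sigma>' det_pos_def[OF \<Sigma>] det_pos_def[of N] by (simp add: ln_mult_pos)
  moreover have "ln (det N) \<le> trace N - real CARD('p)" using N(2) \<Sigma>' by (intro ln_det_le_trace) simp
  ultimately have "0 \<le> trace (matrix_inv \<Sigma> ** \<Sigma>') - ln (det \<Sigma>') + ln (det \<Sigma>) - real CARD('p)"
    by (simp add: N(1))
  then have "0 \<le> real CARD('m) / 2 * (trace (matrix_inv \<Sigma> ** \<Sigma>') - ln (det \<Sigma>') + ln (det \<Sigma>) - real CARD('p))"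
    by simp
  moreover have "0 \<le> ((\<Theta>' - \<Theta>) ** matrix_inv \<Sigma>) \<bullet> (\<Theta>' - \<Theta>)"
  proof -
    define D where "D = \<Theta>' - \<Theta>"
    have "psd (transpose (transpose D) ** matrix_inv \<Sigma> ** transpose D)"
      by (intro psd_congruence pos_def_imp_psd pos_def_matrix_inv \<Sigma>)
    from trace_psd_nonneg[OF this] show ?thesis by (simp add: inner_matrix_trace D_def)
  qed
  ultimately show ?thesis unfolding kl_loss_eq[OF \<Sigma> \<Sigma>'] by simp
qed

lemma pos_def_Sigma_hat0: "pos_def S \<Longrightarrow> 0 < n \<Longrightarrow> pos_def (Sigma_hat0 n S)"
  unfolding Sigma_hat0_def by (intro pos_def_scaleR) auto

text \<open>
  The two functions below are explicit, measurable formulas on the whole sample space; on positive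
  definite \<open>S\<close> they are the loss of the natural estimator and twice the loss difference.
\<close>
definition base_loss :: "nat \<Rightarrow> real^'p^'m \<Rightarrow> real^'p^'p \<Rightarrow> real^'p^'m \<Rightarrow> real^'p^'p \<Rightarrow> real" where
  "base_loss n \<Theta> \<Sigma> X S = real CARD('m) / 2 * (trace (matrix_inv \<Sigma> ** S) / real n
      - (ln (det S) - real CARD('p) * ln (real n)) + ln (det \<Sigma>) - real CARD('p))
      + (((X - \<Theta>) ** matrix_inv \<Sigma>) \<bullet> (X - \<Theta>)) / 2"

definition loss_gap :: "nat \<Rightarrow> real \<Rightarrow> real \<Rightarrow> real^'p^'m \<Rightarrow> real^'p^'p \<Rightarrow> real^'p^'m \<Rightarrow> real^'p^'p \<Rightarrow> real" where
  "loss_gap n \<alpha> \<beta> \<Theta> \<Sigma> X S =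
     (let Q = matrix_inv \<Sigma>; H = ridge_defs.H X S \<beta>; Z = ridge_defs.Z X S \<beta>;
          h1 = trace (Q ** H); h2 = trace (Q ** ridge_defs.M X ** ridge_defs.P X S \<beta> ** H)
      in real CARD('m) * (\<alpha> / real n * h1 - (ln (det (S + \<alpha> *\<^sub>R H)) - ln (det S)))
         - 2 * \<alpha> * (((X - \<Theta>) ** Q) \<bullet> Z) + \<alpha> * \<alpha> * (h1 - \<beta> * h2))"

lemma ln_det_scaled:
  assumes "pos_def (S :: real^'p^'p)" "0 < n"
  shows "ln (det ((1 / real n) *\<^sub>R S)) = ln (det S) - real CARD('p) * ln (real n)"
  using det_pos_def[OF assms(1)] assms(2)
  by (simp add: det_scaleR ln_mult_pos ln_realpow ln_div power_one_over ln_inverse inverse_eq_divide[symmetric])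

lemma kl_loss_base:
  fixes X \<Theta> :: "real^'p^'m"
  assumes \<Sigma>: "pos_def \<Sigma>" and S: "pos_def S" and n: "0 < n"
  shows "kl_loss (X, Sigma_hat0 n S) \<Theta> \<Sigma> = base_loss n \<Theta> \<Sigma> X S"
  unfolding kl_loss_eq[OF \<Sigma> pos_def_Sigma_hat0[OF S n]] base_loss_def
  using ln_det_scaled[OF S n]
  by (simp add: Sigma_hat0_def mm.scaleR_right trace_scaleR)

lemma kl_loss_improved:
  fixes X \<Theta> :: "real^'p^'m"
  assumes \<Sigma>: "pos_def \<Sigma>" and S: "pos_def S" and n: "0 < n" and \<alpha>: "0 < \<alpha>" and \<beta>: "0 < \<beta>"
  shows "kl_loss (Theta_G \<alpha> \<beta> X S, Sigma_G1 n \<alpha> \<beta> X S) \<Theta> \<Sigma>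
      = base_loss n \<Theta> \<Sigma> X S + loss_gap n \<alpha> \<beta> \<Theta> \<Sigma> X S / 2"
    and "0 \<le> kl_loss (Theta_G \<alpha> \<beta> X S, Sigma_G1 n \<alpha> \<beta> X S) \<Theta> \<Sigma>"
proof -
  interpret ridge X S \<beta> using S \<beta> by unfold_locales
  define Q where "Q = matrix_inv \<Sigma>"
  have sQ: "transpose Q = Q" unfolding Q_def by (rule transpose_inverse_pos_def[OF \<Sigma>])
  have SH: "pos_def (S + \<alpha> *\<^sub>R H)" using \<alpha> by (intro pos_def_add S psd_scaleR psd_H) auto
  have S': "pos_def (Sigma_G1 n \<alpha> \<beta> X S)"
    unfolding Sigma_G1_eq using n by (intro pos_def_scaleR SH) auto
  show "0 \<le> kl_loss (Theta_G \<alpha> \<beta> X S, Sigma_G1 n \<alpha> \<beta> X S) \<Theta> \<Sigma>"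
    by (rule kl_loss_nonneg[OF \<Sigma> S'])
  have tr: "trace (Q ** Sigma_G1 n \<alpha> \<beta> X S) = trace (Q ** S) / real n + \<alpha> / real n * trace (Q ** H)"
    by (simp add: Sigma_G1_eq mm.scaleR_right mm.add_right trace_scaleR trace_add add_divide_distrib)
  have ld: "ln (det (Sigma_G1 n \<alpha> \<beta> X S)) = ln (det (S + \<alpha> *\<^sub>R H)) - real CARD('p) * ln (real n)"
    unfolding Sigma_G1_eq by (rule ln_det_scaled[OF SH n])
  define D where "D = X - \<Theta>"
  have "(Z ** Q) \<bullet> D = (D ** Q) \<bullet> Z" by (subst inner_matrix_mult_right) (simp only: sQ inner_commute)
  moreover have DZ: "Theta_G \<alpha> \<beta> X S - \<Theta> = D - \<alpha> *\<^sub>R Z" by (simp add: Theta_G_eq D_def)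
  ultimately have quad: "((Theta_G \<alpha> \<beta> X S - \<Theta>) ** Q) \<bullet> (Theta_G \<alpha> \<beta> X S - \<Theta>)
      = (D ** Q) \<bullet> D - 2 * \<alpha> * ((D ** Q) \<bullet> Z) + \<alpha> * \<alpha> * ((Z ** Q) \<bullet> Z)"
    unfolding DZ by (simp add: mm.diff_left mm.scaleR_left inner_diff_left inner_diff_right algebra_simps)
  show "kl_loss (Theta_G \<alpha> \<beta> X S, Sigma_G1 n \<alpha> \<beta> X S) \<Theta> \<Sigma>
      = base_loss n \<Theta> \<Sigma> X S + loss_gap n \<alpha> \<beta> \<Theta> \<Sigma> X S / 2"
    unfolding kl_loss_eq[OF \<Sigma> S'] base_loss_def loss_gap_def Let_def Q_def[symmetric] tr ld quad quad_Z D_def[symmetric]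
    by (simp add: algebra_simps add_divide_distrib diff_divide_distrib)
qed

section \<open>Integrating the loss difference\<close>

lemma integral_combination:
  fixes f a b d :: "'a \<Rightarrow> real"
  assumes "integrable M f" "integrable M a" "integrable M b" "integrable M d"
  shows "(\<integral>w. f w + (s * a w - t * d w + r * (a w - q * b w)) \<partial>M)
      = (\<integral>w. f w \<partial>M) + (s * (\<integral>w. a w \<partial>M) - t * (\<integral>w. d w \<partial>M) + r * ((\<integral>w. a w \<partial>M) - q * (\<integral>w. b w \<partial>M)))"
  using assms by simp

text \<open>
  For positive definite \<open>S\<close> every integrand is bounded by a multiple of \<open>1 + |X|\<^sup>2\<close>, apart from the base loss, whose
  integrability rests on that of \<open>tr(Q S)\<close> and \<open>log det S\<close>. The loss difference is
  split as \<open>D = J + \<close> (terms of mean zero), where \<open>J\<close> is negative almost everywhere.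
\<close>
theorem risk_strictly_smaller:
  fixes \<Theta> :: "real^'p^'m" and \<Sigma> :: "real^'p^'p" and \<alpha> \<beta> :: real and n :: nat
  assumes mp: "CARD('m) + 1 < CARD('p)" and n: "CARD('p) \<le> n" and \<alpha>: "0 < \<alpha>" and \<beta>: "0 < \<beta>"
    and cond: "\<alpha> / \<beta> \<le> 2 * (real CARD('p) - real CARD('m) - 1) / (real n - real CARD('p) + 2 * real CARD('m) + 1)"
    and \<Sigma>: "pos_def \<Sigma>"
  shows "risk n (\<lambda>X S. (Theta_G \<alpha> \<beta> X S, Sigma_G1 n \<alpha> \<beta> X S)) \<Theta> \<Sigma>
       < risk n (\<lambda>X S. (X, Sigma_hat0 n S)) \<Theta> \<Sigma>"
proof -
  define m p c Q where "m = real CARD('m)" and "p = real CARD('p)" and "c = \<alpha> / \<beta>" and "Q = matrix_inv \<Sigma>"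
  have n0: "0 < n" using n zero_less_card_finite[where 'a='p] by linarith
  have m1: "1 \<le> m" by (simp add: m_def Suc_le_eq)
  have m0: "0 \<le> m" using m1 by simp
  have p0: "0 \<le> p" by (simp add: p_def)
  have mp': "m + 1 < p" using mp by (simp add: m_def p_def)
  have np: "p \<le> real n" using n by (simp add: p_def)
  have c: "0 < c" using \<alpha> \<beta> by (simp add: c_def)
  have cond': "c * (real n - p + 2 * m + 1) \<le> 2 * (p - m - 1)"
  proof -
    have "0 < real n - p + 2 * m + 1" using np m1 by linarith
    then show ?thesis using cond by (simp add: c_def m_def p_def pos_le_divide_eq)
  qed
  let ?N = "matrix_normal \<Theta> \<Sigma>" and ?W = "wishart n \<Sigma>"
  have pN: "prob_space ?N" by (rule prob_space_matrix_normal[OF \<Sigma>])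
  have pW: "prob_space ?W" by (rule prob_space_wishart[OF \<Sigma>])
  interpret NW: pair_prob_space ?N ?W
    using pN pW by (intro pair_prob_space.intro pair_sigma_finite.intro prob_space_imp_sigma_finite)
  have mNW: "(f \<in> borel_measurable (?N \<Otimes>\<^sub>M ?W)) = (f \<in> borel_measurable (borel \<Otimes>\<^sub>M borel))"
    for f :: "(real^'p^'m) \<times> (real^'p^'p) \<Rightarrow> real"
    by (subst measurable_cong_sets[OF sets_pair_measure_cong refl]) (auto simp: matrix_normal_def)
  have pd_ae: "AE w in ?N \<Otimes>\<^sub>M ?W. pos_def (snd w)"
  proof (rule NW.AE_pair_measure)
    have "snd -` {S. pos_def S} \<inter> space (?N \<Otimes>\<^sub>M ?W) \<in> sets (?N \<Otimes>\<^sub>M ?W)"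
      by (rule measurable_sets[OF measurable_snd]) (simp add: sets_pos_def)
    then show "{w \<in> space (?N \<Otimes>\<^sub>M ?W). pos_def (snd w)} \<in> sets (?N \<Otimes>\<^sub>M ?W)"
      by (simp add: vimage_def Int_def conj_commute)
    show "AE X in ?N. AE S in ?W. pos_def (snd (X, S))"
      using wishart_pos_def_and_integrable(1)[OF \<Sigma> n] by simp
  qed
  have domX: "integrable (?N \<Otimes>\<^sub>M ?W) (\<lambda>w. C * (1 + (norm (fst w))\<^sup>2))" for C
  proof -
    have "integrable ?N (\<lambda>X. 1 + (norm X)\<^sup>2)" by (rule integrable_matrix_normal[OF \<Sigma>, where B = 1]) auto
    from integrable_pair_fst[OF pW this] show ?thesis by (rule integrable_mult_right)
  qed
  have int_dom: "integrable (?N \<Otimes>\<^sub>M ?W) f"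
    if meas: "f \<in> borel_measurable (borel \<Otimes>\<^sub>M borel)"
      and bd: "\<And>X S. pos_def S \<Longrightarrow> \<bar>f (X, S)\<bar> \<le> C * (1 + (norm X)\<^sup>2)" for f C
  proof (rule Bochner_Integration.integrable_bound[OF domX[of C]])
    show "f \<in> borel_measurable (?N \<Otimes>\<^sub>M ?W)" using meas by (simp only: mNW)
    show "AE w in ?N \<Otimes>\<^sub>M ?W. norm (f w) \<le> norm (C * (1 + (norm (fst w))\<^sup>2))"
      using pd_ae
    proof eventually_elim
      case (elim w)
      then show ?case using order_trans[OF bd[of "snd w" "fst w"] abs_ge_self] by simp
    qed
  qed
  define v1 v2 v3 where "v1 w = ridge_defs.u1 (fst w) (snd w) \<beta>" and "v2 w = ridge_defs.u2 (fst w) (snd w) \<beta>"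
    and "v3 w = ridge_defs.u3 (fst w) (snd w) \<beta>" for w :: "(real^'p^'m) \<times> (real^'p^'p)"
  define h1 where "h1 w = trace (Q ** ridge_defs.H (fst w) (snd w) \<beta>)" for w :: "(real^'p^'m) \<times> (real^'p^'p)"
  define h2 where "h2 w = trace (Q ** ridge_defs.M (fst w) ** ridge_defs.P (fst w) (snd w) \<beta>
      ** ridge_defs.H (fst w) (snd w) \<beta>)" for w :: "(real^'p^'m) \<times> (real^'p^'p)"
  define s where "s w = ((fst w - \<Theta>) ** Q) \<bullet> ridge_defs.Z (fst w) (snd w) \<beta>" for w
  define l where "l w = ln (det (snd w + \<alpha> *\<^sub>R ridge_defs.H (fst w) (snd w) \<beta>)) - ln (det (snd w))"
    for w :: "(real^'p^'m) \<times> (real^'p^'p)"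
  \<comment> \<open>The functions \<open>r1\<close>, \<open>r2\<close>, \<open>rs\<close> have the same means as \<open>h1\<close>, \<open>h2\<close>, \<open>s\<close> but are free of
      \<open>\<Theta>\<close> and \<open>\<Sigma>\<close>; \<open>a1\<close> and \<open>a2\<close> are the Stein-Haff defects \<open>h1 - r1\<close> and \<open>h2 - r2\<close>.\<close>
  define r1 where "r1 w = real n * v1 w - (v1 w - \<beta> * v2 w) - (p - \<beta> * v1 w) * v1 w" for w
  define r2 where "r2 w = real n * v2 w - 2 * (v2 w - \<beta> * v3 w) - (p - \<beta> * v1 w) * v2 w - (v1 w - \<beta> * v2 w) * v1 w" for w
  define rs where "rs w = m * (p - \<beta> * v1 w) - \<beta> * ((v1 w - \<beta> * v2 w) + v1 w * (p - \<beta> * v1 w))" for w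
  define a1 where "a1 w = haff1 n Q (transpose (fst w) ** fst w)
      (matrix_inv (\<beta> *\<^sub>R (transpose (fst w) ** fst w) + snd w)) (snd w)" for w :: "(real^'p^'m) \<times> (real^'p^'p)"
  define a2 where "a2 w = haff2 n Q (transpose (fst w) ** fst w)
      (matrix_inv (\<beta> *\<^sub>R (transpose (fst w) ** fst w) + snd w)) (snd w)" for w :: "(real^'p^'m) \<times> (real^'p^'p)"
  define D where "D w = loss_gap n \<alpha> \<beta> \<Theta> \<Sigma> (fst w) (snd w)" for w
  define L where "L w = base_loss n \<Theta> \<Sigma> (fst w) (snd w)" for w
  note defs = ridge_defs.u1_def ridge_defs.u2_def ridge_defs.u3_def ridge_defs.H_def ridge_defs.Z_def
    ridge_defs.P_def ridge_defs.M_def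
  have [measurable]: "v1 \<in> borel_measurable (borel \<Otimes>\<^sub>M borel)" "v2 \<in> borel_measurable (borel \<Otimes>\<^sub>M borel)"
    "v3 \<in> borel_measurable (borel \<Otimes>\<^sub>M borel)" "h1 \<in> borel_measurable (borel \<Otimes>\<^sub>M borel)"
    "h2 \<in> borel_measurable (borel \<Otimes>\<^sub>M borel)" "s \<in> borel_measurable (borel \<Otimes>\<^sub>M borel)"
    "l \<in> borel_measurable (borel \<Otimes>\<^sub>M borel)"
    unfolding v1_def v2_def v3_def h1_def h2_def s_def l_def defs by measurable
  have [measurable]: "a1 \<in> borel_measurable (borel \<Otimes>\<^sub>M borel)" "a2 \<in> borel_measurable (borel \<Otimes>\<^sub>M borel)"
    unfolding a1_def a2_def haff1_def haff2_def by measurable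
  have [measurable]: "r1 \<in> borel_measurable (borel \<Otimes>\<^sub>M borel)" "r2 \<in> borel_measurable (borel \<Otimes>\<^sub>M borel)"
    "rs \<in> borel_measurable (borel \<Otimes>\<^sub>M borel)"
    unfolding r1_def r2_def rs_def by measurable

  have kb: "0 \<le> \<beta> * v1 w" "0 \<le> \<beta> * \<beta> * v2 w" "\<beta> * \<beta> * v2 w \<le> \<beta> * v1 w" "\<beta> * v1 w < m"
    "0 \<le> \<beta> * v1 w - 2 * (\<beta> * \<beta> * v2 w) + \<beta> * \<beta> * \<beta> * v3 w" "0 \<le> m - 2 * (\<beta> * v1 w) + \<beta> * \<beta> * v2 w"
    "0 \<le> \<beta> * \<beta> * \<beta> * v3 w" "\<beta> * \<beta> * \<beta> * v3 w \<le> \<beta> * \<beta> * v2 w" if "pos_def (snd w)" for w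
  proof -
    interpret ridge "fst w" "snd w" \<beta> using that \<beta> by unfold_locales
    show "0 \<le> \<beta> * v1 w" "0 \<le> \<beta> * \<beta> * v2 w" "\<beta> * \<beta> * v2 w \<le> \<beta> * v1 w" "\<beta> * v1 w < m"
      "0 \<le> \<beta> * v1 w - 2 * (\<beta> * \<beta> * v2 w) + \<beta> * \<beta> * \<beta> * v3 w" "0 \<le> m - 2 * (\<beta> * v1 w) + \<beta> * \<beta> * v2 w"
      "0 \<le> \<beta> * \<beta> * \<beta> * v3 w" "\<beta> * \<beta> * \<beta> * v3 w \<le> \<beta> * \<beta> * v2 w"
      using k_bounds unfolding v1_def v2_def v3_def m_def by auto
  qed
  have a_eq: "a1 w = h1 w - r1 w" "a2 w = h2 w - r2 w" if "pos_def (snd w)" for w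
  proof -
    interpret ridge "fst w" "snd w" \<beta> using that \<beta> by unfold_locales
    show "a1 w = h1 w - r1 w"
      using haff1_eq[of n Q] unfolding a1_def h1_def r1_def v1_def v2_def p_def M_def P_def by simp
    show "a2 w = h2 w - r2 w"
      using haff2_eq[of n Q] unfolding a2_def h2_def r2_def v1_def v2_def v3_def p_def M_def P_def by simp
  qed
  have D_eq: "D w = m * (\<alpha> / real n * h1 w - l w) - 2 * \<alpha> * s w + \<alpha> * \<alpha> * (h1 w - \<beta> * h2 w)" for w
    unfolding D_def loss_gap_def Let_def h1_def h2_def s_def l_def m_def Q_def ..

  have Zb: "norm (ridge_defs.Z X S \<beta>) \<le> m * norm X" if "pos_def S" for X :: "real^'p^'m" and S
  proof -
    interpret ridge X S \<beta> using that \<beta> by unfold_locales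
    show ?thesis using norm_Z_le by (simp add: m_def)
  qed
  have Hb: "\<bar>h1 (X, S)\<bar> \<le> p * (norm Q * m) * (1 + (norm X)\<^sup>2)" if "pos_def S" for X S
  proof -
    interpret ridge X S \<beta> using that \<beta> by unfold_locales
    have "H = transpose X ** Z" by (simp add: H_eq Z_eq matrix_mul_assoc)
    then have "norm (Q ** H) \<le> norm Q * (norm (transpose X) * (m * norm X))"
      using Zb[OF that, of X] by (simp only:) (intro norm_matrix_mult_mono order_refl)
    then have "\<bar>trace (Q ** H)\<bar> \<le> p * (norm Q * (norm X * (m * norm X)))"
      using abs_trace_le[of "Q ** H"] mult_left_mono[of "norm (Q ** H)" _ p] p0
      unfolding p_def norm_transpose by (meson order_trans of_nat_0_le_iff)
    also have "\<dots> = p * (norm Q * m) * (norm X)\<^sup>2" by (simp add: power2_eq_square)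
    also have "\<dots> \<le> p * (norm Q * m) * (1 + (norm X)\<^sup>2)" using p0 m0 by (intro mult_left_mono) auto
    finally show ?thesis by (simp add: h1_def)
  qed
  have int_h1: "integrable (?N \<Otimes>\<^sub>M ?W) h1" by (rule int_dom[OF _ Hb]) measurable
  have int_h2: "integrable (?N \<Otimes>\<^sub>M ?W) h2"
  proof (rule int_dom)
    fix X :: "real^'p^'m" and S :: "real^'p^'p" assume S: "pos_def S"
    interpret ridge X S \<beta> using S \<beta> by unfold_locales
    have "\<bar>(Z ** Q) \<bullet> Z\<bar> \<le> norm (Z ** Q) * norm Z" by (rule Cauchy_Schwarz_ineq2)
    also have "\<dots> \<le> ((m * norm X) * norm Q) * (m * norm X)"
      using Zb[OF S, of X] m0 by (intro mult_mono norm_matrix_mult_mono order_refl) auto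
    also have "\<dots> = (m * m * norm Q) * (norm X)\<^sup>2" by (simp add: power2_eq_square)
    also have "\<dots> \<le> (m * m * norm Q) * (1 + (norm X)\<^sup>2)" using m0 by (intro mult_left_mono) auto
    finally have "\<bar>(Z ** Q) \<bullet> Z\<bar> \<le> (m * m * norm Q) * (1 + (norm X)\<^sup>2)" .
    moreover have "\<beta> * h2 (X, S) = h1 (X, S) - (Z ** Q) \<bullet> Z"
      by (simp add: quad_Z h1_def h2_def)
    ultimately have "\<beta> * \<bar>h2 (X, S)\<bar> \<le> (p * (norm Q * m) + m * m * norm Q) * (1 + (norm X)\<^sup>2)"
      using Hb[OF S, of X] abs_mult[of \<beta> "h2 (X, S)"] \<beta>
      by (simp add: distrib_right)
    then show "\<bar>h2 (X, S)\<bar> \<le> ((p * (norm Q * m) + m * m * norm Q) / \<beta>) * (1 + (norm X)\<^sup>2)"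
      using \<beta> by (simp add: field_simps)
  qed measurable
  have int_s: "integrable (?N \<Otimes>\<^sub>M ?W) s"
  proof (rule int_dom)
    fix X :: "real^'p^'m" and S :: "real^'p^'p" assume S: "pos_def S"
    have "\<bar>s (X, S)\<bar> \<le> norm ((X - \<Theta>) ** Q) * norm (ridge_defs.Z X S \<beta>)"
      unfolding s_def fst_conv snd_conv by (rule Cauchy_Schwarz_ineq2)
    also have "\<dots> \<le> ((norm X + norm \<Theta>) * norm Q) * (m * norm X)"
      using Zb[OF S, of X] by (intro mult_mono norm_matrix_mult_mono norm_triangle_ineq4 order_refl) auto
    also have "\<dots> = (norm Q * m) * ((norm X + norm \<Theta>) * norm X)" by simp
    also have "\<dots> \<le> (norm Q * m) * ((1 + norm \<Theta>) * (1 + (norm X)\<^sup>2))"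
    proof (intro mult_left_mono)
      have "norm X \<le> 1 + (norm X)\<^sup>2"
      proof -
        have "0 \<le> (norm X - 1 / 2) * (norm X - 1 / 2)" by simp
        then show ?thesis by (simp add: power2_eq_square algebra_simps)
      qed
      then have "norm \<Theta> * norm X \<le> norm \<Theta> * (1 + (norm X)\<^sup>2)" by (intro mult_left_mono) auto
      then show "(norm X + norm \<Theta>) * norm X \<le> (1 + norm \<Theta>) * (1 + (norm X)\<^sup>2)"
        by (simp add: power2_eq_square algebra_simps)
    qed (use m0 in auto)
    finally show "\<bar>s (X, S)\<bar> \<le> (norm Q * m * (1 + norm \<Theta>)) * (1 + (norm X)\<^sup>2)" by (simp add: mult.assoc)
  qed measurable
  have le1: "x \<le> x * (1 + (norm X)\<^sup>2)" if "0 \<le> x" for x and X :: "real^'p^'m"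
    using mult_left_mono[of 1 "1 + (norm X)\<^sup>2" x] that by simp
  have int_l: "integrable (?N \<Otimes>\<^sub>M ?W) l"
  proof (rule int_dom)
    fix X :: "real^'p^'m" and S :: "real^'p^'p" assume S: "pos_def S"
    interpret ridge X S \<beta> using S \<beta> by unfold_locales
    have b: "2 * c / (2 + c) * (\<beta> * v1 (X, S)) \<le> l (X, S)" "l (X, S) \<le> c * (\<beta> * v1 (X, S))"
      using ln_det_bounds[OF \<alpha>] by (simp_all only: l_def v1_def c_def fst_conv snd_conv)
    have "0 \<le> 2 * c / (2 + c) * (\<beta> * v1 (X, S))"
      by (rule mult_nonneg_nonneg[OF _ kb(1)]) (use S c in auto)
    with b have l0: "0 \<le> l (X, S)" and "l (X, S) \<le> c * (\<beta> * v1 (X, S))" by linarith+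
    moreover have "c * (\<beta> * v1 (X, S)) \<le> c * m" using kb(4)[of "(X, S)"] S c by (intro mult_left_mono) auto
    moreover have "c * m \<le> (c * m) * (1 + (norm X)\<^sup>2)" using c m0 by (intro le1) auto
    ultimately show "\<bar>l (X, S)\<bar> \<le> (c * m) * (1 + (norm X)\<^sup>2)"
      unfolding abs_of_nonneg[OF l0] by linarith
  qed measurable
  have int_u: "integrable (?N \<Otimes>\<^sub>M ?W) (\<lambda>w. f (v1 w) (v2 w) (v3 w))"
    if meas: "(\<lambda>w. f (v1 w) (v2 w) (v3 w)) \<in> borel_measurable (borel \<Otimes>\<^sub>M borel)"
      and cont: "continuous_on UNIV (\<lambda>(x, y, z). f x y z)" for f :: "real \<Rightarrow> real \<Rightarrow> real \<Rightarrow> real"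
  proof -
    \<comment> \<open>The bounded functions of \<open>K\<close> are handled together: \<open>(u\<^sub>1, u\<^sub>2, u\<^sub>3)\<close> stays in a compact box.\<close>
    define B where "B = {0..m / \<beta>} \<times> {0..m / (\<beta> * \<beta>)} \<times> {0..m / (\<beta> * \<beta> * \<beta>)}"
    have "compact B" unfolding B_def by (intro compact_Times compact_Icc)
    then have "bounded ((\<lambda>(x, y, z). f x y z) ` B)"
      by (intro compact_imp_bounded compact_continuous_image continuous_on_subset[OF cont]) auto
    then obtain C where C: "\<And>x y z. (x, y, z) \<in> B \<Longrightarrow> \<bar>f x y z\<bar> \<le> C"
      unfolding bounded_iff by fastforce
    have "(0, 0, 0) \<in> B" using m0 \<beta> by (simp add: B_def)
    then have C0: "0 \<le> C" by (rule order_trans[OF abs_ge_zero C])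
    have box: "x \<in> {0..m / b}" if "0 < b" "0 \<le> b * x" "b * x \<le> m" for b x
      using that by (simp add: zero_le_mult_iff pos_le_divide_eq mult.commute[of x])
    show ?thesis
    proof (rule int_dom[OF meas])
      fix X :: "real^'p^'m" and S :: "real^'p^'p" assume S: "pos_def S"
      have "(v1 (X, S), v2 (X, S), v3 (X, S)) \<in> B"
      proof -
        note k = kb[of "(X, S)", unfolded snd_conv, OF S]
        have "\<beta> * \<beta> * v2 (X, S) \<le> m" "\<beta> * \<beta> * \<beta> * v3 (X, S) \<le> m" using k by linarith+
        then show ?thesis unfolding B_def using k(1,2,4,7) \<beta>
          by (intro SigmaI box mult_pos_pos) (simp_all only: less_imp_le)
      qed
      from C[OF this] show "\<bar>f (v1 (X, S)) (v2 (X, S)) (v3 (X, S))\<bar> \<le> C * (1 + (norm X)\<^sup>2)"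
        using le1[OF C0, of X] by linarith
    qed
  qed
  have int_r1: "integrable (?N \<Otimes>\<^sub>M ?W) r1"
    unfolding r1_def[abs_def]
    by (rule int_u[of "\<lambda>x y z. real n * x - (x - \<beta> * y) - (p - \<beta> * x) * x"])
       (measurable, simp add: case_prod_unfold, intro continuous_intros)
  have int_r2: "integrable (?N \<Otimes>\<^sub>M ?W) r2"
    unfolding r2_def[abs_def]
    by (rule int_u[of "\<lambda>x y z. real n * y - 2 * (y - \<beta> * z) - (p - \<beta> * x) * y - (x - \<beta> * y) * x"])
       (measurable, simp add: case_prod_unfold, intro continuous_intros)
  have int_rs: "integrable (?N \<Otimes>\<^sub>M ?W) rs"
    unfolding rs_def[abs_def]
    by (rule int_u[of "\<lambda>x y z. m * (p - \<beta> * x) - \<beta> * ((x - \<beta> * y) + x * (p - \<beta> * x))"])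
       (measurable, simp add: case_prod_unfold, intro continuous_intros)
  have a_ae: "AE w in ?N \<Otimes>\<^sub>M ?W. h1 w - r1 w = a1 w" "AE w in ?N \<Otimes>\<^sub>M ?W. h2 w - r2 w = a2 w"
    using pd_ae by (eventually_elim, simp add: a_eq)+
  have int_a1: "integrable (?N \<Otimes>\<^sub>M ?W) a1"
    by (rule integrable_cong_AE_imp[OF Bochner_Integration.integrable_diff[OF int_h1 int_r1]])
       (use a_ae(1) in \<open>auto simp: mNW elim: eventually_mono\<close>)
  have int_a2: "integrable (?N \<Otimes>\<^sub>M ?W) a2"
    by (rule integrable_cong_AE_imp[OF Bochner_Integration.integrable_diff[OF int_h2 int_r2]])
       (use a_ae(2) in \<open>auto simp: mNW elim: eventually_mono\<close>)
  have zero1: "(\<integral>w. a1 w \<partial>(?N \<Otimes>\<^sub>M ?W)) = 0"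
    unfolding NW.integral_fst'[OF int_a1, symmetric]
    by (simp add: a1_def Q_def stein_haff(1)[OF \<Sigma> n \<beta>])
  have zero2: "(\<integral>w. a2 w \<partial>(?N \<Otimes>\<^sub>M ?W)) = 0"
    unfolding NW.integral_fst'[OF int_a2, symmetric]
    by (simp add: a2_def Q_def stein_haff(2)[OF \<Sigma> n \<beta>])
  define sd where "sd w = s w - rs w" for w
  have int_sd: "integrable (?N \<Otimes>\<^sub>M ?W) sd"
    unfolding sd_def[abs_def] by (rule Bochner_Integration.integrable_diff[OF int_s int_rs])
  have zeros: "(\<integral>w. sd w \<partial>(?N \<Otimes>\<^sub>M ?W)) = 0"
  proof -
    have i: "integrable (?N \<Otimes>\<^sub>M ?W) (case_prod (\<lambda>X S. s (X, S) - rs (X, S)))"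
      using Bochner_Integration.integrable_diff[OF int_s int_rs] by (simp add: case_prod_unfold)
    have "(\<integral>w. sd w \<partial>(?N \<Otimes>\<^sub>M ?W)) = (\<integral>S. (\<integral>X. s (X, S) - rs (X, S) \<partial>?N) \<partial>?W)"
      unfolding NW.integral_snd[OF i] by (simp add: case_prod_unfold sd_def)
    also have "\<dots> = (\<integral>S. 0 \<partial>?W)"
    proof (rule integral_cong_AE)
      show "AE S in ?W. (\<integral>X. s (X, S) - rs (X, S) \<partial>?N) = 0"
        using wishart_pos_def_and_integrable(1)[OF \<Sigma> n]
      proof eventually_elim
        case (elim S)
        have loc: "ridge_field S \<beta>" using elim \<beta> by unfold_locales auto
        have e: "s (X, S) = ((X - \<Theta>) ** matrix_inv \<Sigma>) \<bullet> ridge_field.field1 S \<beta> S X"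
          "rs (X, S) = (\<Sum>E\<in>Basis. ridge_field.field1' S \<beta> S X E \<bullet> E)" for X :: "real^'p^'m"
        proof -
          interpret ridge X S \<beta> using elim \<beta> by unfold_locales
          show "s (X, S) = ((X - \<Theta>) ** matrix_inv \<Sigma>) \<bullet> ridge_field.field1 S \<beta> S X"
            by (simp add: s_def field1_S(1) Q_def)
          show "rs (X, S) = (\<Sum>E\<in>Basis. ridge_field.field1' S \<beta> S X E \<bullet> E)"
            by (simp add: rs_def field1_S(2) v1_def v2_def m_def p_def)
        qed
        show ?case unfolding e
          using ridge_field.field1_stein[OF loc \<Sigma>, of \<Theta> S] by simp
      qed
      show "(\<lambda>S. \<integral>X. s (X, S) - rs (X, S) \<partial>?N) \<in> borel_measurable ?W"
        using borel_measurable_integrable[OF NW.integrable_snd[OF i]] .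
    qed simp
    finally show ?thesis by simp
  qed

  \<comment> \<open>The loss difference with each \<open>\<Theta>\<close>- or \<open>\<Sigma>\<close>-dependent term replaced by its counterpart of equal mean.\<close>
  define J where "J w = m * (\<alpha> / real n * r1 w) - m * l w - 2 * \<alpha> * rs w + \<alpha> * \<alpha> * (r1 w - \<beta> * r2 w)" for w
  have int_J: "integrable (?N \<Otimes>\<^sub>M ?W) J"
    unfolding J_def
    by (intro Bochner_Integration.integrable_add Bochner_Integration.integrable_diff integrable_mult_right
        int_r1 int_r2 int_rs int_l)
  have J_neg: "AE w in ?N \<Otimes>\<^sub>M ?W. J w < 0"
    using pd_ae
  proof eventually_elim
    case (elim w)
    interpret ridge "fst w" "snd w" \<beta> using elim \<beta> by unfold_locales
    define k1 k2 k3 where "k1 = \<beta> * v1 w" and "k2 = \<beta> * \<beta> * v2 w" and "k3 = \<beta> * \<beta> * \<beta> * v3 w"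
    have \<alpha>c: "\<alpha> = c * \<beta>" using \<beta> by (simp add: c_def)
    have l: "2 * c / (2 + c) * k1 \<le> l w"
      using ln_det_bounds(1)[OF \<alpha>] by (simp add: k1_def v1_def l_def c_def)
    have e1: "\<alpha> / real n * r1 w = c / real n * ((real n - p - 1) * k1 + k2 + k1 * k1)"
      by (simp add: \<alpha>c r1_def k1_def k2_def algebra_simps diff_divide_distrib add_divide_distrib)
    have e2: "rs w = m * p - (m + 1 + p) * k1 + k2 + k1 * k1"
      by (simp add: rs_def k1_def k2_def algebra_simps)
    have e3: "\<alpha> * \<alpha> * (r1 w - \<beta> * r2 w)
        = \<alpha> * c * ((real n - p - 1) * (k1 - k2) + 2 * (k2 - k3) + 2 * k1 * (k1 - k2))"
    proof -
      have "\<alpha> * (\<alpha> * (r1 w - \<beta> * r2 w)) = \<alpha> * (c * (\<beta> * (r1 w - \<beta> * r2 w)))" by (simp add: \<alpha>c mult.assoc)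
      moreover have "\<beta> * (r1 w - \<beta> * r2 w) = (real n - p - 1) * (k1 - k2) + 2 * (k2 - k3) + 2 * k1 * (k1 - k2)"
        by (simp add: r1_def r2_def k1_def k2_def k3_def algebra_simps)
      ultimately show ?thesis by (simp add: mult.assoc)
    qed
    show ?case
      unfolding J_def e1 e2 e3
      by (rule risk_difference_negative[OF m1 mp' np \<alpha> c cond']) (use kb[OF elim] l in \<open>auto simp: k1_def k2_def k3_def\<close>)
  qed
  have D_ae: "AE w in ?N \<Otimes>\<^sub>M ?W. D w = J w + (m * (\<alpha> / real n) * a1 w - 2 * \<alpha> * sd w + \<alpha> * \<alpha> * (a1 w - \<beta> * a2 w))"
    using pd_ae by eventually_elim (simp add: D_eq J_def sd_def a_eq algebra_simps diff_divide_distrib)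
  have int_D: "integrable (?N \<Otimes>\<^sub>M ?W) D"
    unfolding D_eq
    by (intro Bochner_Integration.integrable_add Bochner_Integration.integrable_diff integrable_mult_right
        int_h1 int_h2 int_s int_l)
  have "(\<integral>w. D w \<partial>(?N \<Otimes>\<^sub>M ?W)) = (\<integral>w. J w + (m * (\<alpha> / real n) * a1 w - 2 * \<alpha> * sd w
      + \<alpha> * \<alpha> * (a1 w - \<beta> * a2 w)) \<partial>(?N \<Otimes>\<^sub>M ?W))"
    by (rule integral_cong_AE[OF _ _ D_ae])
       (use int_D int_J int_a1 int_a2 int_sd in \<open>auto intro!: borel_measurable_integrable\<close>)
  also have "\<dots> = (\<integral>w. J w \<partial>(?N \<Otimes>\<^sub>M ?W)) + (m * (\<alpha> / real n) * (\<integral>w. a1 w \<partial>(?N \<Otimes>\<^sub>M ?W))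
      - 2 * \<alpha> * (\<integral>w. sd w \<partial>(?N \<Otimes>\<^sub>M ?W))
      + \<alpha> * \<alpha> * ((\<integral>w. a1 w \<partial>(?N \<Otimes>\<^sub>M ?W)) - \<beta> * (\<integral>w. a2 w \<partial>(?N \<Otimes>\<^sub>M ?W))))"
    by (rule integral_combination[OF int_J int_a1 int_a2 int_sd])
  also have "\<dots> = (\<integral>w. J w \<partial>(?N \<Otimes>\<^sub>M ?W))" by (simp only: zero1 zero2 zeros) simp
  also have "\<dots> < 0"
    using NW.integral_less_AE_space[OF int_J integrable_zero J_neg] NW.P.emeasure_space_1 by simp
  finally have neg: "(\<integral>w. D w \<partial>(?N \<Otimes>\<^sub>M ?W)) < 0" .

  have int_L: "integrable (?N \<Otimes>\<^sub>M ?W) L"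
  proof -
    have "integrable ?N (\<lambda>X. ((X - \<Theta>) ** Q) \<bullet> (X ** mat 1 + (- \<Theta>)))"
      unfolding Q_def by (rule matrix_normal_stein_linear(2)[OF \<Sigma>])
    from integrable_pair_fst[OF pW this]
    have q: "integrable (?N \<Otimes>\<^sub>M ?W) (\<lambda>w. ((fst w - \<Theta>) ** Q) \<bullet> (fst w - \<Theta>))" by simp
    note t = integrable_pair_snd[OF pN pW wishart_pos_def_and_integrable(3)[OF \<Sigma> n, of Q]]
    note d = integrable_pair_snd[OF pN pW wishart_pos_def_and_integrable(2)[OF \<Sigma> n]]
    show ?thesis
      unfolding L_def base_loss_def Q_def[symmetric]
      by (intro Bochner_Integration.integrable_add Bochner_Integration.integrable_diff integrable_mult_right
          integrable_divide q t d NW.P.integrable_const)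
  qed
  have L0: "AE w in ?N \<Otimes>\<^sub>M ?W. 0 \<le> L w"
    using pd_ae
  proof eventually_elim
    case (elim w)
    then show ?case
      using kl_loss_nonneg[OF \<Sigma> pos_def_Sigma_hat0[OF elim n0], of "fst w" \<Theta>] kl_loss_base[OF \<Sigma> elim n0, of "fst w" \<Theta>]
      by (simp add: L_def)
  qed
  have L1: "AE w in ?N \<Otimes>\<^sub>M ?W. 0 \<le> L w + D w / 2"
    using pd_ae
  proof eventually_elim
    case (elim w)
    then show ?case
      using kl_loss_improved[OF \<Sigma> elim n0 \<alpha> \<beta>, where X = "fst w" and \<Theta> = \<Theta>] by (simp add: L_def D_def)
  qed
  have int_L1: "integrable (?N \<Otimes>\<^sub>M ?W) (\<lambda>w. L w + D w / 2)"
    by (intro Bochner_Integration.integrable_add integrable_divide int_L int_D)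
  have r0: "risk n (\<lambda>X S. (X, Sigma_hat0 n S)) \<Theta> \<Sigma> = ennreal (\<integral>w. L w \<partial>(?N \<Otimes>\<^sub>M ?W))"
  proof -
    have "risk n (\<lambda>X S. (X, Sigma_hat0 n S)) \<Theta> \<Sigma> = (\<integral>\<^sup>+w. ennreal (L w) \<partial>(?N \<Otimes>\<^sub>M ?W))"
      unfolding risk_def
    proof (rule nn_integral_cong_AE)
      show "AE w in ?N \<Otimes>\<^sub>M ?W. (case w of (X, S) \<Rightarrow> ennreal (kl_loss (X, Sigma_hat0 n S) \<Theta> \<Sigma>)) = ennreal (L w)"
        using pd_ae by eventually_elim (auto simp: L_def case_prod_unfold kl_loss_base[OF \<Sigma> _ n0])
    qed
    then show ?thesis by (simp add: nn_integral_eq_integral[OF int_L L0])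
  qed
  have r1': "risk n (\<lambda>X S. (Theta_G \<alpha> \<beta> X S, Sigma_G1 n \<alpha> \<beta> X S)) \<Theta> \<Sigma> = ennreal (\<integral>w. L w + D w / 2 \<partial>(?N \<Otimes>\<^sub>M ?W))"
  proof -
    have "risk n (\<lambda>X S. (Theta_G \<alpha> \<beta> X S, Sigma_G1 n \<alpha> \<beta> X S)) \<Theta> \<Sigma> = (\<integral>\<^sup>+w. ennreal (L w + D w / 2) \<partial>(?N \<Otimes>\<^sub>M ?W))"
      unfolding risk_def
    proof (rule nn_integral_cong_AE)
      show "AE w in ?N \<Otimes>\<^sub>M ?W. (case w of (X, S) \<Rightarrow> ennreal (kl_loss (Theta_G \<alpha> \<beta> X S, Sigma_G1 n \<alpha> \<beta> X S) \<Theta> \<Sigma>))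
          = ennreal (L w + D w / 2)"
        using pd_ae by eventually_elim
          (auto simp: L_def D_def case_prod_unfold kl_loss_improved(1)[OF \<Sigma> _ n0 \<alpha> \<beta>])
    qed
    then show ?thesis by (simp add: nn_integral_eq_integral[OF int_L1 L1])
  qed
  \<comment> \<open>Since the risk of the natural estimator is finite, the strict inequality survives.\<close>
  have "(\<integral>w. L w + D w / 2 \<partial>(?N \<Otimes>\<^sub>M ?W)) = (\<integral>w. L w \<partial>(?N \<Otimes>\<^sub>M ?W)) + (\<integral>w. D w \<partial>(?N \<Otimes>\<^sub>M ?W)) / 2"
    using int_L int_D by simp
  then have "(\<integral>w. L w + D w / 2 \<partial>(?N \<Otimes>\<^sub>M ?W)) < (\<integral>w. L w \<partial>(?N \<Otimes>\<^sub>M ?W))" using neg by simp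
  moreover have "0 \<le> (\<integral>w. L w + D w / 2 \<partial>(?N \<Otimes>\<^sub>M ?W))" by (rule integral_nonneg_AE[OF L1])
  ultimately show ?thesis unfolding r0 r1' by (simp add: ennreal_less_iff)
qed

theorem theorem4p3:
  fixes \<alpha> \<beta> :: real and n :: nat
  assumes "CARD('p::finite) > CARD('m::finite) + 1"
    and "n \<ge> CARD('p)"
    and "\<alpha> > 0" and "\<beta> > 0"
    and "\<alpha> / \<beta> \<le> 2 * (real CARD('p) - real CARD('m) - 1)
                  / (real n - real CARD('p) + 2 * real CARD('m) + 1)"
  shows "dominates n
           (\<lambda>(X :: real^'p^'m) (S :: real^'p^'p). (Theta_G \<alpha> \<beta> X S, Sigma_G1 n \<alpha> \<beta> X S))
           (\<lambda>X S. (X, Sigma_hat0 n S))"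
proof -
  have less: "risk n (\<lambda>X S. (Theta_G \<alpha> \<beta> X S, Sigma_G1 n \<alpha> \<beta> X S)) \<Theta> \<Sigma>
       < risk n (\<lambda>X S. (X, Sigma_hat0 n S)) \<Theta> \<Sigma>"
    if "pos_def \<Sigma>" for \<Theta> :: "real^'p^'m" and \<Sigma> :: "real^'p^'p"
    using risk_strictly_smaller[OF assms that] .
  have "pos_def (mat 1 :: real^'p^'p)" by (rule pos_def_mat) simp
  then show ?thesis
    unfolding dominates_def by (intro conjI allI impI exI[of _ "mat 1 :: real^'p^'p"] exI[of _ "0 :: real^'p^'m"])
      (assumption | rule less_imp_le less)+
qed

end
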